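(* $\mathbb{P}$-almost surely, for all $t\in\mathbb{R}$, $$\lim_{n\to+\infty}\mathbb{E}_X\left[e^{itf_n(X)}\right]=\frac{1}{2\pi}\int_0^{2\pi}e^{-\frac{t^2}{2}\times2\pi\psi_\rho(x)}\,dx=\mathbb{E}_{X,N}\left[e^{it\sqrt{2\pi\psi_\rho(X)}\,N}\right],$$ where $N$ is a standard Gaussian variable independent of $X$. In other words, $\mathbb{P}$-almost surely, the sequence of random variables $f_n(X)$ converges in distribution under $\mathbb{P}_X$ towards $\sqrt{2\pi\psi_\rho(X)}\,N$.
   Context: Let $\mu_\rho$ be a symmetric probability measure on $[-\pi,\pi]$ (the spectral measure), regarded as a measure on the circle $\mathbb{R}/2\pi\mathbb{Z}$, and let $\rho(k)=\int_{-\pi}^{\pi}e^{-ikx}\,\mu_\rho(dx)$, $k\in\mathbb{Z}$. No assumption is made on $\mu_\rho$; $\psi_\rho$ denotes the density with respect to Lebesgue measure of the absolutely continuous part of $\mu_\rho$ (with $\psi_\rho=0$ if $\mu_\rho$ is purely singular), regarded as a $2\pi$-periodic function. On a probability space $(\Omega,\mathcal{F},\mathbb{P})$ with expectation $\mathbb{E}$, let $(a_k)_{k\ge1}$ and $(b_k)_{k\ge1}$ be two independent centered stationary Gaussian sequences with $\mathbb{E}[a_ka_\ell]=\mathbb{E}[b_kb_\ell]=\rho(|k-\ell|)$ for $k,\ell\ge1$ (so each variable has variance $\rho(0)=1$). For $n\ge1$ set $f_n(x)=\frac{1}{\sqrt n}\sum_{k=1}^n a_k\cos(kx)+b_k\sin(kx)$.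 $X$ is a random variable uniformly distributed on $[0,2\pi]$, independent of the coefficients $(a_k),(b_k)$; $\mathbb{P}_X,\mathbb{E}_X$ denote probability and expectation with respect to $X$ only (the coefficients being fixed), and $\mathbb{E}_{X,N}$ the expectation with respect to $(X,N)$. *)

theory Defs
  imports "HOL-Probability.Probability"
begin

text \<open>
  Symmetric probability measures on the interval from \<open>-pi\<close> to \<open>pi\<close>, represented as Borel
  measures on the real line that give no mass to the complement of that interval.
\<close>

definition symmetric_spectral_measure :: "real measure \<Rightarrow> bool" where
  "symmetric_spectral_measure \<mu> \<longleftrightarrow>
     prob_space \<mu> \<and> sets \<mu> = sets borel \<and> (AE x in \<mu>. x \<in> {-pi..pi}) \<and>
     distr \<mu> borel uminus = \<mu>"

definition spectral_cov :: "real measure \<Rightarrow> int \<Rightarrow> complex" where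
  "spectral_cov \<mu> k = (CLINT x|\<mu>. iexp (- (of_int k * x)))"

text \<open>
  \<open>\<psi>\<close> is a version of the density of the absolutely continuous part of \<open>\<mu>\<close>, extended
  \<open>2 * pi\<close>-periodically: there is a Lebesgue decomposition \<open>\<mu> = \<psi> dx + \<nu>\<close> on the interval from
  \<open>-pi\<close> to \<open>pi\<close>, with \<open>\<nu>\<close> carried by a Lebesgue null set \<open>S\<close>. The density is determined up to
  Lebesgue null sets only; its existence is \<open>is_ac_density_exists\<close> below.
\<close>

definition is_ac_density :: "real measure \<Rightarrow> (real \<Rightarrow> real) \<Rightarrow> bool" where
  "is_ac_density \<mu> \<psi> \<longleftrightarrow>
     \<psi> \<in> borel_measurable borel \<and> (\<forall>x. 0 \<le> \<psi> x) \<and> (\<forall>x. \<psi> (x + 2 * pi) = \<psi> x) \<and>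
     (\<exists>\<nu> S. sets \<nu> = sets borel \<and> S \<in> null_sets lborel \<and> emeasure \<nu> (UNIV - S) = 0 \<and>
        (\<forall>A\<in>sets borel. emeasure \<mu> A =
           (\<integral>\<^sup>+x\<in>A \<inter> {-pi..pi}. ennreal (\<psi> x) \<partial>lborel) + emeasure \<nu> A))"

text \<open>
  Gaussian laws may be degenerate: for a general spectral measure the covariance matrices of the
  sequences need not be invertible (e.g. a Dirac mass at \<open>0\<close> gives a constant sequence).
\<close>

definition gaussian_rv :: "'w measure \<Rightarrow> ('w \<Rightarrow> real) \<Rightarrow> bool" where
  "gaussian_rv M Y \<longleftrightarrow> Y \<in> borel_measurable M \<and>
     ((\<exists>m \<sigma>. \<sigma> > 0 \<and> distributed M lborel Y (normal_density m \<sigma>)) \<or> (\<exists>m. AE \<omega> in M. Y \<omega> = m))"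

definition gaussian_process :: "'w measure \<Rightarrow> 'i set \<Rightarrow> ('i \<Rightarrow> 'w \<Rightarrow> real) \<Rightarrow> bool" where
  "gaussian_process M I Y \<longleftrightarrow> (\<forall>k\<in>I. Y k \<in> borel_measurable M) \<and>
     (\<forall>J c. finite J \<longrightarrow> J \<subseteq> I \<longrightarrow> gaussian_rv M (\<lambda>\<omega>. \<Sum>k\<in>J. c k * Y k \<omega>))"

text \<open>
  Indices start at \<open>1\<close>. Stationarity is the fact that the covariance depends only on the
  distance of the indices; for centered Gaussian sequences this is the same as invariance of the
  law under shifts.
\<close>

definition stationary_gaussian_seq ::
    "'w measure \<Rightarrow> (int \<Rightarrow> complex) \<Rightarrow> (nat \<Rightarrow> 'w \<Rightarrow> real) \<Rightarrow> bool" where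
  "stationary_gaussian_seq M \<rho> a \<longleftrightarrow>
     gaussian_process M {1..} a \<and>
     (\<forall>k\<ge>1. (LINT \<omega>|M. a k \<omega>) = 0) \<and>
     (\<forall>k\<ge>1. \<forall>l\<ge>1. complex_of_real (LINT \<omega>|M. a k \<omega> * a l \<omega>) = \<rho> \<bar>int k - int l\<bar>)"

definition indep_sequences ::
    "'w measure \<Rightarrow> (nat \<Rightarrow> 'w \<Rightarrow> real) \<Rightarrow> (nat \<Rightarrow> 'w \<Rightarrow> real) \<Rightarrow> bool" where
  "indep_sequences M a b \<longleftrightarrow>
     prob_space.indep_var M
       (PiM {1..} (\<lambda>_. borel)) (\<lambda>\<omega>. \<lambda>k\<in>{1..}. a k \<omega>)
       (PiM {1..} (\<lambda>_. borel)) (\<lambda>\<omega>. \<lambda>k\<in>{1..}. b k \<omega>)"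

definition trig_poly ::
    "(nat \<Rightarrow> 'w \<Rightarrow> real) \<Rightarrow> (nat \<Rightarrow> 'w \<Rightarrow> real) \<Rightarrow> nat \<Rightarrow> 'w \<Rightarrow> real \<Rightarrow> real" where
  "trig_poly a b n \<omega> x =
     1 / sqrt (real n) * (\<Sum>k=1..n. a k \<omega> * cos (real k * x) + b k \<omega> * sin (real k * x))"

lemma is_ac_density_exists:
  assumes \<mu>: "finite_measure \<mu>" and sets[measurable_cong, simp]: "sets \<mu> = sets borel"
    and supp: "AE x in \<mu>. x \<in> {-pi..pi}"
  shows "\<exists>\<psi>. is_ac_density \<mu> \<psi>"
proof -
  interpret finite_measure \<mu> by fact
  have sp[simp]: "space \<mu> = UNIV" using sets_eq_imp_space_eq[OF sets] by simp
  define N where "N = null_sets (lborel :: real measure)"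
  define s where "s = (SUP S\<in>N. emeasure \<mu> S)"
  have "N \<noteq> {}" unfolding N_def by (metis empty_iff null_sets.empty_sets)
  then obtain F where F: "range F \<subseteq> emeasure \<mu> ` N" "s = (SUP i::nat. F i)"
    using ennreal_SUP_countable_SUP[of N "emeasure \<mu>"] unfolding s_def by auto
  then have "\<forall>i. \<exists>S\<in>N. F i = emeasure \<mu> S" by blast
  then obtain T where T: "\<And>i. T i \<in> N" "\<And>i. F i = emeasure \<mu> (T i)" by metis
  define S where "S = (\<Union>i. T i)"
  have SN: "S \<in> N" unfolding S_def N_def using T(1) N_def by auto
  have NB: "A \<in> sets borel" if "A \<in> N" for A using that unfolding N_def by auto
  have [measurable]: "S \<in> sets borel" using NB[OF SN] .
  have s_le: "s \<le> emeasure \<mu> S"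
    unfolding F(2) T(2) by (rule SUP_least, rule emeasure_mono) (auto simp: S_def NB[OF SN, unfolded S_def])
  have le_s: "emeasure \<mu> A \<le> s" if "A \<in> N" for A
    unfolding s_def using that by (rule SUP_upper)
  have null: "emeasure \<mu> (A - S) = 0" if "A \<in> N" for A
  proof -
    have [measurable]: "A \<in> sets borel" using that by (rule NB)
    have "emeasure \<mu> S + emeasure \<mu> (A - S) = emeasure \<mu> (S \<union> (A - S))"
      by (rule plus_emeasure) auto
    also have "\<dots> \<le> s" by (rule le_s) (use that SN in \<open>auto simp: N_def\<close>)
    also have "\<dots> \<le> emeasure \<mu> S" by (rule s_le)
    finally show ?thesis
      by (metis add.right_neutral emeasure_finite ennreal_add_left_cancel_le infinity_ennreal_def le_zero_eq)
  qed
  define \<kappa> where "\<kappa> = density \<mu> (indicator (- S))"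
  have [measurable_cong, simp]: "sets \<kappa> = sets borel" by (simp add: \<kappa>_def)
  have \<kappa>: "emeasure \<kappa> A = emeasure \<mu> (A - S)" if [measurable]: "A \<in> sets borel" for A
    by (simp add: \<kappa>_def emeasure_density flip: indicator_inter_arith)
       (simp add: Diff_eq Int_commute)
  have fk: "finite_measure \<kappa>" by standard (simp add: \<kappa> sets_eq_imp_space_eq[of \<kappa> borel])
  have "absolutely_continuous lborel \<kappa>"
    unfolding absolutely_continuous_def
  proof
    fix A :: "real set" assume A: "A \<in> null_sets lborel"
    then have "A \<in> sets borel" by auto
    then show "A \<in> null_sets \<kappa>" using null[of A] A by (auto simp: N_def \<kappa> intro!: null_setsI)
  qed
  from sigma_finite_measure.Radon_Nikodym[OF sigma_finite_lborel this] obtain f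
    where f[measurable]: "f \<in> borel_measurable borel" and df: "density lborel f = \<kappa>" by auto
  have fin: "AE x in lborel. f x \<noteq> \<infinity>"
    using sigma_finite_measure.sigma_finite_iff_density_finite[OF sigma_finite_lborel, of f] fk df
    by (simp add: finite_measure.axioms(1) sigma_finite_measure_def finite_measure_def)
  define g :: "real \<Rightarrow> real" where "g x = x - 2 * pi * of_int \<lfloor>(x + pi) / (2 * pi)\<rfloor>" for x
  have gm[measurable]: "g \<in> borel_measurable borel" unfolding g_def by measurable
  have gper: "g (x + 2 * pi) = g x" for x
  proof -
    have "(x + 2 * pi + pi) / (2 * pi) = (x + pi) / (2 * pi) + 1" by (simp add: field_simps)
    then show ?thesis by (simp add: g_def algebra_simps)
  qed
  have gid: "g x = x" if "x \<in> {-pi..<pi}" for x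
  proof -
    have "\<lfloor>(x + pi) / (2 * pi)\<rfloor> = 0" using that by (simp add: floor_eq_iff field_simps)
    then show ?thesis by (simp add: g_def)
  qed
  define \<psi> where "\<psi> x = enn2real (f (g x))" for x
  define \<nu> where "\<nu> = density \<mu> (indicator S)"
  have \<nu>: "emeasure \<nu> A = emeasure \<mu> (A \<inter> S)" if [measurable]: "A \<in> sets borel" for A
    by (simp add: \<nu>_def emeasure_density flip: indicator_inter_arith) (simp add: Int_commute)
  have main: "emeasure \<mu> A = (\<integral>\<^sup>+x\<in>A \<inter> {-pi..pi}. ennreal (\<psi> x) \<partial>lborel) + emeasure \<nu> A"
    if A[measurable]: "A \<in> sets borel" for A
  proof -
    have "(\<integral>\<^sup>+x\<in>A \<inter> {-pi..pi}. ennreal (\<psi> x) \<partial>lborel) = (\<integral>\<^sup>+x\<in>A \<inter> {-pi..pi}. f x \<partial>lborel)"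
    proof (rule nn_integral_cong_AE)
      show "AE x in lborel. ennreal (\<psi> x) * indicator (A \<inter> {-pi..pi}) x =
              f x * indicator (A \<inter> {-pi..pi}) x"
        using fin AE_lborel_singleton[of pi]
      proof eventually_elim
        case (elim x)
        then show ?case
          by (cases "x \<in> {-pi..<pi}") (auto simp: \<psi>_def gid less_top indicator_def)
      qed
    qed
    also have "\<dots> = emeasure \<kappa> (A \<inter> {-pi..pi})"
      unfolding df[symmetric] by (subst emeasure_density) auto
    also have "\<dots> = emeasure \<mu> (A \<inter> {-pi..pi} - S)" by (rule \<kappa>) simp
    also have "\<dots> = emeasure \<mu> (A - S)"
      by (rule emeasure_eq_AE) (use supp in auto)
    finally have ac: "(\<integral>\<^sup>+x\<in>A \<inter> {-pi..pi}. ennreal (\<psi> x) \<partial>lborel) = emeasure \<mu> (A - S)" .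
    have "emeasure \<mu> (A - S) + emeasure \<mu> (A \<inter> S) = emeasure \<mu> ((A - S) \<union> (A \<inter> S))"
      by (rule plus_emeasure) auto
    also have "(A - S) \<union> (A \<inter> S) = A" by auto
    finally show ?thesis by (simp add: ac \<nu>)
  qed
  have "is_ac_density \<mu> \<psi>"
    unfolding is_ac_density_def
  proof (intro conjI exI[of _ \<nu>] exI[of _ S])
    show "\<psi> \<in> borel_measurable borel" unfolding \<psi>_def by measurable
    show "\<forall>x. \<psi> (x + 2 * pi) = \<psi> x" by (simp add: \<psi>_def gper)
    show "emeasure \<nu> (UNIV - S) = 0" by (subst \<nu>) (auto simp: Int_Diff Int_commute Diff_Int_distrib)
  qed (use SN main in \<open>auto simp: \<psi>_def N_def \<nu>_def\<close>)
  then show ?thesis by blast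
qed

end

theory Submission
  imports Defs
begin

text \<open>
  Fix \<open>t\<close> and let \<open>\<emp_char>\<^sub>n = E\<^sub>X[exp(i t f\<^sub>n(X))]\<close>, which is random through the coefficients. For fixed \<open>x\<close> the
  variable \<open>f\<^sub>n(x)\<close> is a centered Gaussian, and since the covariances are the Fourier coefficients of
  \<open>\<mu>\<close>, its variance is \<open>\<sigma>\<^sub>n\<^sup>2(x) = \<integral> F\<^sub>n(x - u) \<mu>(du)\<close>, where \<open>F\<^sub>n = |D\<^sub>n|\<^sup>2 / n\<close> is the Fejer kernel (of total
  mass \<open>2 pi\<close>) and \<open>D\<^sub>n(v) = \<Sum>\<^sub>k e\<^bsup>ikv\<^esup>\<close>, with \<open>k\<close> from \<open>1\<close> to \<open>n\<close>. Hence
  \<open>E[\<emp_char>\<^sub>n] = 1/(2 pi) \<integral> exp(- t\<^sup>2 \<sigma>\<^sub>n\<^sup>2(x) / 2) dx\<close>, and three things remain.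

  The mean converges. The functions \<open>\<sigma>\<^sub>n\<^sup>2\<close> tend to \<open>2 pi \<psi>\<close> in measure (\<open>fejer_ac_part\<close>), which suffices because
  the exponentials are bounded: on the absolutely continuous part Fejer's theorem gives convergence
  in \<open>L\<^sup>1\<close> (\<open>fejer_mean_L1\<close>), and the singular part, carried by a null set, is spread by the kernel
  over a set of small measure only (\<open>fejer_conv_null_set\<close>).

  The fluctuations vanish. By Fubini the variance of \<open>\<emp_char>\<^sub>n\<close> is at most \<open>t\<^sup>2\<close> times the \<open>L\<^sup>1\<close> norm of the covariance of
  \<open>f\<^sub>n(x)\<close> and \<open>f\<^sub>n(y)\<close> in \<open>(x, y)\<close>. This covariance is \<open>1/n \<integral> Re(D\<^sub>n(x - u) cnj(D\<^sub>n(y - u))) \<mu>(du)\<close>, so the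
  norm is bounded by the squared \<open>L\<^sup>1\<close> norm of \<open>D\<^sub>n\<close> over \<open>n\<close>, that is by \<open>O(log\<^sup>2 n / n)\<close>, for every \<open>\<mu>\<close>. The
  rate is summable along \<open>n = j\<^sup>4\<close> (\<open>emp_char_subsequence\<close>). For \<open>n\<close> between \<open>j\<^sup>4\<close> and \<open>(j + 1)\<^sup>4\<close>, Parseval's
  identity in \<open>x\<close> bounds \<open>|\<emp_char>\<^sub>n - \<emp_char>\<^sub>m|\<^sup>2\<close>, \<open>m = j\<^sup>4\<close>, by a weighted sum of the squared coefficients with
  total weight \<open>O(1/j)\<close>; Gaussian fourth moments make its second moment \<open>O(1/j\<^sup>2)\<close>, so the full
  sequence converges almost surely (\<open>emp_char_tendsto\<close>).

  One null set serves for all \<open>t\<close>. So far the null set depends on \<open>t\<close>. It can be fixed for all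
  rational \<open>t\<close>, and by Fubini for almost every \<open>t\<close>. The latter makes Gaussian averages of \<open>\<emp_char>\<^sub>n(h s)\<close> in \<open>s\<close>
  converge; these averages control \<open>1 - Re \<emp_char>\<^sub>n\<close> near \<open>0\<close>, hence by Krein's inequality the modulus of
  continuity of \<open>\<emp_char>\<^sub>n\<close>, and convergence extends from the rationals to the line
  (\<open>char_tendsto_from_rationals\<close>). Levy's continuity theorem then gives convergence in distribution.
\<close>

section \<open>The Dirichlet and Fejer kernels\<close>

definition dirichlet :: "nat \<Rightarrow> real \<Rightarrow> complex" where
  "dirichlet n v = (\<Sum>k=1..n. cis (real k * v))"

definition fejer :: "nat \<Rightarrow> real \<Rightarrow> real" where
  "fejer n v = (norm (dirichlet n v))\<^sup>2 / real n"

lemma dirichlet_measurable[measurable]: "dirichlet n \<in> borel_measurable borel"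
  unfolding dirichlet_def cis_conv_exp by measurable

lemma fejer_measurable[measurable]: "fejer n \<in> borel_measurable borel"
  unfolding fejer_def by measurable

lemma fejer_nonneg: "0 \<le> fejer n v"
  by (simp add: fejer_def)

lemma dirichlet_periodic: "dirichlet n (v + 2 * pi) = dirichlet n v"
proof -
  have "cis (real k * (v + 2 * pi)) = cis (real k * v)" for k
    using cis_multiple_2pi[of "real k"] by (simp add: distrib_left mult_ac flip: cis_mult)
  then show ?thesis by (simp add: dirichlet_def)
qed

lemma norm_dirichlet_le: "norm (dirichlet n v) \<le> real n"
  unfolding dirichlet_def by (rule order_trans[OF norm_sum]) simp

text \<open>
  Multiplication by \<open>1 - cis v\<close>, of modulus \<open>2 |sin (v / 2)|\<close>, telescopes the geometric sum.
\<close>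

lemma norm_dirichlet_sin_le: "norm (dirichlet n v) * \<bar>sin (v / 2)\<bar> \<le> 1"
proof -
  have tele: "(1 - cis v) * dirichlet n v = cis v - cis (real (Suc n) * v)"
  proof (induction n)
    case (Suc n)
    have "(1 - cis v) * dirichlet (Suc n) v = (1 - cis v) * dirichlet n v + (1 - cis v) * cis (real (Suc n) * v)"
      by (simp add: dirichlet_def algebra_simps)
    also have "(1 - cis v) * cis (real (Suc n) * v) = cis (real (Suc n) * v) - cis (real (Suc (Suc n)) * v)"
      by (simp add: cis_mult algebra_simps)
    finally show ?case using Suc by simp
  qed (simp add: dirichlet_def)
  have "(norm (1 - cis v))\<^sup>2 = (2 * \<bar>sin (v / 2)\<bar>)\<^sup>2"
  proof -
    have "(norm (1 - cis v))\<^sup>2 = (1 - cos v)\<^sup>2 + (sin v)\<^sup>2" by (simp add: cmod_power2)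
    also have "\<dots> = 2 - 2 * cos v"
      using sin_cos_squared_add[of v] by (simp add: power2_eq_square algebra_simps)
    also have "\<dots> = (2 * \<bar>sin (v / 2)\<bar>)\<^sup>2"
      using cos_double_sin[of "v/2"] by (simp add: power_mult_distrib)
    finally show ?thesis .
  qed
  then have n1: "norm (1 - cis v) = 2 * \<bar>sin (v / 2)\<bar>"
    by (rule power2_eq_imp_eq) auto
  have "norm ((1 - cis v) * dirichlet n v) \<le> 2"
    unfolding tele by (rule order_trans[OF norm_triangle_ineq4]) simp
  then show ?thesis by (simp add: norm_mult n1 mult.commute)
qed

lemma fejer_sin_le: "fejer n v * (sin (v / 2))\<^sup>2 \<le> 1 / real n"
proof -
  have "(norm (dirichlet n v) * \<bar>sin (v / 2)\<bar>)\<^sup>2 \<le> 1\<^sup>2"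
    by (rule power_mono[OF norm_dirichlet_sin_le]) auto
  then show ?thesis
    by (simp add: fejer_def power_mult_distrib divide_right_mono)
qed

lemma fejer_le: "fejer n v \<le> real n"
proof -
  have "(norm (dirichlet n v))\<^sup>2 \<le> (real n)\<^sup>2"
    by (rule power_mono[OF norm_dirichlet_le]) auto
  then show ?thesis
    by (cases "n = 0") (auto simp: fejer_def field_simps power2_eq_square)
qed

lemma has_integral_cos_period:
  fixes j :: int
  shows "((\<lambda>x. cos (of_int j * x)) has_integral (if j = 0 then 2 * pi else 0)) {a..a + 2 * pi}"
proof (cases "j = 0")
  case True
  then show ?thesis using has_integral_const_real[of "1::real" a "a + 2 * pi"] by simp
next
  case False
  have "((\<lambda>x. cos (of_int j * x)) has_integral
      (sin (of_int j * (a + 2 * pi)) / of_int j - sin (of_int j * a) / of_int j)) {a..a + 2 * pi}"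
    by (rule fundamental_theorem_of_calculus)
       (use False in \<open>auto intro!: derivative_eq_intros
         simp flip: has_real_derivative_iff_has_vector_derivative\<close>)
  moreover have "sin (of_int j * (a + 2 * pi)) = sin (of_int j * a)"
    using sin_cos_eq_iff[of "of_int j * (a + 2 * pi)" "of_int j * a"]
    by (auto simp: algebra_simps intro!: exI[of _ j])
  ultimately show ?thesis using False by simp
qed

lemma has_integral_sin_period:
  fixes j :: int
  shows "((\<lambda>x. sin (of_int j * x)) has_integral 0) {a..a + 2 * pi}"
proof (cases "j = 0")
  case False
  have "((\<lambda>x. sin (of_int j * x)) has_integral
      (- cos (of_int j * (a + 2 * pi)) / of_int j - - cos (of_int j * a) / of_int j)) {a..a + 2 * pi}"
    by (rule fundamental_theorem_of_calculus)
       (use False in \<open>auto intro!: derivative_eq_intros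
         simp flip: has_real_derivative_iff_has_vector_derivative\<close>)
  moreover have "cos (of_int j * (a + 2 * pi)) = cos (of_int j * a)"
    using sin_cos_eq_iff[of "of_int j * (a + 2 * pi)" "of_int j * a"]
    by (auto simp: algebra_simps intro!: exI[of _ j])
  ultimately show ?thesis using False by simp
qed (use has_integral_0 in auto)

lemma has_integral_trig_products:
  assumes "1 \<le> k" "1 \<le> l"
  shows "((\<lambda>x. cos (real k * x) * cos (real l * x)) has_integral (if k = l then pi else 0)) {a..a+2*pi}"
    and "((\<lambda>x. sin (real k * x) * sin (real l * x)) has_integral (if k = l then pi else 0)) {a..a+2*pi}"
    and "((\<lambda>x. cos (real k * x) * sin (real l * x)) has_integral 0) {a..a+2*pi}"
proof -
  have c: "((\<lambda>x. cos (of_int (int k - int l) * x) / 2) has_integral (if k = l then 2 * pi else 0) / 2) {a..a+2*pi}"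
    using has_integral_divide[OF has_integral_cos_period[of "int k - int l" a], of 2] by (simp split: if_splits)
  have c': "((\<lambda>x. cos (of_int (int k + int l) * x) / 2) has_integral 0 / 2) {a..a+2*pi}"
    using has_integral_divide[OF has_integral_cos_period[of "int k + int l" a], of 2] assms by (simp split: if_splits)
  have s: "((\<lambda>x. sin (of_int (int k + int l) * x) / 2) has_integral 0 / 2) {a..a+2*pi}"
    by (rule has_integral_divide[OF has_integral_sin_period])
  have s': "((\<lambda>x. sin (of_int (int k - int l) * x) / 2) has_integral 0 / 2) {a..a+2*pi}"
    by (rule has_integral_divide[OF has_integral_sin_period])
  show "((\<lambda>x. cos (real k * x) * cos (real l * x)) has_integral (if k = l then pi else 0)) {a..a+2*pi}"
    using has_integral_add[OF c c']
    by (rule has_integral_eq_rhs[OF has_integral_eq, rotated]) (auto simp: cos_times_cos algebra_simps add_divide_distrib)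
  show "((\<lambda>x. sin (real k * x) * sin (real l * x)) has_integral (if k = l then pi else 0)) {a..a+2*pi}"
    using has_integral_diff[OF c c']
    by (rule has_integral_eq_rhs[OF has_integral_eq, rotated]) (auto simp: sin_times_sin algebra_simps diff_divide_distrib)
  show "((\<lambda>x. cos (real k * x) * sin (real l * x)) has_integral 0) {a..a+2*pi}"
    using has_integral_diff[OF s s']
    by (rule has_integral_eq_rhs[OF has_integral_eq, rotated]) (auto simp: cos_times_sin algebra_simps diff_divide_distrib)
qed

text \<open>
  Parseval's identity for a trigonometric polynomial without constant term, over any period.
\<close>

lemma has_integral_trig_square:
  "((\<lambda>x. (\<Sum>k=1..n. c k * cos (real k * x) + d k * sin (real k * x))\<^sup>2) has_integral
     pi * (\<Sum>k=1..n. (c k)\<^sup>2 + (d k)\<^sup>2)) {a..a + 2 * pi}"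
proof -
  have pr: "((\<lambda>x. (c k * cos (real k * x) + d k * sin (real k * x)) * (c l * cos (real l * x) + d l * sin (real l * x)))
     has_integral (if k = l then pi * ((c k)\<^sup>2 + (d k)\<^sup>2) else 0)) {a..a + 2 * pi}" if "k \<in> {1..n}" "l \<in> {1..n}" for k l
  proof -
    have k: "1 \<le> k" "1 \<le> l" using that by auto
    note h = has_integral_add[OF has_integral_add[OF 
        has_integral_mult_right[OF has_integral_trig_products(1)[OF k, of a], of "c k * c l"]
        has_integral_mult_right[OF has_integral_trig_products(2)[OF k, of a], of "d k * d l"]]
      has_integral_add[OF 
        has_integral_mult_right[OF has_integral_trig_products(3)[OF k, of a], of "c k * d l"]
        has_integral_mult_right[OF has_integral_trig_products(3)[OF k(2,1), of a], of "d k * c l"]]]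
    show ?thesis
      using h by (rule has_integral_eq_rhs[OF has_integral_eq, rotated]) (auto simp: algebra_simps power2_eq_square)
  qed
  have "((\<lambda>x. \<Sum>k=1..n. \<Sum>l=1..n. (c k * cos (real k * x) + d k * sin (real k * x)) * (c l * cos (real l * x) + d l * sin (real l * x)))
     has_integral (\<Sum>k=1..n. \<Sum>l=1..n. (if k = l then pi * ((c k)\<^sup>2 + (d k)\<^sup>2) else 0))) {a..a + 2 * pi}"
    by (intro has_integral_sum finite_atLeastAtMost pr)
  then show ?thesis
    unfolding power2_eq_square[of "sum _ _"] sum_product by (simp add: sum_distrib_left)
qed

lemma nn_integral_trig_square:
  "(\<integral>\<^sup>+x\<in>{a..a + 2 * pi}. ennreal ((\<Sum>k=1..n. c k * cos (real k * x) + d k * sin (real k * x))\<^sup>2) \<partial>lborel)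
     = ennreal (pi * (\<Sum>k=1..n. (c k)\<^sup>2 + (d k)\<^sup>2))"
proof -
  have "(\<integral>\<^sup>+x\<in>{a..a + 2 * pi}. ennreal ((\<Sum>k=1..n. c k * cos (real k * x) + d k * sin (real k * x))\<^sup>2) \<partial>lborel)
     = (\<integral>\<^sup>+x. ennreal (indicator {a..a + 2 * pi} x * (\<Sum>k=1..n. c k * cos (real k * x) + d k * sin (real k * x))\<^sup>2) \<partial>lborel)"
    by (intro nn_integral_cong) (auto simp: indicator_def)
  also have "\<dots> = ennreal (pi * (\<Sum>k=1..n. (c k)\<^sup>2 + (d k)\<^sup>2))"
  proof (rule nn_integral_has_integral_lborel)
    have "(\<lambda>x. indicator {a..a + 2 * pi} x * (\<Sum>k=1..n. c k * cos (real k * x) + d k * sin (real k * x))\<^sup>2) =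
      (\<lambda>x. if x \<in> {a..a + 2 * pi} then (\<Sum>k=1..n. c k * cos (real k * x) + d k * sin (real k * x))\<^sup>2 else 0)"
      by (auto simp: indicator_def)
    then show "((\<lambda>x. indicator {a..a + 2 * pi} x * (\<Sum>k=1..n. c k * cos (real k * x) + d k * sin (real k * x))\<^sup>2)
        has_integral pi * (\<Sum>k=1..n. (c k)\<^sup>2 + (d k)\<^sup>2)) UNIV"
      by (simp only: has_integral_restrict_UNIV has_integral_trig_square)
    show "(\<lambda>x. indicator {a..a + 2 * pi} x * (\<Sum>k=1..n. c k * cos (real k * x) + d k * sin (real k * x))\<^sup>2)
        \<in> borel_measurable borel"
      by (intro borel_measurable_times borel_measurable_power borel_measurable_sum borel_measurable_add
          borel_measurable_indicator borel_measurable_cos borel_measurable_sin) auto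
  qed simp
  finally show ?thesis .
qed

text \<open>
  As functions of \<open>x\<close>, the real and imaginary part of the translated kernel are trigonometric
  polynomials to which Parseval's identity applies.
\<close>

lemma norm_dirichlet_shift_square:
  "(norm (dirichlet n (x - u)))\<^sup>2 =
     (\<Sum>k=1..n. cos (real k * u) * cos (real k * x) + sin (real k * u) * sin (real k * x))\<^sup>2 +
     (\<Sum>k=1..n. - sin (real k * u) * cos (real k * x) + cos (real k * u) * sin (real k * x))\<^sup>2"
proof -
  have "Re (dirichlet n (x - u)) = (\<Sum>k=1..n. cos (real k * u) * cos (real k * x) + sin (real k * u) * sin (real k * x))"
    by (simp add: dirichlet_def right_diff_distrib cos_diff mult.commute)
  moreover have "Im (dirichlet n (x - u)) = (\<Sum>k=1..n. - sin (real k * u) * cos (real k * x) + cos (real k * u) * sin (real k * x))"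
    by (simp add: dirichlet_def right_diff_distrib sin_diff mult.commute)
  ultimately show ?thesis by (simp only: cmod_power2)
qed

lemma nn_integral_fejer_shift:
  "(\<integral>\<^sup>+x\<in>{a..a + 2 * pi}. ennreal (fejer n (x - u)) \<partial>lborel) = (if n = 0 then 0 else ennreal (2 * pi))"
proof (cases "n = 0")
  case False
  let ?A = "\<lambda>x. (\<Sum>k=1..n. cos (real k * u) * cos (real k * x) + sin (real k * u) * sin (real k * x))\<^sup>2"
  let ?B = "\<lambda>x. (\<Sum>k=1..n. - sin (real k * u) * cos (real k * x) + cos (real k * u) * sin (real k * x))\<^sup>2"
  have "(\<integral>\<^sup>+x\<in>{a..a + 2 * pi}. ennreal (fejer n (x - u)) \<partial>lborel)
     = (\<integral>\<^sup>+x. ennreal (1 / real n) * (ennreal (?A x) * indicator {a..a+2*pi} x + ennreal (?B x) * indicator {a..a+2*pi} x) \<partial>lborel)"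
    unfolding fejer_def norm_dirichlet_shift_square
    by (intro nn_integral_cong)
       (simp add: indicator_def add_divide_distrib flip: ennreal_plus ennreal_mult)
  also have "\<dots> = ennreal (1 / real n) * ((\<integral>\<^sup>+x\<in>{a..a+2*pi}. ennreal (?A x) \<partial>lborel) + (\<integral>\<^sup>+x\<in>{a..a+2*pi}. ennreal (?B x) \<partial>lborel))"
    by (subst nn_integral_cmult, measurable, subst nn_integral_add) auto
  also have "\<dots> = ennreal (1 / real n) * (ennreal (pi * real n) + ennreal (pi * real n))"
    unfolding nn_integral_trig_square by simp
  also have "\<dots> = ennreal (2 * pi)"
    using False by (simp flip: ennreal_plus ennreal_mult)
  finally show ?thesis using False by simp
qed (simp add: fejer_def)

text \<open>
  Write \<open>sin y = 2 tan (y/2) cos\<^sup>2 (y/2)\<close> and use \<open>y/2 \<le> tan (y/2)\<close> together with \<open>cos\<^sup>2 (y/2) \<ge> 1/2\<close>.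
\<close>

lemma half_le_sin:
  assumes "0 \<le> y" "y \<le> pi / 2"
  shows "y / 2 \<le> sin y"
proof -
  have "cos (pi / 4) \<le> cos (y / 2)" using assms by (intro cos_monotone_0_pi_le) auto
  then have "(sqrt 2 / 2)\<^sup>2 \<le> (cos (y / 2))\<^sup>2"
    by (intro power_mono) (auto simp: cos_45)
  then have c: "1 / 2 \<le> (cos (y / 2))\<^sup>2" by (simp add: power_divide)
  have t: "y / 2 \<le> tan (y / 2)"
  proof -
    have "y < pi" using assms pi_gt_zero by linarith
    then show ?thesis using abs_tan_ge[of "y/2"] assms tan_pos_pi2_le[of "y/2"] by simp
  qed
  have "cos (y/2) \<noteq> 0" using cos_gt_zero_pi[of "y/2"] assms pi_gt_zero by linarith
  then have "sin y = 2 * tan (y/2) * (cos (y/2))\<^sup>2"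
    using sin_double[of "y/2"] by (simp add: tan_def power2_eq_square)
  moreover have "(y / 2) * (1/2) \<le> tan (y/2) * (cos (y/2))\<^sup>2"
    by (rule mult_mono[OF t c]) (use assms t in auto)
  ultimately show ?thesis by simp
qed

lemma norm_dirichlet_le_inverse:
  assumes "\<bar>v\<bar> \<le> pi" "v \<noteq> 0"
  shows "norm (dirichlet n v) \<le> 4 / \<bar>v\<bar>"
proof -
  have "\<bar>v\<bar> / 4 \<le> \<bar>sin (v / 2)\<bar>"
    using half_le_sin[of "\<bar>v\<bar> / 2"] assms by (cases "v \<ge> 0") auto
  then have "norm (dirichlet n v) * (\<bar>v\<bar> / 4) \<le> norm (dirichlet n v) * \<bar>sin (v / 2)\<bar>"
    by (rule mult_left_mono) auto
  also have "\<dots> \<le> 1" by (rule norm_dirichlet_sin_le)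
  finally show ?thesis using assms by (simp add: field_simps)
qed

text \<open>
  The bound \<open>n\<close> is used for \<open>|v| \<le> 1/n\<close> and the bound \<open>4 / |v|\<close> elsewhere. The variance
  estimate rests on the logarithm being small against \<open>\<surd>n\<close>.
\<close>

lemma nn_integral_dirichlet_le:
  assumes n: "1 \<le> n"
  shows "(\<integral>\<^sup>+v\<in>{-pi..pi}. ennreal (norm (dirichlet n v)) \<partial>lborel) \<le> ennreal (2 + 8 * (ln pi + ln (real n)))"
proof -
  define \<delta> where "\<delta> = 1 / real n"
  have "\<delta> \<le> 1" "0 < \<delta>" using n by (auto simp: \<delta>_def)
  with pi_gt3 have \<delta>: "0 < \<delta>" "\<delta> \<le> pi" by linarith+
  let ?g1 = "\<lambda>v. ennreal (4 / - v) * indicator {-pi..-\<delta>} v"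
  let ?g2 = "\<lambda>v. ennreal (real n) * indicator {-\<delta>..\<delta>} v"
  let ?g3 = "\<lambda>v. ennreal (4 / v) * indicator {\<delta>..pi} v"
  have i1: "(\<integral>\<^sup>+v. ?g1 v \<partial>lborel) = ennreal (-4 * ln \<delta> - (- 4 * ln pi))"
  proof (subst nn_integral_FTC_Icc[of "\<lambda>v. 4 / - v" "-pi" "-\<delta>" "\<lambda>v. -4 * ln (- v)"])
    fix x assume "x \<in> {- pi..- \<delta>}"
    then have "x < 0" using \<delta> by auto
    then show "((\<lambda>v. - 4 * ln (- v)) has_real_derivative 4 / - x) (at x)" "0 \<le> 4 / - x"
      by (auto intro!: derivative_eq_intros simp: divide_simps)
  qed (use \<delta> in auto)
  have i3: "(\<integral>\<^sup>+v. ?g3 v \<partial>lborel) = ennreal (4 * ln pi - 4 * ln \<delta>)"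
  proof (subst nn_integral_FTC_Icc[of "\<lambda>v. 4 / v" \<delta> pi "\<lambda>v. 4 * ln v"])
    fix x assume "x \<in> {\<delta>..pi}"
    then have "x > 0" using \<delta> by auto
    then show "((\<lambda>v. 4 * ln v) has_real_derivative 4 / x) (at x)" "0 \<le> 4 / x"
      by (auto intro!: derivative_eq_intros simp: divide_simps)
  qed (use \<delta> in auto)
  have i2: "(\<integral>\<^sup>+v. ?g2 v \<partial>lborel) = ennreal 2"
    using \<delta> n by (simp add: nn_integral_cmult_indicator \<delta>_def flip: ennreal_mult)
  have "(\<integral>\<^sup>+v\<in>{-pi..pi}. ennreal (norm (dirichlet n v)) \<partial>lborel)
      \<le> (\<integral>\<^sup>+v. ?g1 v + (?g2 v + ?g3 v) \<partial>lborel)"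
  proof (rule nn_integral_mono)
    fix v :: real
    have "v \<notin> {-pi..pi} \<or> v \<in> {-pi..-\<delta>} \<or> v \<in> {-\<delta>..\<delta>} \<or> v \<in> {\<delta>..pi}"
      by auto
    then consider "v \<notin> {-pi..pi}" | "v \<in> {-pi..-\<delta>}" | "v \<in> {-\<delta>..\<delta>}" | "v \<in> {\<delta>..pi}"
      by blast
    then show "ennreal (norm (dirichlet n v)) * indicator {-pi..pi} v \<le> ?g1 v + (?g2 v + ?g3 v)"
    proof cases
      case 2
      then have "ennreal (norm (dirichlet n v)) \<le> ennreal (4 / - v)"
        using norm_dirichlet_le_inverse[of v n] \<delta> by (intro ennreal_leI) auto
      then have "ennreal (norm (dirichlet n v)) * indicator {-pi..pi} v \<le> ?g1 v"
        using 2 \<delta> by (simp add: indicator_def)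
      also have "?g1 v \<le> ?g1 v + (?g2 v + ?g3 v)" by (simp add: add_increasing2)
      finally show ?thesis .
    next
      case 3
      then have "ennreal (norm (dirichlet n v)) \<le> ennreal (real n)"
        using norm_dirichlet_le[of n v] by (intro ennreal_leI)
      then have "ennreal (norm (dirichlet n v)) * indicator {-pi..pi} v \<le> ?g2 v"
        using 3 by (simp add: indicator_def)
      also have "?g2 v \<le> ?g1 v + (?g2 v + ?g3 v)" by (simp add: add_increasing add_increasing2)
      finally show ?thesis .
    next
      case 4
      then have "ennreal (norm (dirichlet n v)) \<le> ennreal (4 / v)"
        using norm_dirichlet_le_inverse[of v n] \<delta> by (intro ennreal_leI) auto
      then have "ennreal (norm (dirichlet n v)) * indicator {-pi..pi} v \<le> ?g3 v"
        using 4 \<delta> by (simp add: indicator_def)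
      also have "?g3 v \<le> ?g1 v + (?g2 v + ?g3 v)" by (simp add: add_increasing add_increasing2)
      finally show ?thesis .
    qed simp
  qed
  also have "\<dots> = ennreal (-4 * ln \<delta> - (- 4 * ln pi)) + (ennreal 2 + ennreal (4 * ln pi - 4 * ln \<delta>))"
    unfolding i1[symmetric] i2[symmetric] i3[symmetric]
    by (subst nn_integral_add, measurable, subst nn_integral_add) auto
  also have "\<dots> = ennreal (2 + 8 * (ln pi + ln (real n)))"
  proof -
    have "ln \<delta> \<le> ln pi" using \<delta> by simp
    moreover have "ln \<delta> = - ln (real n)" using n by (simp add: \<delta>_def ln_div)
    ultimately show ?thesis by (simp flip: ennreal_plus ennreal_numeral)
  qed
  finally show ?thesis .
qed

lemma nn_integral_periodic_shift:
  fixes f :: "real \<Rightarrow> ennreal"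
  assumes f[measurable]: "f \<in> borel_measurable borel" and per: "\<And>x. f (x + 2 * pi) = f x"
    and a: "- pi \<le> a" "a \<le> pi"
  shows "(\<integral>\<^sup>+x\<in>{a..a + 2 * pi}. f x \<partial>lborel) = (\<integral>\<^sup>+x\<in>{-pi..pi}. f x \<partial>lborel)"
proof -
  have "(\<integral>\<^sup>+x\<in>{a..a + 2 * pi}. f x \<partial>lborel)
      = (\<integral>\<^sup>+x. f x * indicator {a..pi} x + f x * indicator {pi<..a + 2 * pi} x \<partial>lborel)"
    using a by (intro nn_integral_cong) (auto simp: indicator_def)
  also have "\<dots> = (\<integral>\<^sup>+x\<in>{a..pi}. f x \<partial>lborel) + (\<integral>\<^sup>+x\<in>{pi<..a + 2 * pi}. f x \<partial>lborel)"
    by (rule nn_integral_add) auto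
  also have "(\<integral>\<^sup>+x\<in>{pi<..a + 2 * pi}. f x \<partial>lborel)
      = (\<integral>\<^sup>+x. f (2 * pi + 1 * x) * indicator {pi<..a + 2 * pi} (2 * pi + 1 * x) \<partial>lborel)"
    by (subst nn_integral_real_affine[where c=1 and t="2 * pi"]) auto
  also have "\<dots> = (\<integral>\<^sup>+x\<in>{-pi<..a}. f x \<partial>lborel)"
    using per by (intro nn_integral_cong) (auto simp: indicator_def add.commute)
  also have "(\<integral>\<^sup>+x\<in>{a..pi}. f x \<partial>lborel) + (\<integral>\<^sup>+x\<in>{-pi<..a}. f x \<partial>lborel)
      = (\<integral>\<^sup>+x. f x * indicator {a..pi} x + f x * indicator {-pi<..a} x \<partial>lborel)"
    by (rule nn_integral_add[symmetric]) auto
  also have "\<dots> = (\<integral>\<^sup>+x\<in>{-pi..pi}. f x \<partial>lborel)"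
  proof (rule nn_integral_cong_AE)
    show "AE x in lborel. f x * indicator {a..pi} x + f x * indicator {-pi<..a} x = f x * indicator {-pi..pi} x"
      using AE_lborel_singleton[of "-pi"] AE_lborel_singleton[of a]
      by eventually_elim (use a in \<open>auto simp: indicator_def\<close>)
  qed
  finally show ?thesis .
qed

section \<open>Fejer means of finite measures\<close>

abbreviation "leb_circle \<equiv> density lborel (indicator {-pi..pi :: real} :: real \<Rightarrow> ennreal)"

text \<open>
  Values are extended nonnegative reals, so that Tonelli's theorem applies without integrability
  conditions.
\<close>

definition fejer_conv :: "real measure \<Rightarrow> nat \<Rightarrow> real \<Rightarrow> ennreal" where
  "fejer_conv \<kappa> n x = (\<integral>\<^sup>+u. ennreal (fejer n (x - u)) \<partial>\<kappa>)"

lemma nn_integral_leb_circle: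
  "f \<in> borel_measurable borel \<Longrightarrow> (\<integral>\<^sup>+x. f x \<partial>leb_circle) = (\<integral>\<^sup>+x\<in>{-pi..pi}. f x \<partial>lborel)"
  by (subst nn_integral_density) (auto simp: mult.commute)

lemma finite_leb_circle: "finite_measure leb_circle"
  by standard (simp add: emeasure_density)

lemma fejer_conv_measurable[measurable]:
  assumes "finite_measure \<kappa>" and [measurable_cong]: "sets \<kappa> = sets borel"
  shows "fejer_conv \<kappa> n \<in> borel_measurable borel"
proof -
  interpret finite_measure \<kappa> by fact
  show ?thesis unfolding fejer_conv_def by measurable
qed

lemma nn_integral_fejer_conv:
  assumes "finite_measure \<kappa>" and [measurable_cong]: "sets \<kappa> = sets borel"
  shows "(\<integral>\<^sup>+x. fejer_conv \<kappa> n x \<partial>leb_circle) \<le> ennreal (2 * pi) * emeasure \<kappa> UNIV"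
proof -
  interpret \<kappa>: finite_measure \<kappa> by fact
  interpret finite_measure leb_circle by (rule finite_leb_circle)
  interpret pair_sigma_finite \<kappa> leb_circle ..
  have sp: "space \<kappa> = UNIV" using sets_eq_imp_space_eq[OF assms(2)] by simp
  have "(\<integral>\<^sup>+x. fejer_conv \<kappa> n x \<partial>leb_circle) = (\<integral>\<^sup>+u. (\<integral>\<^sup>+x. ennreal (fejer n (x - u)) \<partial>leb_circle) \<partial>\<kappa>)"
    unfolding fejer_conv_def by (rule Fubini') measurable
  also have "\<dots> \<le> (\<integral>\<^sup>+u. ennreal (2 * pi) \<partial>\<kappa>)"
  proof (rule nn_integral_mono)
    fix u
    show "(\<integral>\<^sup>+x. ennreal (fejer n (x - u)) \<partial>leb_circle) \<le> ennreal (2 * pi)"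
      using nn_integral_fejer_shift[where a="-pi" and n=n and u=u] by (subst nn_integral_leb_circle) auto
  qed
  also have "\<dots> = ennreal (2 * pi) * emeasure \<kappa> UNIV" by (simp add: sp)
  finally show ?thesis .
qed

text \<open>
  The kernel peaks at all multiples of \<open>2 pi\<close>. Two points of one period differ by at most \<open>2 pi\<close>, hence
  their difference has to stay away from \<open>0\<close> and from both ends \<open>2 pi\<close> and \<open>- 2 pi\<close>.
\<close>

lemma fejer_conv_far_le:
  assumes "finite_measure \<kappa>" and [measurable_cong]: "sets \<kappa> = sets borel"
    and d: "0 < d" "d \<le> pi" and far: "AE u in \<kappa>. d \<le> \<bar>x - u\<bar> \<and> \<bar>x - u\<bar> \<le> 2 * pi - d" and n: "n \<ge> 1"
  shows "fejer_conv \<kappa> n x \<le> ennreal (1 / (real n * (sin (d / 2))\<^sup>2)) * emeasure \<kappa> UNIV"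
proof -
  have sp: "space \<kappa> = UNIV" using sets_eq_imp_space_eq[OF assms(2)] by simp
  have s: "0 < sin (d / 2)" using d by (intro sin_gt_zero) auto
  have "fejer_conv \<kappa> n x \<le> (\<integral>\<^sup>+u. ennreal (1 / (real n * (sin (d / 2))\<^sup>2)) \<partial>\<kappa>)"
    unfolding fejer_conv_def
  proof (rule nn_integral_mono_AE)
    show "AE u in \<kappa>. ennreal (fejer n (x - u)) \<le> ennreal (1 / (real n * (sin (d / 2))\<^sup>2))"
      using far
    proof eventually_elim
      case (elim u)
      define v where "v = \<bar>x - u\<bar>"
      have v: "d \<le> v" "v \<le> 2 * pi - d" using elim by (auto simp: v_def)
      have "sin (d / 2) \<le> sin (v / 2)"
      proof (cases "v \<le> pi")
        case True
        then show ?thesis using v d by (intro sin_monotone_2pi_le) auto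
      next
        case False
        then have "sin (d / 2) \<le> sin (pi - v / 2)" using v d by (intro sin_monotone_2pi_le) auto
        then show ?thesis by simp
      qed
      then have "(sin (d / 2))\<^sup>2 \<le> (sin (v / 2))\<^sup>2" using s by (intro power_mono) auto
      also have "(sin (v / 2))\<^sup>2 = (sin ((x - u) / 2))\<^sup>2"
        using sin_minus[of "(x - u) / 2"] by (cases "x \<le> u") (auto simp: v_def minus_divide_left)
      finally have "fejer n (x - u) * (sin (d / 2))\<^sup>2 \<le> 1 / real n"
        using fejer_sin_le[of n "x - u"] mult_left_mono[OF _ fejer_nonneg[of n "x - u"]] by (meson order_trans)
      then show ?case using s n by (intro ennreal_leI) (simp add: field_simps)
    qed
  qed
  also have "\<dots> = ennreal (1 / (real n * (sin (d / 2))\<^sup>2)) * emeasure \<kappa> UNIV" by (simp add: sp)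
  finally show ?thesis .
qed

lemma finite_measure_compact_inside:
  fixes B :: "real set"
  assumes "finite_measure \<kappa>" and sets: "sets \<kappa> = sets borel" and B: "B \<in> sets borel" and e: "0 < e"
  obtains K where "compact K" "K \<subseteq> B" "emeasure \<kappa> (B - K) \<le> ennreal e"
proof -
  interpret finite_measure \<kappa> by fact
  have "emeasure \<kappa> B = (SUP K \<in> {K. K \<subseteq> B \<and> compact K}. emeasure \<kappa> K)"
    by (rule inner_regular) (use sets B emeasure_finite in auto)
  moreover have "emeasure \<kappa> B < \<infinity>" by (simp add: less_top[symmetric])
  ultimately obtain K where K: "K \<subseteq> B" "compact K" "emeasure \<kappa> B \<le> emeasure \<kappa> K + ennreal e"
    using SUP_approx_ennreal[OF e, of "{K. K \<subseteq> B \<and> compact K}" "emeasure \<kappa> B" "emeasure \<kappa>"]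
    by (fastforce intro: exI[of _ "{}"])
  have "K \<in> sets \<kappa>" using K sets by (simp add: borel_compact)
  then have "emeasure \<kappa> (B - K) = emeasure \<kappa> B - emeasure \<kappa> K"
    using K B sets by (intro emeasure_Diff) auto
  also have "\<dots> \<le> ennreal e" using K(3) by (simp add: ennreal_minus_le_iff add.commute)
  finally show ?thesis using K that by blast
qed

lemma tendsto_0_ennrealI:
  fixes f :: "nat \<Rightarrow> ennreal"
  assumes "\<And>e. 0 < e \<Longrightarrow> \<forall>\<^sub>F n in sequentially. f n \<le> ennreal e"
  shows "f \<longlonglongrightarrow> 0"
proof (rule order_tendstoI)
  fix a :: ennreal assume "0 < a"
  then obtain z where z: "0 < z" "z < a" using dense by blast
  then obtain e where "z = ennreal e" "0 \<le> e" by (cases z) auto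
  with z have "0 < e" "ennreal e < a" by auto
  then show "\<forall>\<^sub>F n in sequentially. f n < a" using assms[of e] by (auto elim!: eventually_mono)
qed simp

text \<open>
  On a set that \<open>\<kappa>\<close> does not charge, the Fejer means of \<open>\<kappa>\<close> tend to \<open>0\<close> in measure. By regularity, \<open>\<kappa>\<close> sits up to
  small mass on a compact set \<open>K\<close> outside \<open>B\<close>, and \<open>B\<close> is up to small measure a compact set \<open>L\<close>. These have
  positive distance, so the part of \<open>\<kappa>\<close> on \<open>K\<close> contributes \<open>O(1/n)\<close> on \<open>L\<close>; the part off \<open>K\<close> is small in \<open>L\<^sup>1\<close>, and
  the truncation at \<open>1\<close> lets the rest of \<open>B\<close> count through its measure only.

  The lemma is used for the singular part of the spectral measure, with \<open>B\<close> the complement of the null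
  set carrying it, and for Lebesgue measure restricted to the complement of \<open>B\<close>.
\<close>

lemma fejer_conv_null_set:
  assumes "finite_measure \<kappa>" and sets[measurable_cong, simp]: "sets \<kappa> = sets borel"
    and supp: "AE u in \<kappa>. u \<in> {-pi..pi}"
    and B[measurable]: "B \<in> sets borel" and null: "emeasure \<kappa> B = 0"
  shows "(\<lambda>n. \<integral>\<^sup>+x\<in>B. min 1 (fejer_conv \<kappa> n x) \<partial>leb_circle) \<longlonglongrightarrow> 0"
proof (rule tendsto_0_ennrealI)
  fix e :: real assume e: "0 < e"
  interpret \<kappa>: finite_measure \<kappa> by fact
  interpret lc: finite_measure leb_circle by (rule finite_leb_circle)
  have sp: "space \<kappa> = UNIV" using sets_eq_imp_space_eq[OF sets] by simp
  note [measurable] = fejer_conv_measurable[OF assms(1,2)]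
  (* e1 is the error allowed in each regularity step; the first costs e1, the second the mass
     2 pi of the kernel times e1, and both together a third of e. *)
  define e1 where "e1 = e / (3 * (1 + 2 * pi))"
  have e1: "0 < e1" using e pi_gt_zero by (simp add: e1_def add_pos_pos)
  obtain K where K: "compact K" "K \<subseteq> - B" "emeasure \<kappa> (- B - K) \<le> ennreal e1"
    using finite_measure_compact_inside[OF assms(1) sets, of "- B" e1] e1 by auto
  obtain L where L: "compact L" "L \<subseteq> B \<inter> {-pi<..<pi}" "emeasure leb_circle (B \<inter> {-pi<..<pi} - L) \<le> ennreal e1"
    using finite_measure_compact_inside[OF finite_leb_circle _ _ e1, of "B \<inter> {-pi<..<pi}"] by auto
  have [measurable]: "K \<in> sets borel" "L \<in> sets borel" using K L by (auto simp: borel_compact)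
  (* L is also separated from the end points of the period, where the kernel peaks again. *)
  have "closed (K \<union> ({..-pi} \<union> {pi..}))" using K(1) by (intro closed_Un compact_imp_closed closed_atMost closed_atLeast)
  moreover have "L \<inter> (K \<union> ({..-pi} \<union> {pi..})) = {}" using K(2) L(2) by auto
  ultimately obtain d where d: "0 < d" "\<And>x y. x \<in> L \<Longrightarrow> y \<in> K \<union> ({..-pi} \<union> {pi..}) \<Longrightarrow> d \<le> dist x y"
    using separate_compact_closed[OF L(1)] by metis
  define d' where "d' = min d pi"
  have d': "0 < d'" "d' \<le> pi" "d' \<le> d" using d(1) by (auto simp: d'_def)
  define \<kappa>1 where "\<kappa>1 = density \<kappa> (indicator K)"
  define \<kappa>2 where "\<kappa>2 = density \<kappa> (indicator (- K))"
  have [measurable_cong, simp]: "sets \<kappa>1 = sets borel" "sets \<kappa>2 = sets borel" by (simp_all add: \<kappa>1_def \<kappa>2_def)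
  have em1: "emeasure \<kappa>1 A = emeasure \<kappa> (A \<inter> K)" if [measurable]: "A \<in> sets borel" for A
    unfolding \<kappa>1_def by (subst emeasure_density) (auto simp: Int_commute simp flip: indicator_inter_arith)
  have em2: "emeasure \<kappa>2 A = emeasure \<kappa> (A - K)" if [measurable]: "A \<in> sets borel" for A
    unfolding \<kappa>2_def by (subst emeasure_density) (auto simp: Int_commute Diff_eq simp flip: indicator_inter_arith)
  have fin1: "finite_measure \<kappa>1" by standard (simp add: em1 sets_eq_imp_space_eq[of \<kappa>1 borel])
  have fin2: "finite_measure \<kappa>2" by standard (simp add: em2 sets_eq_imp_space_eq[of \<kappa>2 borel])
  note [measurable] = fejer_conv_measurable[OF fin1] fejer_conv_measurable[OF fin2]
  have m2: "emeasure \<kappa>2 UNIV \<le> ennreal e1"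
  proof -
    have "emeasure \<kappa>2 UNIV = emeasure \<kappa> ((- B - K) \<union> (B - K))" by (subst em2) (auto intro!: arg_cong[where f="emeasure \<kappa>"])
    also have "\<dots> \<le> emeasure \<kappa> (- B - K) + emeasure \<kappa> (B - K)" by (rule emeasure_subadditive) auto
    also have "emeasure \<kappa> (B - K) = 0" using null by (metis Diff_subset B sets emeasure_mono le_zero_eq)
    finally show ?thesis using K(3) by simp
  qed
  have split: "fejer_conv \<kappa> n x = fejer_conv \<kappa>1 n x + fejer_conv \<kappa>2 n x" for n x
  proof -
    have "fejer_conv \<kappa> n x = (\<integral>\<^sup>+u. indicator K u * ennreal (fejer n (x - u)) + indicator (- K) u * ennreal (fejer n (x - u)) \<partial>\<kappa>)"
      unfolding fejer_conv_def by (intro nn_integral_cong) (auto simp: indicator_def)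
    also have "\<dots> = fejer_conv \<kappa>1 n x + fejer_conv \<kappa>2 n x"
      unfolding fejer_conv_def \<kappa>1_def \<kappa>2_def by (subst nn_integral_add) (auto simp: nn_integral_density)
    finally show ?thesis .
  qed
  define C where "C = measure \<kappa> UNIV / (sin (d' / 2))\<^sup>2"
  have s: "0 < sin (d' / 2)" using d' by (intro sin_gt_zero) auto
  have C: "0 \<le> C" by (simp add: C_def)
  have near: "fejer_conv \<kappa>1 n x \<le> ennreal (C / real n)" if x: "x \<in> L" and n: "n \<ge> 1" for n x
  proof -
    have "fejer_conv \<kappa>1 n x \<le> ennreal (1 / (real n * (sin (d' / 2))\<^sup>2)) * emeasure \<kappa>1 UNIV"
    proof (rule fejer_conv_far_le[OF fin1 _ d'(1,2) _ n])
      have "AE u in \<kappa>. u \<in> K \<longrightarrow> d' \<le> \<bar>x - u\<bar> \<and> \<bar>x - u\<bar> \<le> 2 * pi - d'"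
        using supp
      proof eventually_elim
        case (elim u)
        have "d \<le> dist x (-pi)" "d \<le> dist x pi" by (rule d(2)[OF x], simp)+
        moreover have "-pi < x" "x < pi" using L(2) x by auto
        moreover have "u \<in> K \<longrightarrow> d \<le> dist x u" using d(2)[OF x] by blast
        ultimately show ?case using elim d'(3) by (auto simp: dist_real_def)
      qed
      then show "AE u in \<kappa>1. d' \<le> \<bar>x - u\<bar> \<and> \<bar>x - u\<bar> \<le> 2 * pi - d'"
        unfolding \<kappa>1_def by (subst AE_density) (auto elim!: eventually_mono simp: indicator_def split: if_splits)
    qed simp
    also have "\<dots> \<le> ennreal (1 / (real n * (sin (d' / 2))\<^sup>2)) * emeasure \<kappa> UNIV"
      by (intro mult_left_mono) (auto simp: em1 intro!: emeasure_mono)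
    also have "\<dots> = ennreal (C / real n)"
      using \<kappa>.emeasure_eq_measure[of UNIV] by (simp add: C_def ennreal_mult[symmetric] mult.commute)
    finally show ?thesis .
  qed
  have main: "(\<integral>\<^sup>+x\<in>B. min 1 (fejer_conv \<kappa> n x) \<partial>leb_circle) \<le> ennreal (e1 + 2 * pi * C / real n + 2 * pi * e1)" if n: "n \<ge> 1" for n
  proof -
    have "(\<integral>\<^sup>+x\<in>B. min 1 (fejer_conv \<kappa> n x) \<partial>leb_circle)
       \<le> (\<integral>\<^sup>+x. indicator (B \<inter> {-pi<..<pi} - L) x + (ennreal (C / real n) + fejer_conv \<kappa>2 n x) \<partial>leb_circle)"
    proof (rule nn_integral_mono_AE)
      have "AE x in lborel. x \<in> {-pi..pi} \<longrightarrow> min 1 (fejer_conv \<kappa> n x) * indicator B x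
          \<le> indicator (B \<inter> {-pi<..<pi} - L) x + (ennreal (C / real n) + fejer_conv \<kappa>2 n x)"
        using AE_lborel_singleton[of pi] AE_lborel_singleton[of "-pi"]
      proof eventually_elim
        case (elim x)
        have "fejer_conv \<kappa> n x \<le> ennreal (C / real n) + fejer_conv \<kappa>2 n x" if "x \<in> L"
          unfolding split using near[OF that n] by (intro add_right_mono)
        then have "min 1 (fejer_conv \<kappa> n x) \<le> ennreal (C / real n) + fejer_conv \<kappa>2 n x" if "x \<in> L"
          using that by (metis min.coboundedI2)
        moreover have "min 1 (fejer_conv \<kappa> n x) \<le> 1 + (ennreal (C / real n) + fejer_conv \<kappa>2 n x)"
          by (metis add_increasing2 min.cobounded1 zero_le)
        ultimately show ?case using elim by (auto simp: indicator_def)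
      qed
      then show "AE x in leb_circle. min 1 (fejer_conv \<kappa> n x) * indicator B x
          \<le> indicator (B \<inter> {-pi<..<pi} - L) x + (ennreal (C / real n) + fejer_conv \<kappa>2 n x)"
        by (subst AE_density) (auto elim!: eventually_mono simp: indicator_def split: if_splits)
    qed
    also have "\<dots> = emeasure leb_circle (B \<inter> {-pi<..<pi} - L) + (ennreal (C / real n) * emeasure leb_circle UNIV + (\<integral>\<^sup>+x. fejer_conv \<kappa>2 n x \<partial>leb_circle))"
      by (subst nn_integral_add, measurable, subst nn_integral_add) auto
    also have "\<dots> \<le> ennreal e1 + (ennreal (C / real n) * ennreal (2 * pi) + ennreal (2 * pi) * ennreal e1)"
    proof (intro add_mono L(3) mult_left_mono)
      show "emeasure leb_circle UNIV \<le> ennreal (2 * pi)" by (subst emeasure_density) auto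
      show "(\<integral>\<^sup>+x. fejer_conv \<kappa>2 n x \<partial>leb_circle) \<le> ennreal (2 * pi) * ennreal e1"
        using nn_integral_fejer_conv[OF fin2, of n] mult_left_mono[OF m2, of "ennreal (2 * pi)"] by auto
    qed auto
    also have "\<dots> = ennreal (e1 + (C / real n * (2 * pi) + 2 * pi * e1))"
      using e1 C by (simp add: ennreal_mult'[symmetric] ennreal_plus[symmetric] del: ennreal_plus)
    finally show ?thesis by (simp add: algebra_simps)
  qed
  have "(\<lambda>n. 2 * pi * C / real n) \<longlonglongrightarrow> 0" by (rule lim_const_over_n)
  then have "\<forall>\<^sub>F n in sequentially. 2 * pi * C / real n < e / 3" using e by (intro order_tendstoD) auto
  then show "\<forall>\<^sub>F n in sequentially. (\<integral>\<^sup>+x\<in>B. min 1 (fejer_conv \<kappa> n x) \<partial>leb_circle) \<le> ennreal e"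
    using eventually_ge_at_top[of 1]
  proof eventually_elim
    case (elim n)
    have "1 + 2 * pi \<noteq> 0" using pi_gt_zero by linarith
    then have "e1 * (1 + 2 * pi) = e / 3" unfolding e1_def by (metis nonzero_mult_div_cancel_right divide_divide_eq_left times_divide_eq_left nonzero_divide_eq_eq)
    then have "e1 + 2 * pi * e1 = e / 3" by (simp add: algebra_simps)
    then have "e1 + 2 * pi * C / real n + 2 * pi * e1 \<le> e" using elim(1) e by linarith
    then show ?case using main[OF elim(2)] by (meson ennreal_leI order_trans)
  qed
qed

lemma fejer_minus: "fejer n (- v) = fejer n v"
proof -
  have "dirichlet n (- v) = cnj (dirichlet n v)"
    by (simp add: dirichlet_def cis_cnj)
  then show ?thesis by (simp add: fejer_def)
qed

lemma integrable_fejer_mult: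
  assumes f: "integrable leb_circle f"
  shows "integrable leb_circle (\<lambda>u. fejer n (x - u) * f u)"
proof -
  have [measurable]: "f \<in> borel_measurable borel" using borel_measurable_integrable[OF f] by simp
  show ?thesis
  proof (rule Bochner_Integration.integrable_bound[where f="\<lambda>u. real n * f u"])
    show "AE u in leb_circle. norm (fejer n (x - u) * f u) \<le> norm (real n * f u)"
      using fejer_le fejer_nonneg by (auto simp: abs_mult intro!: mult_right_mono)
  qed (use f in auto)
qed

text \<open>
  Averaging in \<open>x\<close> first, every point \<open>u\<close> contributes the mass \<open>2 pi\<close> of the kernel at most.
\<close>

lemma fejer_mean_contraction:
  assumes f: "integrable leb_circle f"
  shows "(\<integral>\<^sup>+x. ennreal \<bar>LINT u|leb_circle. fejer n (x - u) * f u\<bar> \<partial>leb_circle)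
     \<le> ennreal (2 * pi) * (\<integral>\<^sup>+u. ennreal \<bar>f u\<bar> \<partial>leb_circle)"
proof -
  interpret finite_measure leb_circle by (rule finite_leb_circle)
  interpret pair_sigma_finite leb_circle leb_circle ..
  have [measurable]: "f \<in> borel_measurable borel" using borel_measurable_integrable[OF f] by simp
  have "(\<integral>\<^sup>+x. ennreal \<bar>LINT u|leb_circle. fejer n (x - u) * f u\<bar> \<partial>leb_circle)
     \<le> (\<integral>\<^sup>+x. (\<integral>\<^sup>+u. ennreal (fejer n (x - u)) * ennreal \<bar>f u\<bar> \<partial>leb_circle) \<partial>leb_circle)"
  proof (rule nn_integral_mono)
    fix x
    have "ennreal \<bar>LINT u|leb_circle. fejer n (x - u) * f u\<bar> \<le> (\<integral>\<^sup>+u. ennreal \<bar>fejer n (x - u) * f u\<bar> \<partial>leb_circle)"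
      using integral_norm_bound_ennreal[OF integrable_fejer_mult[OF f, of n x]] by simp
    also have "\<dots> = (\<integral>\<^sup>+u. ennreal (fejer n (x - u)) * ennreal \<bar>f u\<bar> \<partial>leb_circle)"
      using fejer_nonneg by (simp add: abs_mult ennreal_mult)
    finally show "ennreal \<bar>LINT u|leb_circle. fejer n (x - u) * f u\<bar> \<le> (\<integral>\<^sup>+u. ennreal (fejer n (x - u)) * ennreal \<bar>f u\<bar> \<partial>leb_circle)" .
  qed
  also have "\<dots> = (\<integral>\<^sup>+u. (\<integral>\<^sup>+x. ennreal (fejer n (x - u)) * ennreal \<bar>f u\<bar> \<partial>leb_circle) \<partial>leb_circle)"
    by (rule Fubini') measurable
  also have "\<dots> \<le> (\<integral>\<^sup>+u. ennreal (2 * pi) * ennreal \<bar>f u\<bar> \<partial>leb_circle)"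
  proof (rule nn_integral_mono)
    fix u
    have "(\<integral>\<^sup>+x. ennreal (fejer n (x - u)) * ennreal \<bar>f u\<bar> \<partial>leb_circle) = (\<integral>\<^sup>+x. ennreal (fejer n (x - u)) \<partial>leb_circle) * ennreal \<bar>f u\<bar>"
      by (rule nn_integral_multc) measurable
    also have "(\<integral>\<^sup>+x. ennreal (fejer n (x - u)) \<partial>leb_circle) \<le> ennreal (2 * pi)"
      using nn_integral_fejer_shift[where a="-pi" and n=n and u=u] by (subst nn_integral_leb_circle) auto
    finally show "(\<integral>\<^sup>+x. ennreal (fejer n (x - u)) * ennreal \<bar>f u\<bar> \<partial>leb_circle) \<le> ennreal (2 * pi) * ennreal \<bar>f u\<bar>"
      by (simp add: mult_right_mono)
  qed
  also have "\<dots> = ennreal (2 * pi) * (\<integral>\<^sup>+u. ennreal \<bar>f u\<bar> \<partial>leb_circle)"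
    by (rule nn_integral_cmult) measurable
  finally show ?thesis .
qed

lemma fejer_conv_density:
  assumes f: "integrable leb_circle f" "\<And>x. 0 \<le> f x"
  shows "fejer_conv (density leb_circle (\<lambda>x. ennreal (f x))) n x = ennreal (LINT u|leb_circle. fejer n (x - u) * f u)"
proof -
  have [measurable]: "f \<in> borel_measurable borel" using borel_measurable_integrable[OF f(1)] by simp
  have "fejer_conv (density leb_circle (\<lambda>x. ennreal (f x))) n x = (\<integral>\<^sup>+u. ennreal (fejer n (x - u) * f u) \<partial>leb_circle)"
    unfolding fejer_conv_def
    by (subst nn_integral_density) (auto simp: ennreal_mult fejer_nonneg f mult.commute)
  also have "\<dots> = ennreal (LINT u|leb_circle. fejer n (x - u) * f u)"
    by (intro nn_integral_eq_integral integrable_fejer_mult f) (auto simp: fejer_nonneg f)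
  finally show ?thesis .
qed

text \<open>
  The means of \<open>A\<close> and of its complement add up to \<open>2 pi\<close>. So the error is the mean of the complement on \<open>A\<close>
  and the mean of \<open>A\<close> off \<open>A\<close>, and both tend to \<open>0\<close> in measure. Being bounded by \<open>2 pi\<close> they also do so in \<open>L\<^sup>1\<close>.
\<close>

lemma fejer_mean_indicator:
  assumes A[measurable]: "A \<in> sets borel"
  shows "(\<lambda>n. \<integral>\<^sup>+x. ennreal \<bar>(LINT u|leb_circle. fejer n (x - u) * indicator A u) - 2 * pi * indicator A x\<bar> \<partial>leb_circle)
     \<longlonglongrightarrow> 0"
proof -
  interpret finite_measure leb_circle by (rule finite_leb_circle)
  define \<kappa> where "\<kappa> B = density leb_circle (\<lambda>x. ennreal (indicator B x))" for B
  have fin: "finite_measure (\<kappa> B)" if [measurable]: "B \<in> sets borel" for B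
  proof
    have "emeasure (\<kappa> B) UNIV \<le> emeasure leb_circle UNIV"
      unfolding \<kappa>_def by (subst (1) emeasure_density) (auto simp: ennreal_indicator intro!: emeasure_mono)
    then show "emeasure (\<kappa> B) (space (\<kappa> B)) \<noteq> \<infinity>"
      using emeasure_finite[of UNIV] by (auto simp: \<kappa>_def top_unique)
  qed
  have sets[measurable_cong]: "sets (\<kappa> B) = sets borel" for B by (simp add: \<kappa>_def)
  have supp: "AE u in \<kappa> B. u \<in> {-pi..pi}" if [measurable]: "B \<in> sets borel" for B
    unfolding \<kappa>_def by (subst AE_density, measurable, subst AE_density) (auto simp: indicator_def)
  have null: "emeasure (\<kappa> B) (- B) = 0" if [measurable]: "B \<in> sets borel" for B
    unfolding \<kappa>_def by (subst emeasure_density) (auto simp: ennreal_indicator simp flip: indicator_inter_arith)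
  have lim: "(\<lambda>n. \<integral>\<^sup>+x\<in>-B. min 1 (fejer_conv (\<kappa> B) n x) \<partial>leb_circle) \<longlonglongrightarrow> 0" if [measurable]: "B \<in> sets borel" for B
    by (rule fejer_conv_null_set[OF fin sets supp _ null]) auto
  define m where "m n B x = (LINT u|leb_circle. fejer n (x - u) * indicator B u)" for n B x
  have int: "integrable leb_circle (indicator B :: real \<Rightarrow> real)" if [measurable]: "B \<in> sets borel" for B
    by (rule integrable_const_bound[where B=1]) (auto simp: indicator_def)
  have conv: "fejer_conv (\<kappa> B) n x = ennreal (m n B x)" if [measurable]: "B \<in> sets borel" for B n x
    unfolding \<kappa>_def m_def by (rule fejer_conv_density[OF int]) auto
  have m_nonneg: "0 \<le> m n B x" for n B x
    unfolding m_def by (rule Bochner_Integration.integral_nonneg) (simp add: fejer_nonneg)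
  have add: "m n A x + m n (- A) x = 2 * pi" if n: "n \<ge> 1" for n x
  proof -
    have "m n A x + m n (-A) x = (LINT u|leb_circle. fejer n (x - u) * indicator A u + fejer n (x - u) * indicator (- A) u)"
      unfolding m_def by (rule Bochner_Integration.integral_add[symmetric]) (auto intro!: integrable_fejer_mult int)
    also have "\<dots> = (LINT u|leb_circle. fejer n (x - u))"
      by (intro Bochner_Integration.integral_cong) (auto simp: indicator_def)
    also have "\<dots> = 2 * pi"
    proof -
      have "(\<integral>\<^sup>+u. ennreal (fejer n (x - u)) \<partial>leb_circle) = (\<integral>\<^sup>+u. ennreal (fejer n (u - x)) \<partial>leb_circle)"
        using fejer_minus[of n "_ - x"] by simp
      also have "\<dots> = ennreal (2 * pi)"
        using nn_integral_fejer_shift[where a="-pi" and n=n and u=x] n by (subst nn_integral_leb_circle) auto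
      finally show ?thesis
        by (subst integral_eq_nn_integral) (auto simp: fejer_nonneg)
    qed
    finally show ?thesis .
  qed
  have min2: "ennreal z \<le> ennreal (2 * pi) * min 1 (ennreal z)" if "0 \<le> z" "z \<le> 2 * pi" for z
  proof (cases "z \<le> 1")
    case True
    have "1 * z \<le> 2 * pi * z" using that pi_gt3 by (intro mult_right_mono) auto
    then show ?thesis using True that by (simp add: min_def ennreal_le_1 flip: ennreal_mult)
  next
    case False
    then show ?thesis using that by (simp add: min_def ennreal_le_1)
  qed
  have bound: "(\<integral>\<^sup>+x. ennreal \<bar>m n A x - 2 * pi * indicator A x\<bar> \<partial>leb_circle)
     \<le> ennreal (2 * pi) * (\<integral>\<^sup>+x\<in>A. min 1 (fejer_conv (\<kappa> (-A)) n x) \<partial>leb_circle)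
       + ennreal (2 * pi) * (\<integral>\<^sup>+x\<in>-A. min 1 (fejer_conv (\<kappa> A) n x) \<partial>leb_circle)" (is "_ \<le> ?R n") if n: "n \<ge> 1" for n
  proof -
    note [measurable] = fejer_conv_measurable[OF fin sets]
    have "(\<integral>\<^sup>+x. ennreal \<bar>m n A x - 2 * pi * indicator A x\<bar> \<partial>leb_circle)
      \<le> (\<integral>\<^sup>+x. ennreal (2 * pi) * (min 1 (fejer_conv (\<kappa> (-A)) n x) * indicator A x)
          + ennreal (2 * pi) * (min 1 (fejer_conv (\<kappa> A) n x) * indicator (-A) x) \<partial>leb_circle)"
    proof (rule nn_integral_mono)
      fix x
      show "ennreal \<bar>m n A x - 2 * pi * indicator A x\<bar> \<le> ennreal (2 * pi) * (min 1 (fejer_conv (\<kappa> (-A)) n x) * indicator A x)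
          + ennreal (2 * pi) * (min 1 (fejer_conv (\<kappa> A) n x) * indicator (-A) x)"
      proof (cases "x \<in> A")
        case True
        have "\<bar>m n A x - 2 * pi * indicator A x\<bar> = m n (-A) x" using True add[OF n, of x] m_nonneg[of n "-A" x]
          by (subst indicator_simps(1)[OF True]) linarith
        moreover have "ennreal (m n (-A) x) \<le> ennreal (2 * pi) * min 1 (ennreal (m n (-A) x))"
          using m_nonneg[of n A x] m_nonneg[of n "-A" x] add[OF n, of x] by (intro min2) auto
        ultimately show ?thesis using True by (simp add: conv del: abs_le_iff)
      next
        case False
        then show ?thesis using min2[of "m n A x"] m_nonneg[of n A x] m_nonneg[of n "-A" x] add[OF n, of x]
          by (simp add: conv)
      qed
    qed
    also have "\<dots> = ?R n"
      by (subst nn_integral_add) (auto simp: nn_integral_cmult)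
    finally show ?thesis .
  qed
  have "?R \<longlonglongrightarrow> ennreal (2 * pi) * 0 + ennreal (2 * pi) * 0"
    using lim[of "-A"] lim[of A] by (intro tendsto_add ennreal_tendsto_cmult) auto
  then have "?R \<longlonglongrightarrow> 0" by simp
  then have "(\<lambda>n. \<integral>\<^sup>+x. ennreal \<bar>m n A x - 2 * pi * indicator A x\<bar> \<partial>leb_circle) \<longlonglongrightarrow> 0"
    by (rule tendsto_sandwich[OF _ _ tendsto_const, rotated 2])
       (use bound in \<open>auto intro!: eventually_sequentiallyI[of 1]\<close>)
  then show ?thesis by (simp add: m_def)
qed

text \<open>
  Fejer's theorem in \<open>L\<^sup>1\<close>. Indicators span a dense subspace, and the contraction estimate makes the set of
  functions with this property closed in \<open>L\<^sup>1\<close>.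
\<close>

theorem fejer_mean_L1:
  assumes "integrable leb_circle f"
  shows "(\<lambda>n. \<integral>\<^sup>+x. ennreal \<bar>(LINT u|leb_circle. fejer n (x - u) * f u) - 2 * pi * f x\<bar> \<partial>leb_circle) \<longlonglongrightarrow> 0"
  using assms
proof (induction f)
  case (base A c)
  then have A[measurable]: "A \<in> sets borel" by simp
  have eq: "(\<integral>\<^sup>+x. ennreal \<bar>(LINT u|leb_circle. fejer n (x - u) * (indicator A u *\<^sub>R c)) - 2 * pi * (indicator A x *\<^sub>R c)\<bar> \<partial>leb_circle)
    = ennreal \<bar>c\<bar> * (\<integral>\<^sup>+x. ennreal \<bar>(LINT u|leb_circle. fejer n (x - u) * indicator A u) - 2 * pi * indicator A x\<bar> \<partial>leb_circle)" for n
  proof -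
    interpret finite_measure leb_circle by (rule finite_leb_circle)
    have "\<bar>(LINT u|leb_circle. fejer n (x - u) * (indicator A u *\<^sub>R c)) - 2 * pi * (indicator A x *\<^sub>R c)\<bar>
      = \<bar>c\<bar> * \<bar>(LINT u|leb_circle. fejer n (x - u) * indicator A u) - 2 * pi * indicator A x\<bar>" for x
    proof -
      have "(LINT u|leb_circle. fejer n (x - u) * (indicator A u *\<^sub>R c)) = c * (LINT u|leb_circle. fejer n (x - u) * indicator A u)"
        by (simp add: mult_ac flip: Bochner_Integration.integral_mult_right_zero)
      then show ?thesis by (simp add: abs_mult[symmetric] right_diff_distrib mult_ac)
    qed
    then show ?thesis by (simp add: ennreal_mult nn_integral_cmult)
  qed
  show ?case unfolding eq
    using ennreal_tendsto_cmult[OF _ fejer_mean_indicator[OF A], of "ennreal \<bar>c\<bar>"] by simp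
next
  case (add f g)
  interpret finite_measure leb_circle by (rule finite_leb_circle)
  have [measurable]: "f \<in> borel_measurable borel" "g \<in> borel_measurable borel"
    using borel_measurable_integrable[OF add(1)] borel_measurable_integrable[OF add(2)] by auto
  let ?D = "\<lambda>f n x. (LINT u|leb_circle. fejer n (x - u) * f u) - 2 * pi * f x"
  have "(\<lambda>n. (\<integral>\<^sup>+x. ennreal \<bar>?D f n x\<bar> \<partial>leb_circle) + (\<integral>\<^sup>+x. ennreal \<bar>?D g n x\<bar> \<partial>leb_circle)) \<longlonglongrightarrow> 0 + 0"
    by (intro tendsto_add add.IH)
  then have "(\<lambda>n. (\<integral>\<^sup>+x. ennreal \<bar>?D f n x\<bar> \<partial>leb_circle) + (\<integral>\<^sup>+x. ennreal \<bar>?D g n x\<bar> \<partial>leb_circle)) \<longlonglongrightarrow> 0"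
    by simp
  then show ?case
  proof (rule tendsto_sandwich[OF _ _ tendsto_const, rotated 2])
    show "\<forall>\<^sub>F n in sequentially. (\<integral>\<^sup>+x. ennreal \<bar>?D (\<lambda>x. f x + g x) n x\<bar> \<partial>leb_circle)
      \<le> (\<integral>\<^sup>+x. ennreal \<bar>?D f n x\<bar> \<partial>leb_circle) + (\<integral>\<^sup>+x. ennreal \<bar>?D g n x\<bar> \<partial>leb_circle)"
    proof (intro always_eventually allI)
      fix n
      have D: "?D (\<lambda>x. f x + g x) n x = ?D f n x + ?D g n x" for x
        by (simp add: distrib_left integrable_fejer_mult add)
      have "(\<integral>\<^sup>+x. ennreal \<bar>?D (\<lambda>x. f x + g x) n x\<bar> \<partial>leb_circle) \<le> (\<integral>\<^sup>+x. ennreal \<bar>?D f n x\<bar> + ennreal \<bar>?D g n x\<bar> \<partial>leb_circle)"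
        unfolding D by (intro nn_integral_mono) (auto simp flip: ennreal_plus intro!: ennreal_leI)
      also have "\<dots> = (\<integral>\<^sup>+x. ennreal \<bar>?D f n x\<bar> \<partial>leb_circle) + (\<integral>\<^sup>+x. ennreal \<bar>?D g n x\<bar> \<partial>leb_circle)"
        by (rule nn_integral_add) measurable
      finally show "(\<integral>\<^sup>+x. ennreal \<bar>?D (\<lambda>x. f x + g x) n x\<bar> \<partial>leb_circle)
        \<le> (\<integral>\<^sup>+x. ennreal \<bar>?D f n x\<bar> \<partial>leb_circle) + (\<integral>\<^sup>+x. ennreal \<bar>?D g n x\<bar> \<partial>leb_circle)" .
    qed
  qed simp
next
  case (lim f s)
  interpret finite_measure leb_circle by (rule finite_leb_circle)
  have [measurable]: "f \<in> borel_measurable borel" "\<And>i. s i \<in> borel_measurable borel"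
    using borel_measurable_integrable[OF lim.hyps(1)] borel_measurable_integrable[OF lim.hyps(4)] by auto
  let ?D = "\<lambda>f n x. (LINT u|leb_circle. fejer n (x - u) * f u) - 2 * pi * f x"
  have app: "(\<lambda>i. \<integral>\<^sup>+x. ennreal (norm (f x - s i x)) \<partial>leb_circle) \<longlonglongrightarrow> 0"
  proof (rule nn_integral_dominated_convergence_norm[where w="\<lambda>x. 2 * norm (f x)"])
    show "AE x in leb_circle. norm (s j x) \<le> 2 * norm (f x)" for j using lim.hyps(3) by auto
    show "AE x in leb_circle. (\<lambda>i. s i x) \<longlonglongrightarrow> f x" using lim.hyps(2) by auto
    show "(\<integral>\<^sup>+x. ennreal (2 * norm (f x)) \<partial>leb_circle) < \<infinity>"
      using lim.hyps(4) by (simp add: ennreal_mult nn_integral_cmult integrable_iff_bounded ennreal_mult_less_top)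
  qed auto
  show ?case
  proof (rule tendsto_0_ennrealI)
    fix e :: real assume e: "0 < e"
    (* The approximation error enters twice with factor 2 pi, the mean error with e / 2. *)
    then have "0 < ennreal (e / (8 * pi))" by simp
    then obtain i where i: "(\<integral>\<^sup>+x. ennreal (norm (f x - s i x)) \<partial>leb_circle) < ennreal (e / (8 * pi))"
      using order_tendstoD(2)[OF app] by (force simp: eventually_sequentially)
    define h where "h x = f x - s i x" for x
    have h: "integrable leb_circle h" unfolding h_def using lim.hyps(1,4) by auto
    then have [measurable]: "h \<in> borel_measurable borel" using borel_measurable_integrable by auto
    have "\<forall>\<^sub>F n in sequentially. (\<integral>\<^sup>+x. ennreal \<bar>?D (s i) n x\<bar> \<partial>leb_circle) < ennreal (e / 2)"
      by (rule order_tendstoD(2)[OF lim.IH]) (use e in auto)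
    then show "\<forall>\<^sub>F n in sequentially. (\<integral>\<^sup>+x. ennreal \<bar>?D f n x\<bar> \<partial>leb_circle) \<le> ennreal e"
    proof eventually_elim
      case (elim n)
      have D: "?D f n x = (LINT u|leb_circle. fejer n (x - u) * h u) + (?D (s i) n x - 2 * pi * h x)" for x
      proof -
        have "(LINT u|leb_circle. fejer n (x - u) * h u) = (LINT u|leb_circle. fejer n (x - u) * f u) - (LINT u|leb_circle. fejer n (x - u) * s i u)"
          unfolding h_def right_diff_distrib
          by (rule Bochner_Integration.integral_diff) (intro integrable_fejer_mult lim.hyps)+
        then show ?thesis by (simp add: h_def algebra_simps)
      qed
      have "(\<integral>\<^sup>+x. ennreal \<bar>?D f n x\<bar> \<partial>leb_circle)
        \<le> (\<integral>\<^sup>+x. ennreal \<bar>LINT u|leb_circle. fejer n (x - u) * h u\<bar> + (ennreal \<bar>?D (s i) n x\<bar> + ennreal (2 * pi) * ennreal \<bar>h x\<bar>) \<partial>leb_circle)"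
      proof (rule nn_integral_mono)
        fix x
        have "\<bar>?D f n x\<bar> \<le> \<bar>LINT u|leb_circle. fejer n (x - u) * h u\<bar> + (\<bar>?D (s i) n x\<bar> + 2 * pi * \<bar>h x\<bar>)"
          unfolding D using abs_triangle_ineq4[of "?D (s i) n x" "2 * pi * h x"] by (auto simp: abs_mult intro!: order_trans[OF abs_triangle_ineq])
        from ennreal_leI[OF this] show "ennreal \<bar>?D f n x\<bar> \<le> ennreal \<bar>LINT u|leb_circle. fejer n (x - u) * h u\<bar> + (ennreal \<bar>?D (s i) n x\<bar> + ennreal (2 * pi) * ennreal \<bar>h x\<bar>)"
          by (simp add: ennreal_mult)
      qed
      also have "\<dots> = (\<integral>\<^sup>+x. ennreal \<bar>LINT u|leb_circle. fejer n (x - u) * h u\<bar> \<partial>leb_circle)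
          + ((\<integral>\<^sup>+x. ennreal \<bar>?D (s i) n x\<bar> \<partial>leb_circle) + ennreal (2 * pi) * (\<integral>\<^sup>+x. ennreal \<bar>h x\<bar> \<partial>leb_circle))"
        by (subst nn_integral_add, measurable, subst nn_integral_add, measurable, subst nn_integral_cmult) auto
      also have "\<dots> \<le> ennreal (2 * pi) * ennreal (e / (8 * pi)) + (ennreal (e / 2) + ennreal (2 * pi) * ennreal (e / (8 * pi)))"
      proof -
        have hi: "(\<integral>\<^sup>+x. ennreal \<bar>h x\<bar> \<partial>leb_circle) \<le> ennreal (e / (8 * pi))" using i by (simp add: h_def)
        show ?thesis
          using order_trans[OF fejer_mean_contraction[OF h] mult_left_mono[OF hi]] elim hi
          by (intro add_mono mult_left_mono) auto
      qed
      also have "\<dots> = ennreal e" using e by (simp flip: ennreal_mult ennreal_plus)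
      finally show ?case .
    qed
  qed
qed

text \<open>
  The Fejer means of \<open>\<mu>\<close> tend to \<open>2 pi \<psi>\<close> in measure. The truncation at \<open>1\<close> is there for the singular
  part, whose means keep their total mass and do not tend to \<open>0\<close> in \<open>L\<^sup>1\<close>.
\<close>

lemma fejer_ac_part:
  assumes fin: "finite_measure \<mu>" and sets[measurable_cong, simp]: "sets \<mu> = sets borel"
    and supp: "AE x in \<mu>. x \<in> {-pi..pi}" and ac: "is_ac_density \<mu> \<psi>"
  shows "(\<lambda>n. \<integral>\<^sup>+x. ennreal (min 1 \<bar>(LINT u|\<mu>. fejer n (x - u)) - 2 * pi * \<psi> x\<bar>) \<partial>leb_circle) \<longlonglongrightarrow> 0"
proof -
  interpret finite_measure \<mu> by fact
  interpret lc: finite_measure leb_circle by (rule finite_leb_circle)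
  have sp: "space \<mu> = UNIV" using sets_eq_imp_space_eq[OF sets] by simp
  obtain \<nu> S where [measurable]: "\<psi> \<in> borel_measurable borel" and nn: "\<And>x. 0 \<le> \<psi> x"
    and \<nu>[measurable_cong, simp]: "sets \<nu> = sets borel" and S: "S \<in> null_sets lborel" "emeasure \<nu> (UNIV - S) = 0"
    and dec: "\<And>A. A \<in> sets borel \<Longrightarrow> emeasure \<mu> A =
           (\<integral>\<^sup>+x\<in>A \<inter> {-pi..pi}. ennreal (\<psi> x) \<partial>lborel) + emeasure \<nu> A"
    using ac unfolding is_ac_density_def by blast
  have [measurable]: "S \<in> sets borel" using S(1) by auto
  define \<kappa> where "\<kappa> = density \<mu> (indicator S)"
  have [measurable_cong, simp]: "sets \<kappa> = sets borel" by (simp add: \<kappa>_def)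
  have em: "emeasure \<kappa> A = emeasure \<mu> (A \<inter> S)" if [measurable]: "A \<in> sets borel" for A
    unfolding \<kappa>_def by (subst emeasure_density) (auto simp: Int_commute simp flip: indicator_inter_arith)
  have fin\<kappa>: "finite_measure \<kappa>" by standard (simp add: em sets_eq_imp_space_eq[of \<kappa> borel])
  have supp\<kappa>: "AE x in \<kappa>. x \<in> {-pi..pi}"
    unfolding \<kappa>_def using supp by (subst AE_density) auto
  have ac_eq: "density \<mu> (indicator (- S)) = density leb_circle (\<lambda>x. ennreal (\<psi> x))"
  proof (rule measure_eqI)
    fix A assume "A \<in> sets (density \<mu> (indicator (- S)))"
    then have [measurable]: "A \<in> sets borel" by simp
    have "emeasure (density \<mu> (indicator (- S))) A = emeasure \<mu> (A - S)"
      by (subst emeasure_density) (auto simp: Int_commute Diff_eq simp flip: indicator_inter_arith)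
    also have "\<dots> = (\<integral>\<^sup>+x\<in>(A - S) \<inter> {-pi..pi}. ennreal (\<psi> x) \<partial>lborel) + emeasure \<nu> (A - S)"
      by (rule dec) simp
    also have "emeasure \<nu> (A - S) = 0"
      using emeasure_mono[of "A - S" "UNIV - S" \<nu>] S(2) by auto
    also have "(\<integral>\<^sup>+x\<in>(A - S) \<inter> {-pi..pi}. ennreal (\<psi> x) \<partial>lborel) + 0 = (\<integral>\<^sup>+x. ennreal (\<psi> x) * indicator A x * indicator {-pi..pi} x \<partial>lborel)"
      unfolding add_0_right
    proof (rule nn_integral_cong_AE)
      show "AE x in lborel. ennreal (\<psi> x) * indicator ((A - S) \<inter> {-pi..pi}) x = ennreal (\<psi> x) * indicator A x * indicator {-pi..pi} x"
        using AE_not_in[OF S(1)] by eventually_elim (auto simp: indicator_def)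
    qed
    also have "\<dots> = emeasure (density leb_circle (\<lambda>x. ennreal (\<psi> x))) A"
      by (subst emeasure_density, measurable, subst nn_integral_leb_circle) auto
    finally show "emeasure (density \<mu> (indicator (- S))) A = emeasure (density leb_circle (\<lambda>x. ennreal (\<psi> x))) A" .
  qed simp
  have int: "integrable leb_circle \<psi>"
  proof (rule integrableI_nonneg)
    have "(\<integral>\<^sup>+x. ennreal (\<psi> x) \<partial>leb_circle) = (\<integral>\<^sup>+x\<in>UNIV \<inter> {-pi..pi}. ennreal (\<psi> x) \<partial>lborel)"
      by (subst nn_integral_leb_circle) auto
    also have "\<dots> \<le> emeasure \<mu> UNIV" using dec[of UNIV] by (simp add: add_increasing2)
    also have "\<dots> < \<infinity>" by (simp add: less_top[symmetric])
    finally show "(\<integral>\<^sup>+x. ennreal (\<psi> x) \<partial>leb_circle) < \<infinity>" .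
  qed (use nn in auto)
  let ?m = "\<lambda>n x. LINT u|leb_circle. fejer n (x - u) * \<psi> u"
  have split: "ennreal (LINT u|\<mu>. fejer n (x - u)) = fejer_conv \<kappa> n x + ennreal (?m n x)" for n x
  proof -
    have "integrable \<mu> (\<lambda>u. fejer n (x - u))"
      by (rule integrable_const_bound[where B="real n"]) (auto simp: fejer_nonneg fejer_le)
    then have "ennreal (LINT u|\<mu>. fejer n (x - u)) = (\<integral>\<^sup>+u. ennreal (fejer n (x - u)) \<partial>\<mu>)"
      by (rule nn_integral_eq_integral[symmetric]) (simp add: fejer_nonneg)
    also have "\<dots> = (\<integral>\<^sup>+u. indicator S u * ennreal (fejer n (x - u)) + indicator (- S) u * ennreal (fejer n (x - u)) \<partial>\<mu>)"
      by (intro nn_integral_cong) (auto simp: indicator_def)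
    also have "\<dots> = fejer_conv \<kappa> n x + fejer_conv (density \<mu> (indicator (- S))) n x"
      unfolding fejer_conv_def \<kappa>_def by (subst nn_integral_add) (auto simp: nn_integral_density)
    also have "fejer_conv (density \<mu> (indicator (- S))) n x = ennreal (?m n x)"
      unfolding ac_eq by (rule fejer_conv_density[OF int nn])
    finally show ?thesis .
  qed
  have m_nn: "0 \<le> ?m n x" for n x
    by (rule Bochner_Integration.integral_nonneg) (simp add: fejer_nonneg nn)
  note [measurable] = fejer_conv_measurable[OF fin\<kappa>]
  have lim1: "(\<lambda>n. \<integral>\<^sup>+x\<in>- S. min 1 (fejer_conv \<kappa> n x) \<partial>leb_circle) \<longlonglongrightarrow> 0"
    by (rule fejer_conv_null_set[OF fin\<kappa> _ supp\<kappa>]) (auto simp: em)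
  have "(\<lambda>n. (\<integral>\<^sup>+x\<in>- S. min 1 (fejer_conv \<kappa> n x) \<partial>leb_circle) + (\<integral>\<^sup>+x. ennreal \<bar>?m n x - 2 * pi * \<psi> x\<bar> \<partial>leb_circle)) \<longlonglongrightarrow> 0 + 0"
    by (intro tendsto_add lim1 fejer_mean_L1 int)
  then have "(\<lambda>n. (\<integral>\<^sup>+x\<in>- S. min 1 (fejer_conv \<kappa> n x) \<partial>leb_circle) + (\<integral>\<^sup>+x. ennreal \<bar>?m n x - 2 * pi * \<psi> x\<bar> \<partial>leb_circle)) \<longlonglongrightarrow> 0"
    by simp
  then show ?thesis
  proof (rule tendsto_sandwich[OF _ _ tendsto_const, rotated 2])
    show "\<forall>\<^sub>F n in sequentially. (\<integral>\<^sup>+x. ennreal (min 1 \<bar>(LINT u|\<mu>. fejer n (x - u)) - 2 * pi * \<psi> x\<bar>) \<partial>leb_circle)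
      \<le> (\<integral>\<^sup>+x\<in>- S. min 1 (fejer_conv \<kappa> n x) \<partial>leb_circle) + (\<integral>\<^sup>+x. ennreal \<bar>?m n x - 2 * pi * \<psi> x\<bar> \<partial>leb_circle)"
    proof (intro always_eventually allI)
      fix n
      have "(\<integral>\<^sup>+x. ennreal (min 1 \<bar>(LINT u|\<mu>. fejer n (x - u)) - 2 * pi * \<psi> x\<bar>) \<partial>leb_circle)
        \<le> (\<integral>\<^sup>+x. min 1 (fejer_conv \<kappa> n x) * indicator (- S) x + ennreal \<bar>?m n x - 2 * pi * \<psi> x\<bar> \<partial>leb_circle)"
      proof (rule nn_integral_mono_AE)
        have "AE x in lborel. ennreal (min 1 \<bar>(LINT u|\<mu>. fejer n (x - u)) - 2 * pi * \<psi> x\<bar>)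
          \<le> min 1 (fejer_conv \<kappa> n x) * indicator (- S) x + ennreal \<bar>?m n x - 2 * pi * \<psi> x\<bar>"
          using AE_not_in[OF S(1)]
        proof eventually_elim
          case (elim x)
          obtain r where r: "fejer_conv \<kappa> n x = ennreal r" "0 \<le> r"
            using split[of n x] by (cases "fejer_conv \<kappa> n x") auto
          have "0 \<le> (LINT u|\<mu>. fejer n (x - u))"
            by (rule Bochner_Integration.integral_nonneg) (simp add: fejer_nonneg)
          then have L: "(LINT u|\<mu>. fejer n (x - u)) = r + ?m n x"
            using split[of n x] m_nn[of n x] r by (simp flip: ennreal_plus)
          have "min 1 \<bar>r + ?m n x - 2 * pi * \<psi> x\<bar> \<le> min 1 r + \<bar>?m n x - 2 * pi * \<psi> x\<bar>"
            using r(2) by linarith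
          from ennreal_leI[OF this] have "ennreal (min 1 \<bar>r + ?m n x - 2 * pi * \<psi> x\<bar>) \<le> ennreal (min 1 r) + ennreal \<bar>?m n x - 2 * pi * \<psi> x\<bar>"
            using r(2) by simp
          also have "ennreal (min 1 r) = min 1 (ennreal r)" using r(2) by (auto simp: min_def ennreal_le_1)
          finally show ?case using elim by (simp add: L r(1))
        qed
        then show "AE x in leb_circle. ennreal (min 1 \<bar>(LINT u|\<mu>. fejer n (x - u)) - 2 * pi * \<psi> x\<bar>)
          \<le> min 1 (fejer_conv \<kappa> n x) * indicator (- S) x + ennreal \<bar>?m n x - 2 * pi * \<psi> x\<bar>"
          by (subst AE_density) auto
      qed
      also have "\<dots> = (\<integral>\<^sup>+x\<in>- S. min 1 (fejer_conv \<kappa> n x) \<partial>leb_circle) + (\<integral>\<^sup>+x. ennreal \<bar>?m n x - 2 * pi * \<psi> x\<bar> \<partial>leb_circle)"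
        by (rule nn_integral_add) measurable
      finally show "(\<integral>\<^sup>+x. ennreal (min 1 \<bar>(LINT u|\<mu>. fejer n (x - u)) - 2 * pi * \<psi> x\<bar>) \<partial>leb_circle)
        \<le> (\<integral>\<^sup>+x\<in>- S. min 1 (fejer_conv \<kappa> n x) \<partial>leb_circle) + (\<integral>\<^sup>+x. ennreal \<bar>?m n x - 2 * pi * \<psi> x\<bar> \<partial>leb_circle)" .
    qed
  qed simp
qed

section \<open>Gaussian characteristic functions of the random trigonometric polynomials\<close>

text \<open>
  A degenerate centered Gaussian variable vanishes almost surely, and the three formulas hold for it with
  variance \<open>0\<close>.
\<close>

lemma gaussian_rv_centered:
  assumes "prob_space M" and Y: "gaussian_rv M Y" and mean: "(LINT \<omega>|M. Y \<omega>) = 0"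
  shows gaussian_rv_integrable_power: "integrable M (\<lambda>\<omega>. Y \<omega> ^ k)"
    and gaussian_rv_fourth_moment: "(LINT \<omega>|M. Y \<omega> ^ 4) = 3 * (LINT \<omega>|M. (Y \<omega>)\<^sup>2)\<^sup>2"
    and gaussian_rv_char: "(CLINT \<omega>|M. iexp (Y \<omega>)) = complex_of_real (exp (- (LINT \<omega>|M. (Y \<omega>)\<^sup>2) / 2))"
proof -
  interpret prob_space M by fact
  have Ym[measurable]: "Y \<in> borel_measurable M" using Y by (simp add: gaussian_rv_def)
  consider m \<sigma> where "\<sigma> > 0" "distributed M lborel Y (normal_density m \<sigma>)" | m where "AE \<omega> in M. Y \<omega> = m"
    using Y by (auto simp: gaussian_rv_def)
  then have "integrable M (\<lambda>\<omega>. Y \<omega> ^ k) \<and> (LINT \<omega>|M. Y \<omega> ^ 4) = 3 * (LINT \<omega>|M. (Y \<omega>)\<^sup>2)\<^sup>2 \<and>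
     (CLINT \<omega>|M. iexp (Y \<omega>)) = complex_of_real (exp (- (LINT \<omega>|M. (Y \<omega>)\<^sup>2) / 2))"
  proof cases
    case 1
    have "m = 0" using normal_distributed_expectation[OF 1] mean by simp
    define Z where "Z \<omega> = Y \<omega> / \<sigma>" for \<omega>
    have Z: "distributed M lborel Z std_normal_density"
      using 1 \<open>m = 0\<close> normal_standard_normal_convert[OF 1(1), of Y 0] by (simp add: Z_def[abs_def])
    have YZ: "Y \<omega> = \<sigma> * Z \<omega>" for \<omega> using 1 by (simp add: Z_def)
    have Zm[measurable]: "Z \<in> borel_measurable M" unfolding Z_def by measurable
    have distr: "distr M borel Z = std_normal_distribution"
      using distributed_distr_eq_density[OF Z] by (simp cong: distr_cong)
    have intZ: "integrable M (\<lambda>\<omega>. Z \<omega> ^ j)" for j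
      using integrable_std_normal_distribution_moment[of j]
      by (subst integrable_distr_eq[of Z M borel "\<lambda>x. x ^ j", symmetric]) (simp_all add: distr)
    have EZ: "(LINT \<omega>|M. Z \<omega> ^ (2 * j)) = fact (2 * j) / (2 ^ j * fact j)" for j
      using std_normal_distribution_even_moments(1)[of j]
      by (subst integral_distr[of Z M borel "\<lambda>x. x ^ (2 * j)", symmetric]) (simp_all add: distr)
    have Y2: "(LINT \<omega>|M. (Y \<omega>)\<^sup>2) = \<sigma>\<^sup>2"
      using EZ[of 1] by (simp add: YZ power_mult_distrib)
    have Y4: "(LINT \<omega>|M. Y \<omega> ^ 4) = 3 * \<sigma> ^ 4"
      using EZ[of 2] by (simp add: YZ power_mult_distrib fact_numeral)
    have "(CLINT \<omega>|M. iexp (Y \<omega>)) = char (distr M borel Z) \<sigma>"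
      unfolding char_def by (subst integral_distr) (auto simp: YZ)
    also have "\<dots> = complex_of_real (exp (- \<sigma>\<^sup>2 / 2))"
      by (simp add: distr char_std_normal_distribution)
    finally show ?thesis using intZ[of k] Y4 by (simp add: Y2) (simp add: YZ power_mult_distrib)
  next
    case 2
    have "(LINT \<omega>|M. Y \<omega>) = (LINT \<omega>|M. m)" by (rule integral_cong_AE) (use 2 in auto)
    then have "m = 0" using mean by (simp add: prob_space)
    with 2 have Y0: "AE \<omega> in M. Y \<omega> = 0" by simp
    have "(LINT \<omega>|M. (Y \<omega>)\<^sup>2) = (LINT \<omega>|M. 0)" by (rule integral_cong_AE) (use Y0 in auto)
    moreover have "(LINT \<omega>|M. Y \<omega> ^ 4) = (LINT \<omega>|M. 0)" by (rule integral_cong_AE) (use Y0 in auto)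
    moreover have "(CLINT \<omega>|M. iexp (Y \<omega>)) = (CLINT \<omega>|M. 1)" by (rule integral_cong_AE) (use Y0 in auto)
    moreover have "integrable M (\<lambda>\<omega>. Y \<omega> ^ k)"
      by (rule integrable_const_bound[where B=1]) (use Y0 in \<open>auto simp: power_0_left\<close>)
    ultimately show ?thesis by (simp add: prob_space)
  qed
  then show "integrable M (\<lambda>\<omega>. Y \<omega> ^ k)" "(LINT \<omega>|M. Y \<omega> ^ 4) = 3 * (LINT \<omega>|M. (Y \<omega>)\<^sup>2)\<^sup>2"
     "(CLINT \<omega>|M. iexp (Y \<omega>)) = complex_of_real (exp (- (LINT \<omega>|M. (Y \<omega>)\<^sup>2) / 2))" by auto
qed

lemma spectral_cov_eq:
  assumes "prob_space \<mu>" and sets[measurable_cong]: "sets \<mu> = sets borel"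
  shows "Re (spectral_cov \<mu> k) = (LINT u|\<mu>. cos (of_int k * u))"
    and "Im (spectral_cov \<mu> k) = - (LINT u|\<mu>. sin (of_int k * u))"
proof -
  interpret prob_space \<mu> by fact
  have int: "integrable \<mu> (\<lambda>u. iexp (- (of_int k * u)))"
    by (rule integrable_const_bound[where B=1]) auto
  show "Re (spectral_cov \<mu> k) = (LINT u|\<mu>. cos (of_int k * u))"
    unfolding spectral_cov_def by (subst integral_Re[OF int, symmetric]) (simp add: Re_exp)
  show "Im (spectral_cov \<mu> k) = - (LINT u|\<mu>. sin (of_int k * u))"
    unfolding spectral_cov_def by (subst integral_Im[OF int, symmetric]) (simp add: Im_exp)
qed

locale gaussian_pair = prob_space M + spectral: prob_space \<mu>
  for M :: "'w measure" and \<mu> :: "real measure" +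
  fixes a b :: "nat \<Rightarrow> 'w \<Rightarrow> real"
  assumes sets_mu[measurable_cong, simp]: "sets \<mu> = sets borel"
    and support: "AE u in \<mu>. u \<in> {-pi..pi}"
    and gauss_a: "stationary_gaussian_seq M (spectral_cov \<mu>) a"
    and gauss_b: "stationary_gaussian_seq M (spectral_cov \<mu>) b"
    and indep: "indep_sequences M a b"
begin

definition cov :: "nat \<Rightarrow> nat \<Rightarrow> real" where
  "cov k l = (LINT u|\<mu>. cos ((real k - real l) * u))"

lemma cov_commute: "cov k l = cov l k"
proof -
  have "cos ((real k - real l) * u) = cos ((real l - real k) * u)" for u
    by (metis cos_minus minus_diff_eq mult_minus_left)
  then show ?thesis by (simp add: cov_def)
qed

text \<open>
  The covariance is the real part of a Fourier coefficient of \<open>\<mu>\<close>, and the sign of \<open>k - l\<close> does not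
  affect it. The imaginary part of the Fourier coefficient of \<open>\<mu>\<close> vanishes because it equals the expectation of a
  product of real variables.
\<close>

lemma seq_moments:
  assumes "stationary_gaussian_seq M (spectral_cov \<mu>) g" and k: "1 \<le> k" and l: "1 \<le> l"
  shows seq_cov: "(LINT \<omega>|M. g k \<omega> * g l \<omega>) = cov k l"
    and seq_sin: "(LINT u|\<mu>. sin ((real k - real l) * u)) = 0"
proof -
  have e: "complex_of_real (LINT \<omega>|M. g k \<omega> * g l \<omega>) = spectral_cov \<mu> \<bar>int k - int l\<bar>"
    using assms by (auto simp: stationary_gaussian_seq_def)
  have "(LINT \<omega>|M. g k \<omega> * g l \<omega>) = Re (spectral_cov \<mu> \<bar>int k - int l\<bar>)"
    by (simp flip: e)
  also have "\<dots> = cov k l"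
    unfolding spectral_cov_eq(1)[OF spectral.prob_space_axioms sets_mu]
    using cov_commute[of k l] by (cases "k \<le> l") (simp_all add: cov_def abs_if of_nat_diff algebra_simps)
  finally show "(LINT \<omega>|M. g k \<omega> * g l \<omega>) = cov k l" .
  have "Im (spectral_cov \<mu> \<bar>int k - int l\<bar>) = 0" by (simp flip: e)
  then have z: "(LINT u|\<mu>. sin (of_int \<bar>int k - int l\<bar> * u)) = 0"
    unfolding spectral_cov_eq(2)[OF spectral.prob_space_axioms sets_mu] by simp
  show "(LINT u|\<mu>. sin ((real k - real l) * u)) = 0"
  proof (cases "k \<le> l")
    case True
    have "sin ((real k - real l) * u) = - sin (of_int \<bar>int k - int l\<bar> * u)" for u
      using True sin_minus[of "(real l - real k) * u"] by (simp add: abs_if algebra_simps)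
    then show ?thesis using z by simp
  qed (use z in \<open>simp add: abs_if\<close>)
qed

text \<open>
  The covariance matrix of the first \<open>n\<close> coefficients as a bilinear form.
\<close>

definition quad :: "nat \<Rightarrow> (nat \<Rightarrow> real) \<Rightarrow> (nat \<Rightarrow> real) \<Rightarrow> real" where
  "quad n c d = (\<Sum>k=1..n. \<Sum>l=1..n. c k * d l * cov k l)"

lemma quad_commute: "quad n c d = quad n d c"
  unfolding quad_def by (subst sum.swap) (simp add: cov_commute mult_ac)

lemma quad_diff:
  "quad n (\<lambda>k. t * (c k - d k)) (\<lambda>k. t * (c k - d k)) = t\<^sup>2 * (quad n c c + quad n d d - 2 * quad n c d)"
proof -
  have "quad n (\<lambda>k. t * (c k - d k)) (\<lambda>k. t * (c k - d k)) = t\<^sup>2 * (quad n c c - quad n c d - quad n d c + quad n d d)"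
  proof -
    have "(t * (c k - d k)) * (t * (c l - d l)) * cov k l
      = t\<^sup>2 * (c k * c l * cov k l - c k * d l * cov k l - d k * c l * cov k l + d k * d l * cov k l)" for k l
      by (simp add: algebra_simps power2_eq_square)
    then show ?thesis
      unfolding quad_def by (simp only: sum.distrib sum_subtractf flip: sum_distrib_left)
  qed
  then show ?thesis by (simp add: quad_commute[of n d c])
qed

lemma seq_facts:
  assumes g: "stationary_gaussian_seq M (spectral_cov \<mu>) g"
  shows seq_measurable: "1 \<le> k \<Longrightarrow> g k \<in> borel_measurable M"
    and seq_integrable_power: "1 \<le> k \<Longrightarrow> integrable M (\<lambda>\<omega>. g k \<omega> ^ j)"
    and seq_fourth: "1 \<le> k \<Longrightarrow> (LINT \<omega>|M. g k \<omega> ^ 4) = 3"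
    and seq_lincomb_sq: "(LINT \<omega>|M. (\<Sum>k=1..n. c k * g k \<omega>)\<^sup>2) = quad n c c"
    and seq_lincomb_char: "(CLINT \<omega>|M. iexp (\<Sum>k=1..n. c k * g k \<omega>)) = complex_of_real (exp (- quad n c c / 2))"
proof -
  have gp: "gaussian_process M {1..} g" and mean: "\<And>k. 1 \<le> k \<Longrightarrow> (LINT \<omega>|M. g k \<omega>) = 0"
    using g by (auto simp: stationary_gaussian_seq_def)
  show meas: "g k \<in> borel_measurable M" if "1 \<le> k" for k
    using gp that by (auto simp: gaussian_process_def)
  have lin: "gaussian_rv M (\<lambda>\<omega>. \<Sum>k\<in>J. c k * g k \<omega>)" if "finite J" "J \<subseteq> {1..}" for J c
    using gp that by (auto simp: gaussian_process_def)
  have grv: "gaussian_rv M (g k)" if "1 \<le> k" for k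
    using lin[of "{k}" "\<lambda>_. 1"] that by simp
  show intp: "integrable M (\<lambda>\<omega>. g k \<omega> ^ j)" if "1 \<le> k" for k j
    by (rule gaussian_rv_integrable_power[OF prob_space_axioms grv mean]) (use that in auto)
  show "(LINT \<omega>|M. g k \<omega> ^ 4) = 3" if "1 \<le> k"
  proof -
    have "(LINT \<omega>|M. (g k \<omega>)\<^sup>2) = cov k k"
      using seq_cov[OF g that that] by (simp add: power2_eq_square)
    also have "\<dots> = 1" by (simp add: cov_def spectral.prob_space)
    finally show ?thesis
      using gaussian_rv_fourth_moment[OF prob_space_axioms grv[OF that] mean[OF that]] by simp
  qed
  have int1: "integrable M (g k)" if "1 \<le> k" for k using intp[OF that, of 1] by simp
  have int2: "integrable M (\<lambda>\<omega>. g k \<omega> * g l \<omega>)" if "1 \<le> k" "1 \<le> l" for k l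
  proof (rule Bochner_Integration.integrable_bound)
    show "integrable M (\<lambda>\<omega>. (g k \<omega>)\<^sup>2 + (g l \<omega>)\<^sup>2)" using intp that by auto
    have "\<bar>x * y\<bar> \<le> x\<^sup>2 + y\<^sup>2" for x y :: real
    proof -
      have "2 * (\<bar>x\<bar> * \<bar>y\<bar>) \<le> x\<^sup>2 + y\<^sup>2" using sum_squares_bound[of "\<bar>x\<bar>" "\<bar>y\<bar>"] by simp
      moreover have "0 \<le> \<bar>x\<bar> * \<bar>y\<bar>" by simp
      ultimately show ?thesis unfolding abs_mult by linarith
    qed
    then show "AE \<omega> in M. norm (g k \<omega> * g l \<omega>) \<le> norm ((g k \<omega>)\<^sup>2 + (g l \<omega>)\<^sup>2)" by simp
    show "(\<lambda>\<omega>. g k \<omega> * g l \<omega>) \<in> borel_measurable M" using meas[OF that(1)] meas[OF that(2)] by measurable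
  qed
  have sq: "(LINT \<omega>|M. (\<Sum>k=1..n. c k * g k \<omega>)\<^sup>2) = quad n c c"
  proof -
    have "(\<Sum>k=1..n. c k * g k \<omega>)\<^sup>2 = (\<Sum>k=1..n. \<Sum>l=1..n. (c k * c l) * (g k \<omega> * g l \<omega>))" for \<omega>
      unfolding power2_eq_square sum_product by (simp add: mult_ac)
    then have "(LINT \<omega>|M. (\<Sum>k=1..n. c k * g k \<omega>)\<^sup>2) = (LINT \<omega>|M. (\<Sum>k=1..n. \<Sum>l=1..n. (c k * c l) * (g k \<omega> * g l \<omega>)))"
      by simp
    also have "\<dots> = (\<Sum>k=1..n. (LINT \<omega>|M. (\<Sum>l=1..n. (c k * c l) * (g k \<omega> * g l \<omega>))))"
      by (rule Bochner_Integration.integral_sum) (use int2 in \<open>auto intro!: Bochner_Integration.integrable_sum\<close>)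
    also have "\<dots> = (\<Sum>k=1..n. \<Sum>l=1..n. (LINT \<omega>|M. (c k * c l) * (g k \<omega> * g l \<omega>)))"
      by (intro sum.cong refl Bochner_Integration.integral_sum) (use int2 in auto)
    also have "\<dots> = quad n c c"
      unfolding quad_def by (intro sum.cong refl) (simp add: seq_cov[OF g])
    finally show ?thesis .
  qed
  show "(LINT \<omega>|M. (\<Sum>k=1..n. c k * g k \<omega>)\<^sup>2) = quad n c c" by (rule sq)
  have "(LINT \<omega>|M. (\<Sum>k=1..n. c k * g k \<omega>)) = (\<Sum>k=1..n. (LINT \<omega>|M. c k * g k \<omega>))"
    by (rule Bochner_Integration.integral_sum) (use int1 in auto)
  also have "\<dots> = 0" by (simp add: mean)
  finally show "(CLINT \<omega>|M. iexp (\<Sum>k=1..n. c k * g k \<omega>)) = complex_of_real (exp (- quad n c c / 2))"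
    using gaussian_rv_char[OF prob_space_axioms lin[of "{1..n}" c]] unfolding sq by simp
qed

lemma quad_nonneg: "0 \<le> quad n c c"
  unfolding seq_lincomb_sq[OF gauss_a, symmetric] by (rule Bochner_Integration.integral_nonneg) simp

text \<open>
  By independence the characteristic functions of the two linear combinations multiply, so that the
  exponents add up to minus half the variance of the sum.
\<close>

lemma pair_char:
  "(CLINT \<omega>|M. iexp (\<Sum>k=1..n. c k * a k \<omega> + d k * b k \<omega>)) = complex_of_real (exp (- (quad n c c + quad n d d) / 2))"
proof -
  define A where "A \<omega> = (\<Sum>k=1..n. c k * a k \<omega>)" for \<omega>
  define B where "B \<omega> = (\<Sum>k=1..n. d k * b k \<omega>)" for \<omega>
  have L: "(\<lambda>x. \<Sum>k=1..n. e k * x k) \<in> borel_measurable (PiM {1..} (\<lambda>_. borel))" for e :: "nat \<Rightarrow> real"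
    by (intro borel_measurable_sum borel_measurable_times measurable_component_singleton) auto
  have "indep_var borel ((\<lambda>x. \<Sum>k=1..n. c k * x k) \<circ> (\<lambda>\<omega>. \<lambda>k\<in>{1..}. a k \<omega>)) borel ((\<lambda>x. \<Sum>k=1..n. d k * x k) \<circ> (\<lambda>\<omega>. \<lambda>k\<in>{1..}. b k \<omega>))"
    using indep[unfolded indep_sequences_def] by (rule indep_var_compose) (rule L)+
  moreover have "(\<lambda>x. \<Sum>k=1..n. c k * x k) \<circ> (\<lambda>\<omega>. \<lambda>k\<in>{1..}. a k \<omega>) = A" "(\<lambda>x. \<Sum>k=1..n. d k * x k) \<circ> (\<lambda>\<omega>. \<lambda>k\<in>{1..}. b k \<omega>) = B"
    by (auto simp: fun_eq_iff A_def B_def)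
  ultimately have AB: "indep_var borel A borel B" by simp
  have [measurable]: "A \<in> borel_measurable M" "B \<in> borel_measurable M"
    using indep_var_rv1[OF AB] indep_var_rv2[OF AB] by auto
  have "(CLINT \<omega>|M. iexp (A \<omega> + B \<omega>)) = (CLINT \<omega>|M. iexp (A \<omega>)) * (CLINT \<omega>|M. iexp (B \<omega>))"
    using char_distr_add[OF AB, of 1] by (simp add: char_def integral_distr)
  also have "\<dots> = complex_of_real (exp (- quad n c c / 2)) * complex_of_real (exp (- quad n d d / 2))"
    unfolding A_def B_def seq_lincomb_char[OF gauss_a] seq_lincomb_char[OF gauss_b] ..
  also have "\<dots> = complex_of_real (exp (- (quad n c c + quad n d d) / 2))"
    unfolding of_real_mult[symmetric] exp_add[symmetric] by (simp add: add_divide_distrib)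
  finally show ?thesis by (simp add: A_def B_def sum.distrib)
qed

text \<open>
  The covariance of \<open>f\<^sub>n(x)\<close> and \<open>f\<^sub>n(y)\<close>; this form exhibits the kernels that control it on the diagonal and in
  the mean.
\<close>

definition pcov :: "nat \<Rightarrow> real \<Rightarrow> real \<Rightarrow> real" where
  "pcov n x y = (LINT u|\<mu>. Re (dirichlet n (x - u) * cnj (dirichlet n (y - u)))) / real n"

lemma integrable_bounded_mu:
  assumes [measurable]: "f \<in> borel_measurable borel" and "\<And>u. \<bar>f u\<bar> \<le> C"
  shows "integrable \<mu> (f :: real \<Rightarrow> real)"
  by (rule spectral.integrable_const_bound[where B=C]) (use assms in auto)

text \<open>
  For real \<open>\<rho>\<close> one has \<open>\<rho>(k - l) cos (kx - ly) = \<integral> cos (k(x - u) - l(y - u)) \<mu>(du)\<close>, and summing over \<open>k\<close> and \<open>l\<close>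
  produces the product of two Dirichlet kernels.
\<close>

lemma pcov_eq_quad:
  "pcov n x y = quad n (\<lambda>k. cos (real k * x) / sqrt (real n)) (\<lambda>k. cos (real k * y) / sqrt (real n))
     + quad n (\<lambda>k. sin (real k * x) / sqrt (real n)) (\<lambda>k. sin (real k * y) / sqrt (real n))"
proof -
  have kl: "(LINT u|\<mu>. Re (cis (real k * (x - u)) * cnj (cis (real l * (y - u)))))
      = cos (real k * x - real l * y) * cov k l" if "1 \<le> k" "1 \<le> l" for k l
  proof -
    have "Re (cis (real k * (x - u)) * cnj (cis (real l * (y - u))))
       = cos (real k * x - real l * y) * cos ((real k - real l) * u) + sin (real k * x - real l * y) * sin ((real k - real l) * u)" for u
    proof -
      have "Re (cis (real k * (x - u)) * cnj (cis (real l * (y - u)))) = cos ((real k * x - real l * y) - (real k - real l) * u)"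
        by (simp add: cis_cnj cis_mult algebra_simps)
      then show ?thesis by (simp only: cos_diff)
    qed
    then have "(LINT u|\<mu>. Re (cis (real k * (x - u)) * cnj (cis (real l * (y - u)))))
       = (LINT u|\<mu>. cos (real k * x - real l * y) * cos ((real k - real l) * u) + sin (real k * x - real l * y) * sin ((real k - real l) * u))"
      by simp
    also have "\<dots> = (LINT u|\<mu>. cos (real k * x - real l * y) * cos ((real k - real l) * u)) + (LINT u|\<mu>. sin (real k * x - real l * y) * sin ((real k - real l) * u))"
      by (rule Bochner_Integration.integral_add) (auto intro!: integrable_mult_right integrable_bounded_mu[where C=1])
    also have "\<dots> = cos (real k * x - real l * y) * cov k l"
      using seq_sin[OF gauss_a that] by (simp add: cov_def)
    finally show ?thesis .
  qed
  have "Re (dirichlet n (x - u) * cnj (dirichlet n (y - u)))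
     = (\<Sum>k=1..n. \<Sum>l=1..n. Re (cis (real k * (x - u)) * cnj (cis (real l * (y - u)))))" for u
    unfolding dirichlet_def cnj_sum sum_product Re_sum ..
  then have "(LINT u|\<mu>. Re (dirichlet n (x - u) * cnj (dirichlet n (y - u))))
     = (LINT u|\<mu>. (\<Sum>k=1..n. \<Sum>l=1..n. Re (cis (real k * (x - u)) * cnj (cis (real l * (y - u))))))"
    by simp
  also have "\<dots> = (\<Sum>k=1..n. \<Sum>l=1..n. (LINT u|\<mu>. Re (cis (real k * (x - u)) * cnj (cis (real l * (y - u))))))"
  proof -
    have int: "integrable \<mu> (\<lambda>u. Re (cis (real k * (x - u)) * cnj (cis (real l * (y - u)))))" for k l
      unfolding cis_cnj cis_mult cis.sel by (rule integrable_bounded_mu[where C=1]) auto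
    show ?thesis
      by (subst Bochner_Integration.integral_sum, intro Bochner_Integration.integrable_sum int,
          intro sum.cong refl Bochner_Integration.integral_sum int)
  qed
  also have "\<dots> = (\<Sum>k=1..n. \<Sum>l=1..n. cos (real k * x - real l * y) * cov k l)"
    by (intro sum.cong refl kl) auto
  finally have 1: "pcov n x y = (\<Sum>k=1..n. \<Sum>l=1..n. cos (real k * x - real l * y) * cov k l) / real n"
    by (simp add: pcov_def)
  show ?thesis
    unfolding 1 quad_def sum.distrib[symmetric] sum_divide_distrib
    by (intro sum.cong refl) (simp add: cos_diff algebra_simps add_divide_distrib)
qed

lemma pcov_diag: "pcov n x x = (LINT u|\<mu>. fejer n (x - u))"
proof -
  have "Re (dirichlet n (x - u) * cnj (dirichlet n (x - u))) = (norm (dirichlet n (x - u)))\<^sup>2" for u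
    by (metis complex_norm_square Re_complex_of_real)
  then show ?thesis by (simp add: pcov_def fejer_def)
qed

lemma pcov_diag_nonneg: "0 \<le> pcov n x x"
  unfolding pcov_diag by (rule Bochner_Integration.integral_nonneg) (simp add: fejer_nonneg)

lemma trig_poly_eq:
  "trig_poly a b n \<omega> x = (\<Sum>k=1..n. (cos (real k * x) / sqrt (real n)) * a k \<omega> + (sin (real k * x) / sqrt (real n)) * b k \<omega>)"
  unfolding trig_poly_def sum_distrib_left by (intro sum.cong refl) (simp add: field_simps)

lemma trig_poly_char:
  "(CLINT \<omega>|M. iexp (t * trig_poly a b n \<omega> x)) = complex_of_real (exp (- (t\<^sup>2 * pcov n x x) / 2))"
proof -
  have "t * trig_poly a b n \<omega> x = (\<Sum>k=1..n. (t * (cos (real k * x) / sqrt (real n) - 0)) * a k \<omega> + (t * (sin (real k * x) / sqrt (real n) - 0)) * b k \<omega>)" for \<omega>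
    unfolding trig_poly_eq sum_distrib_left by (intro sum.cong refl) (simp add: algebra_simps)
  moreover have "quad n c (\<lambda>_. 0) = 0" for c by (simp add: quad_def)
  ultimately show ?thesis
    unfolding pcov_eq_quad by (simp only: pair_char quad_diff) (simp add: distrib_left)
qed

lemma trig_poly_char_diff:
  "(CLINT \<omega>|M. iexp (t * (trig_poly a b n \<omega> x - trig_poly a b n \<omega> y)))
     = complex_of_real (exp (- (t\<^sup>2 * (pcov n x x + pcov n y y - 2 * pcov n x y)) / 2))"
  and pcov_triangle: "0 \<le> pcov n x x + pcov n y y - 2 * pcov n x y"
proof -
  let ?c = "\<lambda>x k. cos (real k * x) / sqrt (real n)" and ?d = "\<lambda>x k. sin (real k * x) / sqrt (real n)"
  have "t * (trig_poly a b n \<omega> x - trig_poly a b n \<omega> y) = (\<Sum>k=1..n. (t * (?c x k - ?c y k)) * a k \<omega> + (t * (?d x k - ?d y k)) * b k \<omega>)" for \<omega>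
    unfolding trig_poly_eq sum_subtractf[symmetric] sum_distrib_left by (intro sum.cong refl) (simp add: algebra_simps)
  then have "(CLINT \<omega>|M. iexp (t * (trig_poly a b n \<omega> x - trig_poly a b n \<omega> y)))
     = complex_of_real (exp (- (quad n (\<lambda>k. t * (?c x k - ?c y k)) (\<lambda>k. t * (?c x k - ?c y k)) + quad n (\<lambda>k. t * (?d x k - ?d y k)) (\<lambda>k. t * (?d x k - ?d y k))) / 2))"
    by (simp only: pair_char)
  then show "(CLINT \<omega>|M. iexp (t * (trig_poly a b n \<omega> x - trig_poly a b n \<omega> y)))
     = complex_of_real (exp (- (t\<^sup>2 * (pcov n x x + pcov n y y - 2 * pcov n x y)) / 2))"
    unfolding pcov_eq_quad quad_diff by (simp only: algebra_simps)
  have "0 \<le> quad n (\<lambda>k. 1 * (?c x k - ?c y k)) (\<lambda>k. 1 * (?c x k - ?c y k)) + quad n (\<lambda>k. 1 * (?d x k - ?d y k)) (\<lambda>k. 1 * (?d x k - ?d y k))"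
    by (intro add_nonneg_nonneg quad_nonneg)
  then show "0 \<le> pcov n x x + pcov n y y - 2 * pcov n x y"
    unfolding quad_diff pcov_eq_quad by (simp add: algebra_simps)
qed

end

section \<open>Averages over independent randomness and almost sure convergence\<close>

text \<open>
  The first Borel-Cantelli lemma in integrated form: the sum of the \<open>Y j\<close> has finite expectation, hence is
  finite almost surely.
\<close>

lemma AE_tendsto_0_of_inverse_square:
  fixes Y :: "nat \<Rightarrow> 'a \<Rightarrow> real"
  assumes [measurable]: "\<And>j. Y j \<in> borel_measurable M" and nn: "\<And>j \<omega>. 0 \<le> Y j \<omega>"
    and bound: "\<And>j. 1 \<le> j \<Longrightarrow> (\<integral>\<^sup>+\<omega>. ennreal (Y j \<omega>) \<partial>M) \<le> ennreal (C / (real j)\<^sup>2)"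
  shows "AE \<omega> in M. (\<lambda>j. Y j \<omega>) \<longlonglongrightarrow> 0"
proof -
  define D where "D = max 0 C"
  have "summable (\<lambda>j. D * inverse (real (Suc j) ^ 2))"
    by (rule summable_mult[OF summable_Suc_iff[where f="\<lambda>j. inverse (real j ^ 2)", THEN iffD2,
          OF inverse_power_summable]]) simp
  then have fin: "(\<Sum>j. ennreal (D * inverse (real (Suc j) ^ 2))) < \<infinity>"
    by (subst suminf_ennreal2) (auto simp: D_def)
  have "(\<integral>\<^sup>+\<omega>. (\<Sum>j. ennreal (Y (Suc j) \<omega>)) \<partial>M) = (\<Sum>j. \<integral>\<^sup>+\<omega>. ennreal (Y (Suc j) \<omega>) \<partial>M)"
    by (rule nn_integral_suminf) measurable
  also have "\<dots> \<le> (\<Sum>j. ennreal (D * inverse (real (Suc j) ^ 2)))"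
  proof (rule suminf_le)
    fix j
    have "C / (real (Suc j))\<^sup>2 \<le> D * inverse (real (Suc j) ^ 2)"
      unfolding divide_inverse by (rule mult_right_mono) (auto simp: D_def)
    then show "(\<integral>\<^sup>+\<omega>. ennreal (Y (Suc j) \<omega>) \<partial>M) \<le> ennreal (D * inverse (real (Suc j) ^ 2))"
      using order_trans[OF bound[of "Suc j"] ennreal_leI] by simp
  qed auto
  finally have "(\<integral>\<^sup>+\<omega>. (\<Sum>j. ennreal (Y (Suc j) \<omega>)) \<partial>M) \<noteq> \<infinity>" using fin by auto
  then have "AE \<omega> in M. (\<Sum>j. ennreal (Y (Suc j) \<omega>)) \<noteq> \<infinity>"
    by (intro nn_integral_PInf_AE) auto
  then show ?thesis
  proof eventually_elim
    case (elim \<omega>)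
    then have "summable (\<lambda>j. Y (Suc j) \<omega>)" by (intro summable_suminf_not_top) (auto simp: nn)
    then have "(\<lambda>j. Y (Suc j) \<omega>) \<longlonglongrightarrow> 0" by (rule summable_LIMSEQ_zero)
    then show ?case by (rule LIMSEQ_imp_Suc)
  qed
qed

text \<open>
  Fubini's theorem, after \<open>|z|\<^sup>2 = z cnj z\<close> is written as an integral over two independent points with law
  \<open>U\<close>.
\<close>

lemma second_moment_of_average_le:
  fixes W :: "'w \<Rightarrow> 'x \<Rightarrow> complex"
  assumes "prob_space M" "prob_space U"
    and W[measurable]: "case_prod W \<in> borel_measurable (M \<Otimes>\<^sub>M U)" and bd: "\<And>\<omega> x. norm (W \<omega> x) \<le> B"
  shows "(\<integral>\<^sup>+\<omega>. ennreal ((norm (CLINT x|U. W \<omega> x))\<^sup>2) \<partial>M)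
     \<le> (\<integral>\<^sup>+p. ennreal (norm (CLINT \<omega>|M. W \<omega> (fst p) * cnj (W \<omega> (snd p)))) \<partial>(U \<Otimes>\<^sub>M U))"
proof -
  interpret M: prob_space M by fact
  interpret U: prob_space U by fact
  interpret UU: pair_prob_space U U ..
  interpret P: pair_prob_space M "U \<Otimes>\<^sub>M U" ..
  have B0: "0 \<le> B" using bd norm_ge_zero order_trans by blast
  have W2[measurable]: "(\<lambda>x. W \<omega> x) \<in> borel_measurable U" if "\<omega> \<in> space M" for \<omega>
    using that by measurable
  have intW: "integrable U (\<lambda>x. W \<omega> x)" if "\<omega> \<in> space M" for \<omega>
    by (rule U.integrable_const_bound[where B=B]) (use bd that in auto)
  define G where "G \<omega> p = W \<omega> (fst p) * cnj (W \<omega> (snd p))" for \<omega> p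
  have cnj_m: "cnj \<in> borel_measurable borel"
    by (intro borel_measurable_continuous_onI continuous_intros)
  have Gm[measurable]: "case_prod G \<in> borel_measurable (M \<Otimes>\<^sub>M (U \<Otimes>\<^sub>M U))"
  proof -
    have "(\<lambda>z. case_prod W (fst z, fst (snd z)) * cnj (case_prod W (fst z, snd (snd z)))) \<in> borel_measurable (M \<Otimes>\<^sub>M (U \<Otimes>\<^sub>M U))"
      by (intro borel_measurable_times measurable_compose[OF _ cnj_m] measurable_compose[OF _ W]) measurable
    then show ?thesis by (simp add: G_def case_prod_beta')
  qed
  have Gb: "norm (G \<omega> p) \<le> B * B" for \<omega> p
    unfolding G_def norm_mult complex_mod_cnj by (intro mult_mono bd) (use B0 in auto)
  have intG: "integrable (M \<Otimes>\<^sub>M (U \<Otimes>\<^sub>M U)) (case_prod G)"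
    by (rule P.integrable_const_bound[where B="B * B"]) (use Gb in auto)
  have sq: "complex_of_real ((norm (CLINT x|U. W \<omega> x))\<^sup>2) = (CLINT p|U \<Otimes>\<^sub>M U. G \<omega> p)" if \<omega>: "\<omega> \<in> space M" for \<omega>
  proof -
    note [measurable] = W2[OF \<omega>]
    have "integrable (U \<Otimes>\<^sub>M U) (\<lambda>(x, y). W \<omega> x * cnj (W \<omega> y))"
    proof (rule UU.P.integrable_const_bound[where B="B * B"])
      show "AE p in U \<Otimes>\<^sub>M U. norm (case p of (x, y) \<Rightarrow> W \<omega> x * cnj (W \<omega> y)) \<le> B * B"
        using Gb[of \<omega>] by (auto simp: G_def)
      have "(\<lambda>p. W \<omega> (fst p) * cnj (W \<omega> (snd p))) \<in> borel_measurable (U \<Otimes>\<^sub>M U)"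
        by (intro borel_measurable_times measurable_compose[OF _ cnj_m] measurable_compose[OF _ W2[OF \<omega>]]) measurable
      then show "(\<lambda>(x, y). W \<omega> x * cnj (W \<omega> y)) \<in> borel_measurable (U \<Otimes>\<^sub>M U)"
        by (simp add: case_prod_beta')
    qed
    from UU.integral_fst'[OF this] have "(CLINT p|U \<Otimes>\<^sub>M U. G \<omega> p) = (CLINT x|U. (CLINT y|U. W \<omega> x * cnj (W \<omega> y)))"
      by (simp add: G_def case_prod_beta')
    also have "\<dots> = (CLINT x|U. W \<omega> x) * cnj (CLINT y|U. W \<omega> y)"
      by simp
    finally show ?thesis by (simp only: complex_norm_square)
  qed
  have int2: "integrable M (\<lambda>\<omega>. (norm (CLINT x|U. W \<omega> x))\<^sup>2)"
  proof (rule M.integrable_const_bound[where B="B * B"])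
    show "AE \<omega> in M. norm ((norm (CLINT x|U. W \<omega> x))\<^sup>2) \<le> B * B"
    proof (rule AE_I2)
      fix \<omega> assume \<omega>: "\<omega> \<in> space M"
      have "norm (CLINT x|U. W \<omega> x) \<le> (LINT x|U. norm (W \<omega> x))" by (rule integral_norm_bound)
      also have "\<dots> \<le> (LINT x|U. B)"
        by (rule integral_mono) (use intW[OF \<omega>] bd in auto)
      finally have "norm (CLINT x|U. W \<omega> x) \<le> B" by (simp add: U.prob_space)
      from power_mono[OF this, of 2] show "norm ((norm (CLINT x|U. W \<omega> x))\<^sup>2) \<le> B * B"
        by (simp add: power2_eq_square)
    qed
  qed measurable
  have "(\<integral>\<^sup>+\<omega>. ennreal ((norm (CLINT x|U. W \<omega> x))\<^sup>2) \<partial>M) = ennreal (LINT \<omega>|M. (norm (CLINT x|U. W \<omega> x))\<^sup>2)"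
    by (rule nn_integral_eq_integral[OF int2]) simp
  also have "(LINT \<omega>|M. (norm (CLINT x|U. W \<omega> x))\<^sup>2) = norm (CLINT \<omega>|M. complex_of_real ((norm (CLINT x|U. W \<omega> x))\<^sup>2))"
    by (subst integral_complex_of_real) (simp add: Bochner_Integration.integral_nonneg)
  also have "(CLINT \<omega>|M. complex_of_real ((norm (CLINT x|U. W \<omega> x))\<^sup>2)) = (CLINT \<omega>|M. (CLINT p|U \<Otimes>\<^sub>M U. G \<omega> p))"
    by (rule Bochner_Integration.integral_cong[OF refl sq])
  also have "\<dots> = (CLINT p|U \<Otimes>\<^sub>M U. (CLINT \<omega>|M. G \<omega> p))"
    by (rule P.Fubini_integral[OF intG, symmetric])
  also have "ennreal (norm \<dots>) \<le> (\<integral>\<^sup>+p. ennreal (norm (CLINT \<omega>|M. G \<omega> p)) \<partial>(U \<Otimes>\<^sub>M U))"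
    by (rule integral_norm_bound_ennreal[OF P.integrable_snd[OF intG]])
  finally show ?thesis by (simp add: G_def)
qed

text \<open>
  Countable quantifiers only, so that measurability of the set of convergence is immediate.
\<close>

lemma tendsto_iff_inverse_Suc:
  fixes f :: "nat \<Rightarrow> complex"
  shows "f \<longlonglongrightarrow> l \<longleftrightarrow> (\<forall>i::nat. \<exists>N. \<forall>n\<ge>N. norm (f n - l) < inverse (real (Suc i)))"
proof
  assume "f \<longlonglongrightarrow> l"
  then show "\<forall>i::nat. \<exists>N. \<forall>n\<ge>N. norm (f n - l) < inverse (real (Suc i))"
    using LIMSEQ_D[of f l] by (metis inverse_Suc)
next
  assume *: "\<forall>i::nat. \<exists>N. \<forall>n\<ge>N. norm (f n - l) < inverse (real (Suc i))"
  show "f \<longlonglongrightarrow> l"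
  proof (rule LIMSEQ_I)
    fix r :: real assume "0 < r"
    then obtain i where "inverse (real (Suc i)) < r" using reals_Archimedean by blast
    then show "\<exists>no. \<forall>n\<ge>no. norm (f n - l) < r" using * by (meson less_trans)
  qed
qed

text \<open>
  Turns a null set for each \<open>s\<close> into one null set outside of which almost every \<open>s\<close> is good.
\<close>

lemma AE_AE_tendsto_swap:
  fixes f :: "nat \<Rightarrow> 's \<Rightarrow> 'w \<Rightarrow> complex" and l :: "'s \<Rightarrow> complex"
  assumes "prob_space S" "prob_space M"
    and f[measurable]: "\<And>n. (\<lambda>p. f n (fst p) (snd p)) \<in> borel_measurable (S \<Otimes>\<^sub>M M)"
    and l[measurable]: "l \<in> borel_measurable S"
    and ae: "\<And>s. AE \<omega> in M. (\<lambda>n. f n s \<omega>) \<longlonglongrightarrow> l s"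
  shows "AE \<omega> in M. AE s in S. (\<lambda>n. f n s \<omega>) \<longlonglongrightarrow> l s"
proof -
  interpret S: prob_space S by fact
  interpret M: prob_space M by fact
  interpret pair_prob_space S M ..
  have "{p \<in> space (S \<Otimes>\<^sub>M M). \<forall>i::nat. \<exists>N. \<forall>n\<ge>N. norm (f n (fst p) (snd p) - l (fst p)) < inverse (real (Suc i))} \<in> sets (S \<Otimes>\<^sub>M M)"
    by measurable
  then have "{p \<in> space (S \<Otimes>\<^sub>M M). (\<lambda>n. f n (fst p) (snd p)) \<longlonglongrightarrow> l (fst p)} \<in> sets (S \<Otimes>\<^sub>M M)"
    by (simp only: tendsto_iff_inverse_Suc)
  from AE_commute[OF this] show ?thesis using ae by simp
qed

section \<open>Convergence of characteristic functions from almost every argument\<close>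

text \<open>
  For \<open>z = (d x)\<^sup>2 / 2\<close> the left-hand side is at most \<open>min 2 z \<le> 3 z / (1 + z)\<close>, and \<open>exp (- z) \<le> 1 / (1 + z)\<close>.
  The right-hand side increases with \<open>h\<close>; it is, up to the factor \<open>3\<close>, one minus the
  integrand of the Gaussian average of a characteristic function.
\<close>

lemma one_minus_cos_le:
  fixes d h x :: real
  assumes "\<bar>d\<bar> \<le> h"
  shows "1 - cos (d * x) \<le> 3 * (1 - exp (- (h * x)\<^sup>2 / 2))"
proof -
  define z where "z = (d * x)\<^sup>2 / 2"
  have z: "0 \<le> z" by (simp add: z_def)
  have e: "exp (- z) \<le> 1 / (1 + z)"
    using exp_ge_add_one_self[of z] z by (simp add: exp_minus field_simps)
  have "1 - cos (d * x) \<le> min 2 z"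
  proof -
    have "cos (d * x) = 1 - 2 * (sin (d * x / 2))\<^sup>2" using cos_double_sin[of "d * x / 2"] by simp
    moreover have "(sin (d * x / 2))\<^sup>2 \<le> (d * x / 2)\<^sup>2"
      using abs_sin_x_le_abs_x[of "d * x / 2"] by (simp add: abs_le_square_iff[symmetric])
    ultimately show ?thesis using cos_ge_minus_one[of "d * x"] by (simp add: z_def power2_eq_square)
  qed
  also have "\<dots> \<le> 3 * (z / (1 + z))"
  proof (cases "z \<le> 2")
    case True
    have "z * (1 + z) \<le> z * 3" using True z by (intro mult_left_mono) auto
    then show ?thesis using True z by (simp add: field_simps)
  qed (use z in \<open>simp add: field_simps\<close>)
  also have "z / (1 + z) = 1 - 1 / (1 + z)" using z by (simp add: field_simps)
  also have "1 - 1 / (1 + z) \<le> 1 - exp (- z)" using e by simp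
  also have "1 - exp (- z) \<le> 1 - exp (- (h * x)\<^sup>2 / 2)"
  proof -
    have "\<bar>d * x\<bar> \<le> \<bar>h * x\<bar>" unfolding abs_mult using assms by (intro mult_right_mono) auto
    then have "(d * x)\<^sup>2 \<le> (h * x)\<^sup>2" by (simp add: abs_le_square_iff)
    then show ?thesis by (simp add: z_def)
  qed
  finally show ?thesis by simp
qed

lemma real_distribution_integrable_iexp:
  assumes "real_distribution M"
  shows "integrable M (\<lambda>x. iexp (t * x))"
proof -
  interpret real_distribution M by fact
  show ?thesis by (rule integrable_const_bound[where B=1]) auto
qed

lemma Re_char: "real_distribution M \<Longrightarrow> Re (char M t) = (LINT x|M. cos (t * x))"
  unfolding char_def by (subst integral_Re[OF real_distribution_integrable_iexp, symmetric]) (auto simp: Re_exp)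

text \<open>
  Krein's inequality: the second moment of \<open>e\<^bsup>itx\<^esup> - e\<^bsup>isx\<^esup>\<close> is at least the squared modulus of its mean, and
  \<open>|e\<^bsup>itx\<^esup> - e\<^bsup>isx\<^esup>|\<^sup>2 = 2 (1 - cos ((t - s) x))\<close>.
\<close>

lemma char_increment_le:
  assumes "real_distribution M"
  shows "(norm (char M t - char M s))\<^sup>2 \<le> 2 * (1 - Re (char M (t - s)))"
proof -
  interpret real_distribution M by fact
  let ?f = "\<lambda>x. iexp (t * x) - iexp (s * x)"
  have n2: "(norm (?f x))\<^sup>2 = 2 * (1 - cos ((t - s) * x))" for x
  proof -
    have "(norm (?f x))\<^sup>2 = (cos (t*x) - cos (s*x))\<^sup>2 + (sin (t*x) - sin (s*x))\<^sup>2"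
      by (simp add: cmod_power2 Re_exp Im_exp)
    also have "\<dots> = 2 - 2 * (cos (t*x) * cos (s*x) + sin (t*x) * sin (s*x))"
      using sin_cos_squared_add[of "t*x"] sin_cos_squared_add[of "s*x"] by (simp add: power2_eq_square algebra_simps)
    finally show ?thesis by (simp add: left_diff_distrib cos_diff)
  qed
  have "norm (char M t - char M s) = norm (CLINT x|M. ?f x)"
    unfolding char_def
    by (subst Bochner_Integration.integral_diff) (rule real_distribution_integrable_iexp[OF assms] refl)+
  also have "\<dots> \<le> (LINT x|M. norm (?f x))" by (rule integral_norm_bound)
  finally have "(norm (char M t - char M s))\<^sup>2 \<le> (LINT x|M. norm (?f x))\<^sup>2" by (intro power_mono) auto
  also have "\<dots> \<le> (LINT x|M. (norm (?f x))\<^sup>2)"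
  proof -
    have "integrable M (\<lambda>x. norm (?f x))"
      by (intro integrable_norm Bochner_Integration.integrable_diff real_distribution_integrable_iexp assms)
    moreover have "integrable M (\<lambda>x. (norm (?f x))\<^sup>2)"
      unfolding n2 by (intro integrable_mult_right Bochner_Integration.integrable_diff)
        (auto intro: integrable_const_bound[where B=1])
    ultimately show ?thesis
      using variance_positive[of "\<lambda>x. norm (?f x)"] by (subst (asm) variance_eq) auto
  qed
  also have "\<dots> = 2 * (1 - Re (char M (t - s)))"
  proof -
    have "integrable M (\<lambda>x. cos ((t - s) * x))" by (rule integrable_const_bound[where B=1]) auto
    then show ?thesis unfolding n2 by (simp add: Re_char[OF assms] prob_space[unfolded space_eq_univ])
  qed
  finally show ?thesis .
qed

text \<open>
  Up to normalisation the Gaussian density is its own Fourier transform, so by Fubini averaging a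
  characteristic function over a Gaussian argument tests the measure against a Gaussian.
\<close>

lemma gaussian_average_char:
  assumes "real_distribution M"
  shows "(CLINT s|std_normal_distribution. char M (h * s)) = complex_of_real (LINT x|M. exp (- (h * x)\<^sup>2 / 2))"
proof -
  interpret M: real_distribution M by fact
  interpret N: real_distribution std_normal_distribution by (rule real_dist_normal_dist)
  interpret pair_prob_space M std_normal_distribution ..
  have int: "integrable (M \<Otimes>\<^sub>M std_normal_distribution) (\<lambda>(x, s). iexp (h * s * x))"
    by (rule P.integrable_const_bound[where B=1]) (auto simp: split_beta')
  have "(CLINT s|std_normal_distribution. char M (h * s)) = (CLINT x|M. (CLINT s|std_normal_distribution. iexp (h * s * x)))"
    unfolding char_def by (rule Fubini_integral[OF int])
  also have "\<dots> = (CLINT x|M. char std_normal_distribution (h * x))"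
    unfolding char_def by (simp add: mult_ac)
  also have "\<dots> = complex_of_real (LINT x|M. exp (- (h * x)\<^sup>2 / 2))"
    unfolding char_std_normal_distribution by (rule integral_complex_of_real)
  finally show ?thesis .
qed

text \<open>
  Convergence at the rationals alone does not exclude that mass escapes to infinity. The Gaussian averages at
  scale \<open>h\<close> converge by the second condition, and those of \<open>\<nu>'\<close> are small for small \<open>h\<close>. Therefore \<open>1 - Re (char (\<nu> n) d)\<close>
  is small for large \<open>n\<close>, uniformly in \<open>|d| \<le> h\<close>, and Krein's inequality passes from a rational argument
  within distance \<open>h\<close> to \<open>t\<close>.
\<close>

lemma char_tendsto_from_rationals:
  fixes \<nu> :: "nat \<Rightarrow> real measure" and \<nu>' :: "real measure"
  assumes d: "\<And>n. real_distribution (\<nu> n)" "real_distribution \<nu>'"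
    and rat: "\<And>q. q \<in> \<rat> \<Longrightarrow> (\<lambda>n. char (\<nu> n) q) \<longlonglongrightarrow> char \<nu>' q"
    and ae: "\<And>m. AE s in std_normal_distribution. (\<lambda>n. char (\<nu> n) (s / real (Suc m))) \<longlonglongrightarrow> char \<nu>' (s / real (Suc m))"
  shows "(\<lambda>n. char (\<nu> n) t) \<longlonglongrightarrow> char \<nu>' t"
proof -
  interpret N: real_distribution std_normal_distribution by (rule real_dist_normal_dist)
  interpret \<nu>': real_distribution \<nu>' by fact
  define G where "G P h = (LINT x|P. 1 - exp (- (h * x)\<^sup>2 / 2))" for P :: "real measure" and h :: real
  have intexp: "integrable P (\<lambda>x. exp (- (h * x)\<^sup>2 / 2))" if "real_distribution P" for P h
  proof -
    interpret real_distribution P by fact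
    show ?thesis by (rule integrable_const_bound[where B=1]) auto
  qed
  have G_eq: "G P h = 1 - Re (CLINT s|std_normal_distribution. char P (h * s))" if "real_distribution P" for P h
  proof -
    interpret real_distribution P by fact
    show ?thesis unfolding G_def gaussian_average_char[OF that] using intexp[OF that, of h] prob_space
      by (simp del: space_eq_univ)
  qed
  have char_osc: "1 - Re (char P e) \<le> 3 * G P h" if "real_distribution P" "\<bar>e\<bar> \<le> h" for P e h
  proof -
    interpret real_distribution P by fact
    have c: "integrable P (\<lambda>x. cos (e * x))" by (rule integrable_const_bound[where B=1]) auto
    have "1 - Re (char P e) = (LINT x|P. 1 - cos (e * x))"
      using c by (simp add: Re_char[OF that(1)] prob_space[unfolded space_eq_univ])
    also have "\<dots> \<le> (LINT x|P. 3 * (1 - exp (- (h * x)\<^sup>2 / 2)))"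
      by (rule integral_mono) (use c intexp[OF that(1), of h] one_minus_cos_le[OF that(2)] in auto)
    also have "\<dots> = 3 * G P h" unfolding G_def by (rule integral_mult_right_zero)
    finally show ?thesis .
  qed
  have G_small: "(\<lambda>m. G \<nu>' (1 / real (Suc m))) \<longlonglongrightarrow> 0"
  proof -
    have "(\<lambda>m. G \<nu>' (1 / real (Suc m))) \<longlonglongrightarrow> (LINT x|\<nu>'. 0)"
      unfolding G_def
    proof (rule integral_dominated_convergence[where w="\<lambda>_. 1"])
      have inv: "(\<lambda>m. 1 / real (Suc m)) \<longlonglongrightarrow> 0" using LIMSEQ_inverse_real_of_nat by (simp add: divide_inverse)
      have "(\<lambda>m. 1 - exp (- (1 / real (Suc m) * x)\<^sup>2 / 2)) \<longlonglongrightarrow> 1 - exp (- (0 * x)\<^sup>2 / 2)" for x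
        by (intro tendsto_intros inv) auto
      then show "AE x in \<nu>'. (\<lambda>m. 1 - exp (- (1 / real (Suc m) * x)\<^sup>2 / 2)) \<longlonglongrightarrow> 0" by simp
      show "AE x in \<nu>'. norm (1 - exp (- (1 / real (Suc m) * x)\<^sup>2 / 2)) \<le> 1" for m by auto
    qed auto
    then show ?thesis by simp
  qed
  have G_conv: "(\<lambda>n. G (\<nu> n) (1 / real (Suc m))) \<longlonglongrightarrow> G \<nu>' (1 / real (Suc m))" for m
  proof -
    have "(\<lambda>n. CLINT s|std_normal_distribution. char (\<nu> n) (1 / real (Suc m) * s)) \<longlonglongrightarrow>
       (CLINT s|std_normal_distribution. char \<nu>' (1 / real (Suc m) * s))"
    proof (rule integral_dominated_convergence[where w="\<lambda>_. 1"])
      have cm: "char P \<in> borel_measurable borel" if "real_distribution P" for P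
        using real_distribution.char_measurable[OF that] .
      show "(\<lambda>s. char \<nu>' (1 / real (Suc m) * s)) \<in> borel_measurable std_normal_distribution"
        using cm[OF d(2)] by simp
      show "(\<lambda>s. char (\<nu> n) (1 / real (Suc m) * s)) \<in> borel_measurable std_normal_distribution" for n
        using cm[OF d(1)[of n]] by simp
      show "AE s in std_normal_distribution. norm (char (\<nu> n) (1 / real (Suc m) * s)) \<le> 1" for n
        using real_distribution.cmod_char_le_1[OF d(1)[of n]] by auto
    qed (use ae[of m] in auto)
    then show ?thesis unfolding G_eq[OF d(1)] G_eq[OF d(2)] by (intro tendsto_intros)
  qed
  show ?thesis
  proof (rule LIMSEQ_I)
    fix r :: real assume r: "0 < r"
    (* Three errors of size r / 4; the factor 6 is 2 from Krein's inequality times 3 from the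
       comparison of the cosine with the Gaussian. *)
    define e where "e = (r / 4)\<^sup>2 / 6"
    have e: "0 < e" using r by (simp add: e_def)
    obtain m where m: "G \<nu>' (1 / real (Suc m)) < e"
      using order_tendstoD(2)[OF G_small e] by (auto simp: eventually_sequentially)
    define h where "h = 1 / real (Suc m)"
    have h: "0 < h" by (simp add: h_def)
    obtain q where q: "q \<in> \<rat>" "t - h < q" "q < t + h"
      using Rats_dense_in_real[of "t - h" "t + h"] h by auto
    have qt: "\<bar>t - q\<bar> \<le> h" using q by auto
    have near: "norm (char P t - char P q) < r / 4" if P: "real_distribution P" "G P h < e" for P
    proof -
      have "(norm (char P t - char P q))\<^sup>2 \<le> 2 * (3 * G P h)"
        using order_trans[OF char_increment_le[OF P(1), of t q] mult_left_mono[OF char_osc[OF P(1) qt], of 2]] by simp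
      also have "\<dots> < (r / 4)\<^sup>2" using P(2) by (simp add: e_def)
      finally show ?thesis by (rule power_less_imp_less_base) (use r in auto)
    qed
    have "\<forall>\<^sub>F n in sequentially. G (\<nu> n) h < e"
      using order_tendstoD(2)[OF G_conv m] by (simp add: h_def)
    moreover have "\<forall>\<^sub>F n in sequentially. norm (char (\<nu> n) q - char \<nu>' q) < r / 4"
      using tendstoD[OF rat[OF q(1)], of "r / 4"] r by (simp add: dist_norm)
    ultimately have "\<forall>\<^sub>F n in sequentially. norm (char (\<nu> n) t - char \<nu>' t) < r"
    proof eventually_elim
      case (elim n)
      have "norm (char (\<nu> n) t - char \<nu>' t) \<le> norm (char (\<nu> n) t - char (\<nu> n) q) + norm (char (\<nu> n) q - char \<nu>' q) + norm (char \<nu>' t - char \<nu>' q)"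
        using dist_triangle[of "char (\<nu> n) t" "char \<nu>' t" "char (\<nu> n) q"] dist_triangle[of "char (\<nu> n) q" "char \<nu>' t" "char \<nu>' q"]
        by (simp add: dist_norm norm_minus_commute)
      then show ?case using near[OF d(1) elim(1)] elim(2) near[OF d(2)] m r by (simp add: h_def)
    qed
    then show "\<exists>no. \<forall>n\<ge>no. norm (char (\<nu> n) t - char \<nu>' t) < r" by (simp add: eventually_sequentially)
  qed
qed

text \<open>
  Conditionally on \<open>X\<close> the product is Gaussian with standard deviation \<open>|s (X)|\<close>.
\<close>

lemma char_gaussian_scale_mixture:
  assumes "prob_space Q" and X: "distr Q borel X = U" and N: "distributed Q lborel N std_normal_density"
    and ind: "prob_space.indep_var Q borel X borel N"
    and s[measurable]: "s \<in> borel_measurable borel"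
  shows "(CLINT q|Q. iexp (t * (s (X q) * N q))) = complex_of_real (LINT x|U. exp (- (t * s x)\<^sup>2 / 2))"
proof -
  interpret Q: prob_space Q by fact
  have rv[measurable]: "X \<in> borel_measurable Q" "N \<in> borel_measurable Q"
    using Q.indep_var_rv1[OF ind] Q.indep_var_rv2[OF ind] by auto
  have U: "prob_space U" unfolding X[symmetric] by (rule Q.prob_space_distr[OF rv(1)])
  interpret U: prob_space U by (rule U)
  interpret N: real_distribution std_normal_distribution by (rule real_dist_normal_dist)
  interpret pair_prob_space U std_normal_distribution ..
  have [measurable_cong]: "sets U = sets borel" by (simp add: X[symmetric])
  have dN: "distr Q borel N = std_normal_distribution"
    using distributed_distr_eq_density[OF N] by (simp cong: distr_cong)
  have prod: "U \<Otimes>\<^sub>M std_normal_distribution = distr Q (borel \<Otimes>\<^sub>M borel) (\<lambda>q. (X q, N q))"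
    using ind unfolding Q.indep_var_distribution_eq X dN by auto
  have "(CLINT q|Q. iexp (t * (s (X q) * N q))) = (CLINT p|distr Q (borel \<Otimes>\<^sub>M borel) (\<lambda>q. (X q, N q)). iexp (t * (s (fst p) * snd p)))"
    by (subst integral_distr) auto
  also have "\<dots> = (CLINT p|U \<Otimes>\<^sub>M std_normal_distribution. iexp (t * (s (fst p) * snd p)))"
    by (simp only: prod)
  also have "\<dots> = (CLINT x|U. (CLINT z|std_normal_distribution. iexp (t * (s x * z))))"
  proof -
    have "integrable (U \<Otimes>\<^sub>M std_normal_distribution) (\<lambda>(x, z). iexp (t * (s x * z)))"
      by (rule P.integrable_const_bound[where B=1]) (auto simp: split_beta')
    from integral_fst'[OF this] show ?thesis by (simp add: case_prod_beta')
  qed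
  also have "\<dots> = (CLINT x|U. char std_normal_distribution (t * s x))"
    unfolding char_def by (simp add: mult_ac)
  also have "\<dots> = complex_of_real (LINT x|U. exp (- (t * s x)\<^sup>2 / 2))"
    unfolding char_std_normal_distribution by (rule integral_complex_of_real)
  finally show ?thesis .
qed

section \<open>The uniform distribution on the circle\<close>

abbreviation "unif_circle \<equiv> density lborel (\<lambda>x::real. ennreal (indicator {0..2 * pi} x / (2 * pi)))"

lemma nn_integral_unif_circle:
  assumes [measurable]: "f \<in> borel_measurable borel"
  shows "(\<integral>\<^sup>+x. f x \<partial>unif_circle) = ennreal (1 / (2 * pi)) * (\<integral>\<^sup>+x\<in>{0..2 * pi}. f x \<partial>lborel)"
proof -
  have "(\<integral>\<^sup>+x. f x \<partial>unif_circle) = (\<integral>\<^sup>+x. ennreal (1 / (2 * pi)) * (f x * indicator {0..2 * pi} x) \<partial>lborel)"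
    by (subst nn_integral_density) (auto simp: indicator_def intro!: nn_integral_cong)
  also have "\<dots> = ennreal (1 / (2 * pi)) * (\<integral>\<^sup>+x\<in>{0..2 * pi}. f x \<partial>lborel)"
    by (rule nn_integral_cmult) measurable
  finally show ?thesis .
qed

lemma prob_space_unif_circle: "prob_space unif_circle"
proof
  have "emeasure unif_circle UNIV = (\<integral>\<^sup>+x. 1 \<partial>unif_circle)" by simp
  also have "\<dots> = 1" by (subst nn_integral_unif_circle) (auto simp flip: ennreal_mult)
  finally show "emeasure unif_circle (space unif_circle) = 1" by simp
qed

lemma nn_integral_unif_circle_periodic:
  assumes [measurable]: "f \<in> borel_measurable borel" and "\<And>x. f (x + 2 * pi) = f x"
  shows "(\<integral>\<^sup>+x. f x \<partial>unif_circle) = ennreal (1 / (2 * pi)) * (\<integral>\<^sup>+x. f x \<partial>leb_circle)"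
  using nn_integral_periodic_shift[OF assms, of 0]
  by (simp add: nn_integral_unif_circle nn_integral_leb_circle)

lemma nn_integral_unif_dirichlet_le:
  assumes n: "1 \<le> n" and u: "u \<in> {-pi..pi}"
  shows "(\<integral>\<^sup>+x. ennreal (norm (dirichlet n (x - u))) \<partial>unif_circle) \<le> ennreal (2 + 8 * (ln pi + ln (real n)))"
proof -
  have "(\<integral>\<^sup>+x\<in>{0..2 * pi}. ennreal (norm (dirichlet n (x - u))) \<partial>lborel)
     = (\<integral>\<^sup>+x. ennreal (norm (dirichlet n (u + 1 * x - u))) * indicator {0..2 * pi} (u + 1 * x) \<partial>lborel)"
    by (subst nn_integral_real_affine[where c=1 and t=u]) auto
  also have "\<dots> = (\<integral>\<^sup>+x\<in>{-u..-u + 2 * pi}. ennreal (norm (dirichlet n x)) \<partial>lborel)"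
    by (intro nn_integral_cong) (auto simp: indicator_def)
  also have "\<dots> = (\<integral>\<^sup>+x\<in>{-pi..pi}. ennreal (norm (dirichlet n x)) \<partial>lborel)"
    by (rule nn_integral_periodic_shift) (use u in \<open>auto simp: dirichlet_periodic\<close>)
  also have "\<dots> \<le> ennreal (2 + 8 * (ln pi + ln (real n)))" by (rule nn_integral_dirichlet_le[OF n])
  finally have "(\<integral>\<^sup>+x\<in>{0..2 * pi}. ennreal (norm (dirichlet n (x - u))) \<partial>lborel) \<le> ennreal (2 + 8 * (ln pi + ln (real n)))" .
  then have "(\<integral>\<^sup>+x. ennreal (norm (dirichlet n (x - u))) \<partial>unif_circle) \<le> ennreal (1 / (2 * pi)) * ennreal (2 + 8 * (ln pi + ln (real n)))"
    by (subst nn_integral_unif_circle) (auto intro: mult_left_mono)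
  also have "\<dots> \<le> ennreal 1 * ennreal (2 + 8 * (ln pi + ln (real n)))"
    using pi_gt3 by (intro mult_right_mono ennreal_leI) auto
  finally show ?thesis by simp
qed

lemma integral_unif_circle:
  fixes f :: "real \<Rightarrow> real"
  assumes [measurable]: "f \<in> borel_measurable borel"
  shows "(LINT x|unif_circle. f x) = 1 / (2 * pi) * (LINT x:{0..2 * pi}|lborel. f x)"
proof -
  have "(LINT x|unif_circle. f x) = (LINT x|lborel. (indicator {0..2 * pi} x / (2 * pi)) * f x)"
    by (subst integral_real_density) (auto simp: indicator_def)
  also have "\<dots> = (LINT x|lborel. 1 / (2 * pi) * (indicator {0..2 * pi} x *\<^sub>R f x))"
    by (intro Bochner_Integration.integral_cong) auto
  also have "\<dots> = 1 / (2 * pi) * (LINT x:{0..2 * pi}|lborel. f x)"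
    unfolding set_lebesgue_integral_def by (rule integral_mult_right_zero)
  finally show ?thesis .
qed

section \<open>Convergence of the mean, and the variance\<close>

lemma abs_exp_minus_diff_le:
  fixes p q :: real
  assumes "0 \<le> p" "0 \<le> q"
  shows "\<bar>exp (- p) - exp (- q)\<bar> \<le> \<bar>p - q\<bar>"
proof -
  have *: "exp (- p) - exp (- q) \<le> q - p \<and> 0 \<le> exp (- p) - exp (- q)" if "0 \<le> p" "p \<le> q" for p q :: real
  proof -
    have "exp (- p) - exp (- q) = exp (- p) * (1 - exp (- (q - p)))" by (simp add: right_diff_distrib flip: exp_add)
    also have "\<dots> \<le> 1 * (q - p)"
    proof (rule mult_mono)
      show "1 - exp (- (q - p)) \<le> q - p" using exp_ge_add_one_self[of "- (q - p)"] by linarith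
    qed (use that in auto)
    finally show ?thesis using that by simp
  qed
  show ?thesis using *[of p q] *[of q p] assms by (cases "p \<le> q") auto
qed

lemma abs_exp_minus_diff_le_min:
  fixes p q :: real
  assumes "0 \<le> p" "0 \<le> q"
  shows "\<bar>exp (- (t\<^sup>2 * p) / 2) - exp (- (t\<^sup>2 * q) / 2)\<bar> \<le> (1 + t\<^sup>2) * min 1 \<bar>p - q\<bar>"
proof -
  let ?l = "\<bar>exp (- (t\<^sup>2 * p) / 2) - exp (- (t\<^sup>2 * q) / 2)\<bar>"
  have e: "0 < exp (- (t\<^sup>2 * p) / 2)" "exp (- (t\<^sup>2 * p) / 2) \<le> 1" "0 < exp (- (t\<^sup>2 * q) / 2)" "exp (- (t\<^sup>2 * q) / 2) \<le> 1"
    using assms by auto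
  then have 1: "?l \<le> 1" by linarith
  have "?l \<le> \<bar>t\<^sup>2 * p / 2 - t\<^sup>2 * q / 2\<bar>"
    using abs_exp_minus_diff_le[of "t\<^sup>2 * p / 2" "t\<^sup>2 * q / 2"] assms by simp
  also have "\<dots> = t\<^sup>2 / 2 * \<bar>p - q\<bar>"
    by (simp add: abs_mult right_diff_distrib[symmetric] diff_divide_distrib[symmetric])
  also have "\<dots> \<le> (1 + t\<^sup>2) * \<bar>p - q\<bar>" by (intro mult_right_mono) auto
  finally have 2: "?l \<le> (1 + t\<^sup>2) * \<bar>p - q\<bar>" .
  show ?thesis
  proof (cases "\<bar>p - q\<bar> \<le> 1")
    case False
    then show ?thesis using order_trans[OF 1, of "1 + t\<^sup>2"] by (simp add: min_def)
  qed (use 2 in \<open>simp add: min_def\<close>)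
qed

context gaussian_pair
begin

text \<open>
  The characteristic function of \<open>f\<^sub>n(X)\<close> for fixed coefficients; by \<open>trig_poly_char\<close> and Fubini its
  expectation is \<open>mean_char\<close>.
\<close>

definition emp_char :: "nat \<Rightarrow> real \<Rightarrow> 'w \<Rightarrow> complex" where
  "emp_char n t \<omega> = (CLINT x|unif_circle. iexp (t * trig_poly a b n \<omega> x))"

definition mean_char :: "nat \<Rightarrow> real \<Rightarrow> real" where
  "mean_char n t = (LINT x|unif_circle. exp (- (t\<^sup>2 * pcov n x x) / 2))"

lemma pcov_measurable[measurable]: "(\<lambda>x. pcov n x x) \<in> borel_measurable borel"
  unfolding pcov_diag by measurable

lemma pcov_periodic: "pcov n (x + 2 * pi) (x + 2 * pi) = pcov n x x"
proof -
  have "x + 2 * pi - u = (x - u) + 2 * pi" for u by simp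
  then show ?thesis unfolding pcov_diag fejer_def by (simp only: dirichlet_periodic)
qed

lemma mean_char_tendsto:
  assumes ac: "is_ac_density \<mu> \<psi>"
  shows "(\<lambda>n. mean_char n t) \<longlonglongrightarrow> (LINT x|unif_circle. exp (- (t\<^sup>2 * (2 * pi * \<psi> x)) / 2))"
proof -
  interpret U: prob_space unif_circle by (rule prob_space_unif_circle)
  have [measurable]: "\<psi> \<in> borel_measurable borel" and nn: "\<And>x. 0 \<le> \<psi> x" and per: "\<And>x. \<psi> (x + 2 * pi) = \<psi> x"
    using ac by (auto simp: is_ac_density_def)
  define g where "g n x = exp (- (t\<^sup>2 * pcov n x x) / 2)" for n x
  define g' where "g' x = exp (- (t\<^sup>2 * (2 * pi * \<psi> x)) / 2)" for x
  have [measurable]: "g n \<in> borel_measurable borel" "g' \<in> borel_measurable borel" for n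
    unfolding g_def g'_def by measurable
  have i: "integrable unif_circle (g n)" "integrable unif_circle g'" for n
    using pcov_diag_nonneg nn unfolding g_def g'_def by (auto intro!: U.integrable_const_bound[where B=1])
  define I where "I n = (\<integral>\<^sup>+x. ennreal (min 1 \<bar>(LINT u|\<mu>. fejer n (x - u)) - 2 * pi * \<psi> x\<bar>) \<partial>leb_circle)" for n
  have I: "I \<longlonglongrightarrow> 0"
    unfolding I_def by (rule fejer_ac_part[OF spectral.finite_measure_axioms sets_mu support ac])
  have "ennreal \<bar>(LINT x|unif_circle. g n x) - (LINT x|unif_circle. g' x)\<bar> \<le> ennreal (1 + t\<^sup>2) * (ennreal (1 / (2 * pi)) * I n)" for n
  proof -
    have "ennreal \<bar>(LINT x|unif_circle. g n x) - (LINT x|unif_circle. g' x)\<bar> = ennreal (norm (LINT x|unif_circle. g n x - g' x))"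
      using i by simp
    also have "\<dots> \<le> (\<integral>\<^sup>+x. ennreal (norm (g n x - g' x)) \<partial>unif_circle)"
      by (rule integral_norm_bound_ennreal) (use i in auto)
    also have "\<dots> \<le> (\<integral>\<^sup>+x. ennreal (1 + t\<^sup>2) * ennreal (min 1 \<bar>pcov n x x - 2 * pi * \<psi> x\<bar>) \<partial>unif_circle)"
    proof (rule nn_integral_mono)
      fix x
      have "norm (g n x - g' x) \<le> (1 + t\<^sup>2) * min 1 \<bar>pcov n x x - 2 * pi * \<psi> x\<bar>"
        unfolding g_def g'_def real_norm_def by (rule abs_exp_minus_diff_le_min) (auto simp: pcov_diag_nonneg nn)
      then show "ennreal (norm (g n x - g' x)) \<le> ennreal (1 + t\<^sup>2) * ennreal (min 1 \<bar>pcov n x x - 2 * pi * \<psi> x\<bar>)"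
        by (subst ennreal_mult[symmetric]) (auto intro: ennreal_leI)
    qed
    also have "\<dots> = ennreal (1 + t\<^sup>2) * (\<integral>\<^sup>+x. ennreal (min 1 \<bar>pcov n x x - 2 * pi * \<psi> x\<bar>) \<partial>unif_circle)"
      by (rule nn_integral_cmult) measurable
    also have "(\<integral>\<^sup>+x. ennreal (min 1 \<bar>pcov n x x - 2 * pi * \<psi> x\<bar>) \<partial>unif_circle) = ennreal (1 / (2 * pi)) * I n"
      unfolding I_def pcov_diag[symmetric]
      by (rule nn_integral_unif_circle_periodic) (auto simp: per pcov_periodic)
    finally show ?thesis .
  qed
  note le = this
  have "(\<lambda>n. ennreal (1 + t\<^sup>2) * (ennreal (1 / (2 * pi)) * I n)) \<longlonglongrightarrow> ennreal (1 + t\<^sup>2) * (ennreal (1 / (2 * pi)) * 0)"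
    by (rule ennreal_tendsto_cmult[OF _ ennreal_tendsto_cmult[OF _ I]]) auto
  then have "(\<lambda>n. ennreal (1 + t\<^sup>2) * (ennreal (1 / (2 * pi)) * I n)) \<longlonglongrightarrow> 0" by simp
  then have "(\<lambda>n. ennreal \<bar>(LINT x|unif_circle. g n x) - (LINT x|unif_circle. g' x)\<bar>) \<longlonglongrightarrow> 0"
    by (rule tendsto_sandwich[OF _ _ tendsto_const, rotated 2]) (use le in auto)
  then have "(\<lambda>n. \<bar>(LINT x|unif_circle. g n x) - (LINT x|unif_circle. g' x)\<bar>) \<longlonglongrightarrow> 0"
    by (subst (asm) ennreal_tendsto_0_iff) auto
  then have "(\<lambda>n. (LINT x|unif_circle. g n x) - (LINT x|unif_circle. g' x)) \<longlonglongrightarrow> 0"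
    by (rule tendsto_rabs_zero_cancel)
  then have "(\<lambda>n. LINT x|unif_circle. g n x) \<longlonglongrightarrow> (LINT x|unif_circle. g' x)"
    by (rule LIM_zero_cancel)
  then show ?thesis by (simp add: mean_char_def g_def g'_def)
qed

lemma trig_poly_measurable:
  assumes [measurable_cong]: "sets N = sets borel"
  shows "(\<lambda>(\<omega>, x). trig_poly a b n \<omega> x) \<in> borel_measurable (M \<Otimes>\<^sub>M N)"
proof -
  have "(\<lambda>p. trig_poly a b n (fst p) (snd p)) \<in> borel_measurable (M \<Otimes>\<^sub>M N)"
    unfolding trig_poly_def
  proof (intro borel_measurable_times borel_measurable_sum borel_measurable_add)
    fix k assume "k \<in> {1..n}"
    then have [measurable]: "a k \<in> borel_measurable M" "b k \<in> borel_measurable M"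
      using seq_measurable[OF gauss_a, of k] seq_measurable[OF gauss_b, of k] by auto
    show "(\<lambda>p. a k (fst p)) \<in> borel_measurable (M \<Otimes>\<^sub>M N)" by measurable
    show "(\<lambda>p. b k (fst p)) \<in> borel_measurable (M \<Otimes>\<^sub>M N)" by measurable
    show "(\<lambda>p. cos (real k * snd p)) \<in> borel_measurable (M \<Otimes>\<^sub>M N)" by measurable
    show "(\<lambda>p. sin (real k * snd p)) \<in> borel_measurable (M \<Otimes>\<^sub>M N)" by measurable
  qed simp
  then show ?thesis by (simp add: case_prod_beta')
qed

lemma trig_poly_measurable_fst: "(\<lambda>\<omega>. trig_poly a b n \<omega> x) \<in> borel_measurable M"
  using measurable_compose[OF measurable_Pair2'[of x borel M] trig_poly_measurable[of borel n]] by simp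

lemma trig_poly_measurable_snd: "(\<lambda>x. trig_poly a b n \<omega> x) \<in> borel_measurable borel"
  unfolding trig_poly_def by measurable

text \<open>
  By the Gaussian formulas the covariance is a difference of two values of \<open>exp (- z)\<close> with \<open>z \<ge> 0\<close>, and the
  two values of \<open>z\<close> differ by \<open>t\<^sup>2\<close> times the covariance of \<open>f\<^sub>n(x)\<close> and \<open>f\<^sub>n(y)\<close>.
\<close>

lemma covariance_of_char_le:
  "norm (CLINT \<omega>|M. (iexp (t * trig_poly a b n \<omega> x) - complex_of_real (exp (- (t\<^sup>2 * pcov n x x) / 2)))
      * cnj (iexp (t * trig_poly a b n \<omega> y) - complex_of_real (exp (- (t\<^sup>2 * pcov n y y) / 2)))) \<le> t\<^sup>2 * \<bar>pcov n x y\<bar>"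
proof -
  note [measurable] = trig_poly_measurable_fst
  define m where "m x = exp (- (t\<^sup>2 * pcov n x x) / 2)" for x
  let ?Z = "\<lambda>t \<omega> x. iexp (t * trig_poly a b n \<omega> x)"
  have int: "integrable M (\<lambda>\<omega>. ?Z s \<omega> x)" for s x
    by (rule integrable_const_bound[where B=1]) auto
  have int2: "integrable M (\<lambda>\<omega>. iexp (t * (trig_poly a b n \<omega> x - trig_poly a b n \<omega> y)))"
    by (rule integrable_const_bound[where B=1]) auto
  have EZ: "(CLINT \<omega>|M. ?Z s \<omega> x) = complex_of_real (exp (- (s\<^sup>2 * pcov n x x) / 2))" for s x
    by (rule trig_poly_char)
  have "(?Z t \<omega> x - complex_of_real (m x)) * cnj (?Z t \<omega> y - complex_of_real (m y))
     = (iexp (t * (trig_poly a b n \<omega> x - trig_poly a b n \<omega> y)) - complex_of_real (m y) * ?Z t \<omega> x)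
       - (complex_of_real (m x) * ?Z (- t) \<omega> y - complex_of_real (m x * m y))" for \<omega>
  proof -
    have "cnj (?Z t \<omega> y) = ?Z (- t) \<omega> y" by (simp add: exp_cnj)
    moreover have "?Z t \<omega> x * ?Z (- t) \<omega> y = iexp (t * (trig_poly a b n \<omega> x - trig_poly a b n \<omega> y))"
      by (simp add: algebra_simps flip: exp_add)
    ultimately show ?thesis by (simp only: complex_cnj_diff complex_cnj_complex_of_real) (simp add: algebra_simps)
  qed
  then have "(CLINT \<omega>|M. (?Z t \<omega> x - complex_of_real (m x)) * cnj (?Z t \<omega> y - complex_of_real (m y)))
     = (CLINT \<omega>|M. (iexp (t * (trig_poly a b n \<omega> x - trig_poly a b n \<omega> y)) - complex_of_real (m y) * ?Z t \<omega> x)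
       - (complex_of_real (m x) * ?Z (- t) \<omega> y - complex_of_real (m x * m y)))"
    by simp
  also have "\<dots> = ((CLINT \<omega>|M. iexp (t * (trig_poly a b n \<omega> x - trig_poly a b n \<omega> y))) - complex_of_real (m y) * (CLINT \<omega>|M. ?Z t \<omega> x))
       - (complex_of_real (m x) * (CLINT \<omega>|M. ?Z (- t) \<omega> y) - complex_of_real (m x * m y))"
    using int int2 by (simp only: Bochner_Integration.integral_diff Bochner_Integration.integrable_diff
        integrable_mult_right integral_mult_right_zero integrable_const lebesgue_integral_const prob_space scaleR_one)
  also have "\<dots> = complex_of_real (exp (- (t\<^sup>2 * (pcov n x x + pcov n y y - 2 * pcov n x y)) / 2) - m x * m y)"
    unfolding EZ trig_poly_char_diff by (simp add: m_def mult.commute)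
  also have "norm \<dots> = \<bar>exp (- (t\<^sup>2 * (pcov n x x + pcov n y y - 2 * pcov n x y) / 2)) - exp (- (t\<^sup>2 * (pcov n x x + pcov n y y) / 2))\<bar>"
  proof -
    have "m x * m y = exp (- (t\<^sup>2 * (pcov n x x + pcov n y y) / 2))"
      by (simp add: m_def add_divide_distrib distrib_left flip: exp_add)
    then show ?thesis by (simp only: norm_of_real minus_divide_left)
  qed
  also have "\<dots> \<le> \<bar>t\<^sup>2 * (pcov n x x + pcov n y y - 2 * pcov n x y) / 2 - t\<^sup>2 * (pcov n x x + pcov n y y) / 2\<bar>"
    using pcov_triangle[of n x y] pcov_diag_nonneg[of n x] pcov_diag_nonneg[of n y] by (intro abs_exp_minus_diff_le) auto
  also have "t\<^sup>2 * (pcov n x x + pcov n y y - 2 * pcov n x y) / 2 - t\<^sup>2 * (pcov n x x + pcov n y y) / 2 = - (t\<^sup>2 * pcov n x y)"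
    by (simp add: algebra_simps add_divide_distrib diff_divide_distrib)
  finally show ?thesis by (simp add: m_def abs_mult)
qed

text \<open>
  For fixed \<open>u\<close> the modulus of the integrand is a product of a function of \<open>x\<close> and a function of \<open>y\<close>, each with
  the \<open>L\<^sup>1\<close> norm of the Dirichlet kernel.
\<close>

lemma pcov_L1_le:
  assumes n: "1 \<le> n"
  shows "(\<integral>\<^sup>+p. ennreal \<bar>pcov n (fst p) (snd p)\<bar> \<partial>(unif_circle \<Otimes>\<^sub>M unif_circle)) \<le> ennreal ((2 + 8 * (ln pi + ln (real n)))\<^sup>2 / real n)"
proof -
  interpret U: prob_space unif_circle by (rule prob_space_unif_circle)
  interpret UU: pair_prob_space unif_circle unif_circle ..
  interpret P: pair_prob_space \<mu> "unif_circle \<Otimes>\<^sub>M unif_circle" ..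
  define lam where "lam = 2 + 8 * (ln pi + ln (real n))"
  have lam: "0 \<le> lam" using n pi_gt3 by (simp add: lam_def)
  let ?f = "\<lambda>u p. ennreal (norm (dirichlet n (fst p - u))) * ennreal (norm (dirichlet n (snd p - u)))"
  have "ennreal \<bar>pcov n x y\<bar> \<le> ennreal (1 / real n) * (\<integral>\<^sup>+u. ?f u (x, y) \<partial>\<mu>)" for x y
  proof -
    let ?g = "\<lambda>u. Re (dirichlet n (x - u) * cnj (dirichlet n (y - u)))"
    have gb: "\<bar>?g u\<bar> \<le> norm (dirichlet n (x - u)) * norm (dirichlet n (y - u))" for u
      using abs_Re_le_cmod[of "dirichlet n (x - u) * cnj (dirichlet n (y - u))"] by (simp add: norm_mult)
    have gm: "?g \<in> borel_measurable borel"
    proof -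
      have "?g = (\<lambda>u. Re (dirichlet n (x - u)) * Re (dirichlet n (y - u)) + Im (dirichlet n (x - u)) * Im (dirichlet n (y - u)))"
        by (simp add: fun_eq_iff)
      then show ?thesis by simp
    qed
    have "integrable \<mu> ?g"
    proof (rule integrable_bounded_mu[where C="real n * real n", OF gm])
      show "\<bar>?g u\<bar> \<le> real n * real n" for u
        by (rule order_trans[OF gb]) (intro mult_mono norm_dirichlet_le; simp)
    qed
    then have "ennreal (norm (LINT u|\<mu>. ?g u)) \<le> (\<integral>\<^sup>+u. ennreal (norm (?g u)) \<partial>\<mu>)"
      by (rule integral_norm_bound_ennreal)
    also have "\<dots> \<le> (\<integral>\<^sup>+u. ?f u (x, y) \<partial>\<mu>)"
      using gb by (intro nn_integral_mono) (auto simp flip: ennreal_mult intro!: ennreal_leI)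
    finally have "ennreal (1 / real n) * ennreal (norm (LINT u|\<mu>. ?g u)) \<le> ennreal (1 / real n) * (\<integral>\<^sup>+u. ?f u (x, y) \<partial>\<mu>)"
      by (rule mult_left_mono) auto
    then show ?thesis by (simp add: pcov_def abs_divide flip: ennreal_mult)
  qed
  then have "(\<integral>\<^sup>+p. ennreal \<bar>pcov n (fst p) (snd p)\<bar> \<partial>(unif_circle \<Otimes>\<^sub>M unif_circle))
     \<le> (\<integral>\<^sup>+p. ennreal (1 / real n) * (\<integral>\<^sup>+u. ?f u p \<partial>\<mu>) \<partial>(unif_circle \<Otimes>\<^sub>M unif_circle))"
    by (intro nn_integral_mono) (auto split: prod.split)
  also have "\<dots> = ennreal (1 / real n) * (\<integral>\<^sup>+p. (\<integral>\<^sup>+u. ?f u p \<partial>\<mu>) \<partial>(unif_circle \<Otimes>\<^sub>M unif_circle))"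
    by (rule nn_integral_cmult) measurable
  also have "(\<integral>\<^sup>+p. (\<integral>\<^sup>+u. ?f u p \<partial>\<mu>) \<partial>(unif_circle \<Otimes>\<^sub>M unif_circle)) = (\<integral>\<^sup>+u. (\<integral>\<^sup>+p. ?f u p \<partial>(unif_circle \<Otimes>\<^sub>M unif_circle)) \<partial>\<mu>)"
    by (rule P.Fubini') measurable
  also have "ennreal (1 / real n) * \<dots> \<le> ennreal (1 / real n) * (\<integral>\<^sup>+u. ennreal (lam\<^sup>2) \<partial>\<mu>)"
  proof (intro mult_left_mono nn_integral_mono_AE)
    show "AE u in \<mu>. (\<integral>\<^sup>+p. ?f u p \<partial>(unif_circle \<Otimes>\<^sub>M unif_circle)) \<le> ennreal (lam\<^sup>2)"
      using support
    proof eventually_elim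
      case (elim u)
      define D where "D = (\<integral>\<^sup>+x. ennreal (norm (dirichlet n (x - u))) \<partial>unif_circle)"
      have D: "D \<le> ennreal lam" unfolding D_def lam_def by (rule nn_integral_unif_dirichlet_le[OF n elim])
      have "(\<integral>\<^sup>+p. ?f u p \<partial>(unif_circle \<Otimes>\<^sub>M unif_circle)) = (\<integral>\<^sup>+x. (\<integral>\<^sup>+y. ?f u (x, y) \<partial>unif_circle) \<partial>unif_circle)"
        by (rule U.nn_integral_fst[symmetric]) measurable
      also have "\<dots> = D * D"
        unfolding fst_conv snd_conv D_def by (subst nn_integral_cmult, measurable, subst nn_integral_multc) auto
      also have "\<dots> \<le> ennreal lam * ennreal lam" using D by (intro mult_mono) auto
      also have "\<dots> = ennreal (lam\<^sup>2)" using lam by (simp add: power2_eq_square ennreal_mult)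
      finally show ?case .
    qed
  qed simp
  also have "(\<integral>\<^sup>+u. ennreal (lam\<^sup>2) \<partial>\<mu>) = ennreal (lam\<^sup>2)" by (simp add: spectral.emeasure_space_1)
  also have "ennreal (1 / real n) * ennreal (lam\<^sup>2) = ennreal (lam\<^sup>2 / real n)"
    by (simp flip: ennreal_mult)
  finally show ?thesis by (simp only: lam_def)
qed

lemma emp_char_variance_le:
  assumes n: "1 \<le> n"
  shows "(\<integral>\<^sup>+\<omega>. ennreal ((norm (emp_char n t \<omega> - mean_char n t))\<^sup>2) \<partial>M) \<le> ennreal (t\<^sup>2 * ((2 + 8 * (ln pi + ln (real n)))\<^sup>2 / real n))"
proof -
  interpret U: prob_space unif_circle by (rule prob_space_unif_circle)
  define W where "W \<omega> x = iexp (t * trig_poly a b n \<omega> x) - complex_of_real (exp (- (t\<^sup>2 * pcov n x x) / 2))" for \<omega> x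
  note [measurable] = trig_poly_measurable_snd trig_poly_measurable[of unif_circle]
  have mx: "exp (- (t\<^sup>2 * pcov n x x) / 2) \<le> 1" for x using pcov_diag_nonneg[of n x] by simp
  have "emp_char n t \<omega> - mean_char n t = (CLINT x|unif_circle. W \<omega> x)" for \<omega>
  proof -
    have "integrable unif_circle (\<lambda>x. iexp (t * trig_poly a b n \<omega> x))"
      by (rule U.integrable_const_bound[where B=1]) auto
    moreover have "integrable unif_circle (\<lambda>x. complex_of_real (exp (- (t\<^sup>2 * pcov n x x) / 2)))"
      by (rule U.integrable_const_bound[where B=1]) (use mx in auto)
    ultimately show ?thesis unfolding emp_char_def mean_char_def W_def
      by (simp only: Bochner_Integration.integral_diff integral_complex_of_real)
  qed
  then have "(\<integral>\<^sup>+\<omega>. ennreal ((norm (emp_char n t \<omega> - mean_char n t))\<^sup>2) \<partial>M) = (\<integral>\<^sup>+\<omega>. ennreal ((norm (CLINT x|unif_circle. W \<omega> x))\<^sup>2) \<partial>M)"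
    by simp
  also have "\<dots> \<le> (\<integral>\<^sup>+p. ennreal (norm (CLINT \<omega>|M. W \<omega> (fst p) * cnj (W \<omega> (snd p)))) \<partial>(unif_circle \<Otimes>\<^sub>M unif_circle))"
  proof (rule second_moment_of_average_le[OF prob_space_axioms prob_space_unif_circle, where B=2])
    have "(\<lambda>p. iexp (t * (case p of (\<omega>, x) \<Rightarrow> trig_poly a b n \<omega> x)) - complex_of_real (exp (- (t\<^sup>2 * pcov n (snd p) (snd p)) / 2)))
      \<in> borel_measurable (M \<Otimes>\<^sub>M unif_circle)"
      by measurable
    then show "case_prod W \<in> borel_measurable (M \<Otimes>\<^sub>M unif_circle)"
      by (simp add: W_def case_prod_beta')
    show "norm (W \<omega> x) \<le> 2" for \<omega> x
      unfolding W_def by (rule order_trans[OF norm_triangle_ineq4]) (use mx[of x] in auto)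
  qed
  also have "\<dots> \<le> (\<integral>\<^sup>+p. ennreal (t\<^sup>2) * ennreal \<bar>pcov n (fst p) (snd p)\<bar> \<partial>(unif_circle \<Otimes>\<^sub>M unif_circle))"
    using covariance_of_char_le[of t n] unfolding W_def
    by (intro nn_integral_mono) (auto simp flip: ennreal_mult intro!: ennreal_leI)
  also have "\<dots> = ennreal (t\<^sup>2) * (\<integral>\<^sup>+p. ennreal \<bar>pcov n (fst p) (snd p)\<bar> \<partial>(unif_circle \<Otimes>\<^sub>M unif_circle))"
  proof (rule nn_integral_cmult)
    have "(\<lambda>p. Re (dirichlet n (fst p - u) * cnj (dirichlet n (snd p - u)))) = (\<lambda>p. Re (dirichlet n (fst p - u)) * Re (dirichlet n (snd p - u)) + Im (dirichlet n (fst p - u)) * Im (dirichlet n (snd p - u)))" for u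
      by (simp add: fun_eq_iff)
    then show "(\<lambda>p. ennreal \<bar>pcov n (fst p) (snd p)\<bar>) \<in> borel_measurable (unif_circle \<Otimes>\<^sub>M unif_circle)"
      unfolding pcov_def by simp
  qed
  also have "\<dots> \<le> ennreal (t\<^sup>2) * ennreal ((2 + 8 * (ln pi + ln (real n)))\<^sup>2 / real n)"
    by (intro mult_left_mono pcov_L1_le n) auto
  also have "\<dots> = ennreal (t\<^sup>2 * ((2 + 8 * (ln pi + ln (real n)))\<^sup>2 / real n))"
    by (rule ennreal_mult[symmetric]) auto
  finally show ?thesis .
qed

lemma emp_char_measurable: "emp_char n t \<in> borel_measurable M"
proof -
  interpret U: prob_space unif_circle by (rule prob_space_unif_circle)
  note [measurable] = trig_poly_measurable[of unif_circle]
  have "(\<lambda>p. iexp (t * (case p of (\<omega>, x) \<Rightarrow> trig_poly a b n \<omega> x))) \<in> borel_measurable (M \<Otimes>\<^sub>M unif_circle)"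
    by measurable
  then have "(\<lambda>(\<omega>, x). iexp (t * trig_poly a b n \<omega> x)) \<in> borel_measurable (M \<Otimes>\<^sub>M unif_circle)"
    by (simp add: case_prod_beta')
  then show ?thesis unfolding emp_char_def by (rule U.borel_measurable_lebesgue_integral)
qed

text \<open>
  At \<open>n = j\<^sup>4\<close> one has \<open>log n \<le> 4 j\<close>, so the variance is \<open>O(j\<^sup>2 / j\<^sup>4)\<close>, which is summable.
\<close>

lemma emp_char_subsequence:
  "AE \<omega> in M. (\<lambda>j. emp_char (j ^ 4) t \<omega> - mean_char (j ^ 4) t) \<longlonglongrightarrow> 0"
proof -
  note [measurable] = emp_char_measurable
  define C where "C = 2 + 8 * ln pi + 32"
  have lp: "0 \<le> ln pi" using pi_gt3 by simp
  have "AE \<omega> in M. (\<lambda>j. (norm (emp_char (j ^ 4) t \<omega> - mean_char (j ^ 4) t))\<^sup>2) \<longlonglongrightarrow> 0"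
  proof (rule AE_tendsto_0_of_inverse_square[where C="t\<^sup>2 * C\<^sup>2"])
    fix j :: nat assume j: "1 \<le> j"
    have "ln (real (j ^ 4)) = 4 * ln (real j)" using j by (simp add: ln_realpow)
    also have "\<dots> \<le> 4 * real j" using ln_le_minus_one[of "real j"] j by simp
    finally have lj: "ln (real (j ^ 4)) \<le> 4 * real j" .
    have "2 + 8 * (ln pi + ln (real (j ^ 4))) \<le> 2 * real j + 8 * ln pi * real j + 32 * real j"
    proof -
      have "8 * ln pi * 1 \<le> 8 * ln pi * real j" using lp j by (intro mult_left_mono) auto
      then show ?thesis using lj j by simp
    qed
    also have "\<dots> = C * real j" by (simp add: C_def algebra_simps)
    finally have "(2 + 8 * (ln pi + ln (real (j ^ 4))))\<^sup>2 \<le> (C * real j)\<^sup>2"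
      using lp j by (intro power_mono) auto
    then have "(2 + 8 * (ln pi + ln (real (j ^ 4))))\<^sup>2 / real (j ^ 4) \<le> (C * real j)\<^sup>2 / real (j ^ 4)"
      by (rule divide_right_mono) simp
    also have "\<dots> = C\<^sup>2 / (real j)\<^sup>2" using j by (simp add: field_simps power2_eq_square power4_eq_xxxx)
    finally have "t\<^sup>2 * ((2 + 8 * (ln pi + ln (real (j ^ 4))))\<^sup>2 / real (j ^ 4)) \<le> t\<^sup>2 * (C\<^sup>2 / (real j)\<^sup>2)"
      by (rule mult_left_mono) simp
    then show "(\<integral>\<^sup>+\<omega>. ennreal ((norm (emp_char (j ^ 4) t \<omega> - mean_char (j ^ 4) t))\<^sup>2) \<partial>M) \<le> ennreal (t\<^sup>2 * C\<^sup>2 / (real j)\<^sup>2)"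
      using order_trans[OF emp_char_variance_le[of "j ^ 4" t] ennreal_leI] j by simp
  qed auto
  then show ?thesis
  proof eventually_elim
    case (elim \<omega>)
    from tendsto_real_sqrt[OF elim] show ?case by (simp add: tendsto_norm_zero_iff)
  qed
qed

end

section \<open>From fourth powers to all degrees\<close>

lemma tendsto_from_fourth_powers:
  fixes x :: "nat \<Rightarrow> complex"
  assumes sub: "(\<lambda>j. x (j ^ 4)) \<longlonglongrightarrow> l" and z: "z \<longlonglongrightarrow> (0::real)"
    and osc: "\<And>j n. 1 \<le> j \<Longrightarrow> j ^ 4 \<le> n \<Longrightarrow> n < Suc j ^ 4 \<Longrightarrow> (norm (x n - x (j ^ 4)))\<^sup>2 \<le> z j"
  shows "x \<longlonglongrightarrow> l"
proof (rule LIMSEQ_I)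
  fix r :: real assume r: "0 < r"
  have "\<forall>\<^sub>F j in sequentially. norm (x (j ^ 4) - l) < r / 2"
    using tendstoD[OF sub, of "r / 2"] r by (simp add: dist_norm)
  moreover have "\<forall>\<^sub>F j in sequentially. z j < (r / 2)\<^sup>2"
    by (rule order_tendstoD[OF z]) (use r in auto)
  ultimately have "\<forall>\<^sub>F j in sequentially. norm (x (j ^ 4) - l) < r / 2 \<and> z j < (r / 2)\<^sup>2"
    by eventually_elim auto
  then obtain J where J: "\<And>j. J \<le> j \<Longrightarrow> norm (x (j ^ 4) - l) < r / 2 \<and> z j < (r / 2)\<^sup>2"
    by (auto simp: eventually_sequentially)
  show "\<exists>no. \<forall>n\<ge>no. norm (x n - l) < r"
  proof (intro exI allI impI)
    (* Suc J instead of J keeps the block index positive. *)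
    fix n assume n: "(Suc J) ^ 4 \<le> n"
    define j where "j = Greatest (\<lambda>j. j ^ 4 \<le> n)"
    have bnd: "\<And>i. i ^ 4 \<le> n \<Longrightarrow> i \<le> n" by (metis le_trans self_le_power zero_less_numeral le0 not_less_eq_eq One_nat_def)
    have j1: "j ^ 4 \<le> n" unfolding j_def by (rule GreatestI_nat[where P="\<lambda>j. j ^ 4 \<le> n", OF n bnd])
    have j2: "Suc J \<le> j" unfolding j_def by (rule Greatest_le_nat[where P="\<lambda>j. j ^ 4 \<le> n", OF n bnd])
    have j3: "n < Suc j ^ 4"
    proof (rule ccontr)
      assume "\<not> n < Suc j ^ 4"
      then have "Suc j ^ 4 \<le> n" by (simp only: not_less)
      from Greatest_le_nat[where P="\<lambda>j. j ^ 4 \<le> n", OF this bnd] have "Suc j \<le> j" by (simp only: j_def)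
      then show False by simp
    qed
    have "(norm (x n - x (j ^ 4)))\<^sup>2 < (r / 2)\<^sup>2" using osc[OF _ j1 j3] J[of j] j2 by force
    then have "norm (x n - x (j ^ 4)) < r / 2" by (rule power_less_imp_less_base) (use r in auto)
    moreover have "norm (x (j ^ 4) - l) < r / 2" using J[of j] j2 by auto
    ultimately show "norm (x n - l) < r"
      using norm_triangle_ineq[of "x n - x (j ^ 4)" "x (j ^ 4) - l"] by simp
  qed
qed

lemma norm_iexp_diff_le: "norm (iexp x - iexp y) \<le> \<bar>x - y\<bar>"
proof -
  have "iexp x - iexp y = iexp y * (iexp (x - y) - 1)"
    by (simp add: algebra_simps flip: exp_add)
  then have "norm (iexp x - iexp y) = norm (iexp (x - y) - 1)"
    by (simp add: norm_mult)
  also have "\<dots> \<le> \<bar>x - y\<bar>" using iexp_approx1[of "x - y" 0] by simp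
  finally show ?thesis .
qed

lemma fourth_power_gap:
  assumes j: "1 \<le> j"
  shows "real (Suc j ^ 4) - real (j ^ 4) \<le> 15 * real j ^ 3"
proof -
  have j1: "1 \<le> real j" using j by simp
  have "real j ^ 1 \<le> real j ^ 3" "real j ^ 2 \<le> real j ^ 3" "1 \<le> real j ^ 3"
    using j1 power_increasing[of 1 3 "real j"] power_increasing[of 2 3 "real j"] one_le_power[of "real j" 3] by auto
  moreover have "real (Suc j ^ 4) - real (j ^ 4) = 4 * real j ^ 3 + 6 * real j ^ 2 + 4 * real j ^ 1 + 1"
    by (simp add: power4_eq_xxxx power3_eq_cube power2_eq_square algebra_simps)
  ultimately show ?thesis by linarith
qed

text \<open>
  Bounds the squared change of the factor in front of the \<open>k\<close>-th coefficients while the degree runs from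
  \<open>j\<^sup>4\<close> to \<open>(j + 1)\<^sup>4\<close>: for \<open>k \<le> j\<^sup>4\<close> only the normalisation changes, later coefficients enter anew.
  The constant is \<open>225 = 15\<^sup>2\<close>, where \<open>15 j\<^sup>3\<close> bounds the length of the block.
\<close>

definition osc_weight :: "nat \<Rightarrow> nat \<Rightarrow> real" where
  "osc_weight j k = (if k \<le> j ^ 4 then 225 / (real (j ^ 4) * (real j)\<^sup>2) else 1 / real (j ^ 4))"

lemma osc_weight_nonneg: "0 \<le> osc_weight j k"
  by (simp add: osc_weight_def)

lemma normalisation_diff_le:
  assumes j: "1 \<le> j" and n: "j ^ 4 \<le> n" "n < Suc j ^ 4"
  shows "(1 / sqrt (real n) - (if k \<le> j ^ 4 then 1 / sqrt (real (j ^ 4)) else 0))\<^sup>2 \<le> osc_weight j k"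
proof -
  define m where "m = real (j ^ 4)"
  define N where "N = real n"
  have m: "0 < m" "m \<le> N" using j n(1) by (auto simp: m_def N_def simp del: of_nat_power)
  show ?thesis
  proof (cases "k \<le> j ^ 4")
    case True
    define r where "r = m / N"
    have r: "0 < r" "r \<le> 1" using m by (auto simp: r_def)
    have "1 / sqrt N = sqrt r / sqrt m" using m by (simp add: r_def real_sqrt_divide)
    then have "(1 / sqrt N - 1 / sqrt m)\<^sup>2 = ((sqrt r - 1) / sqrt m)\<^sup>2" by (simp add: diff_divide_distrib)
    also have "\<dots> = (1 - sqrt r)\<^sup>2 / m" using m by (simp add: power_divide power2_commute)
    also have "\<dots> \<le> (15 / real j)\<^sup>2 / m"
    proof (intro divide_right_mono power_mono)
      have "r \<le> sqrt r" using r by (simp add: real_le_rsqrt power2_eq_square mult_left_le_one_le)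
      then have "1 - sqrt r \<le> 1 - r" by simp
      also have "\<dots> = (N - m) / N" using m by (simp add: r_def diff_divide_distrib)
      also have "\<dots> \<le> (15 * real j ^ 3) / m"
      proof (rule frac_le)
        have "N \<le> real (Suc j ^ 4)" using n(2) by (simp add: N_def del: of_nat_power)
        then show "N - m \<le> 15 * real j ^ 3" using fourth_power_gap[OF j] by (simp add: m_def)
      qed (use m in auto)
      also have "\<dots> = 15 / real j" using j by (simp add: m_def power4_eq_xxxx power3_eq_cube)
      finally show "1 - sqrt r \<le> 15 / real j" .
    qed (use r m in auto)
    also have "\<dots> = 225 / (m * (real j)\<^sup>2)" by (simp add: power_divide)
    finally show ?thesis using True by (simp add: osc_weight_def m_def N_def)
  next
    case False
    have "(1 / sqrt N)\<^sup>2 = 1 / N" using m by (simp add: power_divide)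
    also have "\<dots> \<le> 1 / m" using m by (intro divide_left_mono) auto
    finally show ?thesis using False by (simp add: osc_weight_def m_def N_def)
  qed
qed

lemma sum_osc_weight_le:
  assumes j: "1 \<le> j"
  shows "(\<Sum>k=1..Suc j ^ 4. osc_weight j k) \<le> 240 / real j"
proof -
  have le: "j ^ 4 \<le> Suc j ^ 4" by (rule power_mono) auto
  have "{1..Suc j ^ 4} = {1..j ^ 4} \<union> {Suc (j ^ 4)..Suc j ^ 4}"
    using le by (intro set_eqI) (simp only: Un_iff atLeastAtMost_iff, linarith)
  then have "(\<Sum>k=1..Suc j ^ 4. osc_weight j k) = (\<Sum>k=1..j ^ 4. osc_weight j k) + (\<Sum>k=Suc (j ^ 4)..Suc j ^ 4. osc_weight j k)"
    by (simp add: sum.union_disjoint)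
  also have "(\<Sum>k=1..j ^ 4. osc_weight j k) = real (j ^ 4) * (225 / (real (j ^ 4) * (real j)\<^sup>2))"
    by (simp add: osc_weight_def)
  also have "\<dots> = 225 / (real j)\<^sup>2" using j by (simp only: times_divide_eq_right, subst mult_divide_mult_cancel_left) auto
  also have "(\<Sum>k=Suc (j ^ 4)..Suc j ^ 4. osc_weight j k) = (real (Suc j ^ 4) - real (j ^ 4)) * (1 / real (j ^ 4))"
    using le by (simp add: osc_weight_def of_nat_diff)
  also have "\<dots> \<le> (15 * real j ^ 3) * (1 / real (j ^ 4))"
    by (rule mult_right_mono[OF fourth_power_gap[OF j]]) simp
  also have "\<dots> = 15 / real j" using j by (simp add: power4_eq_xxxx power3_eq_cube)
  also have "225 / (real j)\<^sup>2 \<le> 225 / real j"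
    using j by (intro divide_left_mono) (auto simp: power2_eq_square)
  finally show ?thesis by simp
qed

context gaussian_pair
begin

text \<open>
  The map \<open>z \<mapsto> e\<^bsup>itz\<^esup>\<close> is Lipschitz with constant \<open>|t|\<close>, so the increment is at most \<open>|t|\<close> times the \<open>L\<^sup>2\<close> norm of
  \<open>f\<^sub>n - f\<^sub>m\<close> in \<open>x\<close>, which Parseval's identity computes.
\<close>

lemma emp_char_increment_le:
  assumes mn: "m \<le> n"
  shows "(norm (emp_char n t \<omega> - emp_char m t \<omega>))\<^sup>2 \<le> t\<^sup>2 * ((\<Sum>k=1..n. (1 / sqrt (real n) - (if k \<le> m then 1 / sqrt (real m) else 0))\<^sup>2
      * ((a k \<omega>)\<^sup>2 + (b k \<omega>)\<^sup>2)) / 2)"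
proof -
  interpret U: prob_space unif_circle by (rule prob_space_unif_circle)
  note [measurable] = trig_poly_measurable_snd
  define w where "w k = 1 / sqrt (real n) - (if k \<le> m then 1 / sqrt (real m) else 0)" for k
  define S where "S = (\<Sum>k=1..n. (w k)\<^sup>2 * ((a k \<omega>)\<^sup>2 + (b k \<omega>)\<^sup>2))"
  define g where "g x = trig_poly a b n \<omega> x - trig_poly a b m \<omega> x" for x
  have gm[measurable]: "g \<in> borel_measurable borel" unfolding g_def by measurable
  have g: "g x = (\<Sum>k=1..n. (w k * a k \<omega>) * cos (real k * x) + (w k * b k \<omega>) * sin (real k * x))" for x
  proof -
    have "trig_poly a b m \<omega> x = (\<Sum>k=1..m. 1 / sqrt (real m) * (a k \<omega> * cos (real k * x) + b k \<omega> * sin (real k * x)))"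
      by (simp add: trig_poly_def sum_distrib_left)
    also have "\<dots> = (\<Sum>k=1..n. (if k \<le> m then 1 / sqrt (real m) else 0) * (a k \<omega> * cos (real k * x) + b k \<omega> * sin (real k * x)))"
      by (rule sum.mono_neutral_cong_left) (use mn in auto)
    finally show ?thesis unfolding g_def
      by (simp add: trig_poly_def[of a b n] sum_distrib_left sum_subtractf[symmetric] w_def algebra_simps)
  qed
  have sq: "(\<integral>\<^sup>+x. ennreal ((g x)\<^sup>2) \<partial>unif_circle) = ennreal (S / 2)"
  proof -
    have "(\<integral>\<^sup>+x. ennreal ((g x)\<^sup>2) \<partial>unif_circle) = ennreal (1 / (2 * pi)) * (\<integral>\<^sup>+x\<in>{0..0 + 2 * pi}. ennreal ((g x)\<^sup>2) \<partial>lborel)"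
      by (subst nn_integral_unif_circle) auto
    also have "\<dots> = ennreal (1 / (2 * pi)) * ennreal (pi * S)"
      unfolding g nn_integral_trig_square by (simp add: S_def power_mult_distrib distrib_left)
    also have "\<dots> = ennreal (S / 2)"
      by (subst ennreal_mult[symmetric]) (auto simp: S_def sum_nonneg)
    finally show ?thesis .
  qed
  have S0: "0 \<le> S" by (auto simp: S_def sum_nonneg)
  have i2: "integrable unif_circle (\<lambda>x. (g x)\<^sup>2)"
    by (rule integrableI_nonneg) (auto simp: sq)
  have E2: "(LINT x|unif_circle. (g x)\<^sup>2) = S / 2"
    by (subst integral_eq_nn_integral) (use S0 in \<open>auto simp: sq\<close>)
  have i1: "integrable unif_circle (\<lambda>x. \<bar>g x\<bar>)"
    by (rule U.square_integrable_imp_integrable) (use i2 in auto)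
  have int: "integrable unif_circle (\<lambda>x. iexp (t * trig_poly a b n \<omega> x))" for n
    by (rule U.integrable_const_bound[where B=1]) auto
  have "norm (emp_char n t \<omega> - emp_char m t \<omega>) = norm (CLINT x|unif_circle. iexp (t * trig_poly a b n \<omega> x) - iexp (t * trig_poly a b m \<omega> x))"
    unfolding emp_char_def using int by (simp only: Bochner_Integration.integral_diff)
  also have "\<dots> \<le> (LINT x|unif_circle. norm (iexp (t * trig_poly a b n \<omega> x) - iexp (t * trig_poly a b m \<omega> x)))"
    by (rule integral_norm_bound)
  also have "\<dots> \<le> (LINT x|unif_circle. \<bar>t\<bar> * \<bar>g x\<bar>)"
  proof (rule integral_mono)
    show "integrable unif_circle (\<lambda>x. norm (iexp (t * trig_poly a b n \<omega> x) - iexp (t * trig_poly a b m \<omega> x)))"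
      by (intro integrable_norm Bochner_Integration.integrable_diff int)
    show "integrable unif_circle (\<lambda>x. \<bar>t\<bar> * \<bar>g x\<bar>)" using i1 by simp
    show "norm (iexp (t * trig_poly a b n \<omega> x) - iexp (t * trig_poly a b m \<omega> x)) \<le> \<bar>t\<bar> * \<bar>g x\<bar>" for x
      using norm_iexp_diff_le[of "t * trig_poly a b n \<omega> x" "t * trig_poly a b m \<omega> x"]
      by (simp add: g_def flip: abs_mult right_diff_distrib)
  qed
  also have "\<dots> = \<bar>t\<bar> * (LINT x|unif_circle. \<bar>g x\<bar>)" by (rule integral_mult_right_zero)
  finally have "(norm (emp_char n t \<omega> - emp_char m t \<omega>))\<^sup>2 \<le> (\<bar>t\<bar> * (LINT x|unif_circle. \<bar>g x\<bar>))\<^sup>2"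
    by (rule power_mono) simp
  also have "\<dots> = t\<^sup>2 * (LINT x|unif_circle. \<bar>g x\<bar>)\<^sup>2" by (simp add: power_mult_distrib)
  also have "\<dots> \<le> t\<^sup>2 * (S / 2)"
  proof (rule mult_left_mono)
    have "U.variance (\<lambda>x. \<bar>g x\<bar>) = (LINT x|unif_circle. \<bar>g x\<bar>\<^sup>2) - (LINT x|unif_circle. \<bar>g x\<bar>)\<^sup>2"
      by (rule U.variance_eq) (use i1 i2 in auto)
    then show "(LINT x|unif_circle. \<bar>g x\<bar>)\<^sup>2 \<le> S / 2"
      using U.variance_positive[of "\<lambda>x. \<bar>g x\<bar>"] by (simp add: E2)
  qed simp
  finally show ?thesis by (simp add: S_def w_def)
qed

text \<open>
  Does not depend on the degree inside the block, so that one random variable per block controls all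
  increments in it.
\<close>

definition osc :: "nat \<Rightarrow> 'w \<Rightarrow> real" where
  "osc j \<omega> = (\<Sum>k=1..Suc j ^ 4. osc_weight j k * (((a k \<omega>)\<^sup>2 + (b k \<omega>)\<^sup>2) / 2))"

lemma emp_char_block_osc_le:
  assumes j: "1 \<le> j" and n: "j ^ 4 \<le> n" "n < Suc j ^ 4"
  shows "(norm (emp_char n t \<omega> - emp_char (j ^ 4) t \<omega>))\<^sup>2 \<le> t\<^sup>2 * osc j \<omega>"
proof -
  have "(norm (emp_char n t \<omega> - emp_char (j ^ 4) t \<omega>))\<^sup>2 \<le> t\<^sup>2 * ((\<Sum>k=1..n. (1 / sqrt (real n) - (if k \<le> j ^ 4 then 1 / sqrt (real (j ^ 4)) else 0))\<^sup>2
      * ((a k \<omega>)\<^sup>2 + (b k \<omega>)\<^sup>2)) / 2)"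
    by (rule emp_char_increment_le[OF n(1)])
  also have "\<dots> \<le> t\<^sup>2 * ((\<Sum>k=1..n. osc_weight j k * ((a k \<omega>)\<^sup>2 + (b k \<omega>)\<^sup>2)) / 2)"
    by (intro mult_left_mono divide_right_mono sum_mono mult_right_mono normalisation_diff_le[OF j n]) auto
  also have "\<dots> \<le> t\<^sup>2 * ((\<Sum>k=1..Suc j ^ 4. osc_weight j k * ((a k \<omega>)\<^sup>2 + (b k \<omega>)\<^sup>2)) / 2)"
    using n(2) by (intro mult_left_mono divide_right_mono sum_mono2) (auto simp: osc_weight_nonneg)
  also have "\<dots> = t\<^sup>2 * osc j \<omega>" by (simp add: osc_def sum_divide_distrib)
  finally show ?thesis .
qed

text \<open>
  Cauchy-Schwarz for the weights, whose sum is \<open>O(1/j)\<close>, and fourth moments equal to \<open>3\<close>. The first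
  moment, also of order \<open>1/j\<close>, would not be summable.
\<close>

lemma osc_second_moment_le:
  assumes j: "1 \<le> j"
  shows "(\<integral>\<^sup>+\<omega>. ennreal ((osc j \<omega>)\<^sup>2) \<partial>M) \<le> ennreal (3 * 240\<^sup>2 / (real j)\<^sup>2)"
proof -
  let ?K = "{1..Suc j ^ 4}"
  define V where "V = (\<Sum>k\<in>?K. osc_weight j k)"
  have V: "0 \<le> V" "V \<le> 240 / real j"
    using sum_osc_weight_le[OF j] by (auto simp: V_def sum_nonneg osc_weight_nonneg)
  define h where "h \<omega> = V * (\<Sum>k\<in>?K. osc_weight j k * ((a k \<omega> ^ 4 + b k \<omega> ^ 4) / 2))" for \<omega>
  have le: "(osc j \<omega>)\<^sup>2 \<le> h \<omega>" for \<omega>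
  proof -
    let ?q = "\<lambda>k. ((a k \<omega>)\<^sup>2 + (b k \<omega>)\<^sup>2) / 2"
    have "(osc j \<omega>)\<^sup>2 = (\<Sum>k\<in>?K. sqrt (osc_weight j k) * (sqrt (osc_weight j k) * ?q k))\<^sup>2"
      unfolding osc_def by (simp add: osc_weight_nonneg flip: mult.assoc)
    also have "\<dots> \<le> (\<Sum>k\<in>?K. (sqrt (osc_weight j k))\<^sup>2) * (\<Sum>k\<in>?K. (sqrt (osc_weight j k) * ?q k)\<^sup>2)"
      by (rule Cauchy_Schwarz_ineq_sum)
    also have "\<dots> = V * (\<Sum>k\<in>?K. osc_weight j k * (?q k)\<^sup>2)"
      by (simp only: V_def power_mult_distrib real_sqrt_pow2[OF osc_weight_nonneg])
    also have "\<dots> \<le> h \<omega>" unfolding h_def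
    proof (intro mult_left_mono sum_mono V osc_weight_nonneg)
      fix k
      have "0 \<le> ((a k \<omega>)\<^sup>2 - (b k \<omega>)\<^sup>2)\<^sup>2" by simp
      then show "(?q k)\<^sup>2 \<le> (a k \<omega> ^ 4 + b k \<omega> ^ 4) / 2"
        by (simp add: power2_eq_square power4_eq_xxxx field_simps)
    qed
    finally show ?thesis .
  qed
  have ia: "integrable M (\<lambda>\<omega>. osc_weight j k * ((a k \<omega> ^ 4 + b k \<omega> ^ 4) / 2))" if "k \<in> ?K" for k
    using seq_integrable_power[OF gauss_a, of k 4] seq_integrable_power[OF gauss_b, of k 4] that by auto
  have ih: "integrable M h"
    unfolding h_def by (intro integrable_mult_right Bochner_Integration.integrable_sum ia)
  have "(\<integral>\<^sup>+\<omega>. ennreal ((osc j \<omega>)\<^sup>2) \<partial>M) \<le> (\<integral>\<^sup>+\<omega>. ennreal (h \<omega>) \<partial>M)"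
    by (intro nn_integral_mono ennreal_leI le)
  also have "\<dots> = ennreal (LINT \<omega>|M. h \<omega>)"
    by (rule nn_integral_eq_integral[OF ih]) (use le order_trans zero_le_power2 in blast)
  also have "(LINT \<omega>|M. h \<omega>) = V * (\<Sum>k\<in>?K. (LINT \<omega>|M. osc_weight j k * ((a k \<omega> ^ 4 + b k \<omega> ^ 4) / 2)))"
    unfolding h_def by (subst integral_mult_right_zero, subst Bochner_Integration.integral_sum[OF ia]) auto
  also have "\<dots> = V * (\<Sum>k\<in>?K. osc_weight j k * 3)"
  proof (intro arg_cong[where f="\<lambda>s. V * s"] sum.cong refl)
    fix k assume "k \<in> ?K"
    then have k: "1 \<le> k" by simp
    show "(LINT \<omega>|M. osc_weight j k * ((a k \<omega> ^ 4 + b k \<omega> ^ 4) / 2)) = osc_weight j k * 3"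
      using seq_integrable_power[OF gauss_a k, of 4] seq_integrable_power[OF gauss_b k, of 4]
        seq_fourth[OF gauss_a k] seq_fourth[OF gauss_b k] by simp
  qed
  also have "\<dots> = 3 * V\<^sup>2" by (simp add: V_def sum_distrib_right[symmetric] power2_eq_square)
  also have "ennreal \<dots> \<le> ennreal (3 * 240\<^sup>2 / (real j)\<^sup>2)"
    using power_mono[OF V(2,1), of 2] by (intro ennreal_leI) (simp add: power_divide)
  finally show ?thesis .
qed

lemma osc_measurable: "osc j \<in> borel_measurable M"
  unfolding osc_def
proof (intro borel_measurable_sum)
  fix k assume "k \<in> {1..Suc j ^ 4}"
  then have [measurable]: "a k \<in> borel_measurable M" "b k \<in> borel_measurable M"
    using seq_measurable[OF gauss_a, of k] seq_measurable[OF gauss_b, of k] by auto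
  show "(\<lambda>\<omega>. osc_weight j k * (((a k \<omega>)\<^sup>2 + (b k \<omega>)\<^sup>2) / 2)) \<in> borel_measurable M" by measurable
qed

lemma osc_tendsto_0: "AE \<omega> in M. (\<lambda>j. osc j \<omega>) \<longlonglongrightarrow> 0"
proof -
  note [measurable] = osc_measurable
  have "AE \<omega> in M. (\<lambda>j. (osc j \<omega>)\<^sup>2) \<longlonglongrightarrow> 0"
    by (rule AE_tendsto_0_of_inverse_square[where C="3 * 240\<^sup>2"]) (use osc_second_moment_le in auto)
  then show ?thesis
  proof eventually_elim
    case (elim \<omega>)
    from tendsto_real_sqrt[OF elim] show ?case by (simp add: tendsto_rabs_zero_iff)
  qed
qed

theorem emp_char_tendsto:
  assumes "is_ac_density \<mu> \<psi>"
  shows "AE \<omega> in M. (\<lambda>n. emp_char n t \<omega>) \<longlonglongrightarrow> complex_of_real (LINT x|unif_circle. exp (- (t\<^sup>2 * (2 * pi * \<psi> x)) / 2))"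
  using emp_char_subsequence[of t] osc_tendsto_0
proof eventually_elim
  case (elim \<omega>)
  let ?l = "LINT x|unif_circle. exp (- (t\<^sup>2 * (2 * pi * \<psi> x)) / 2)"
  have "filterlim (\<lambda>j::nat. j ^ 4) sequentially sequentially"
    by (rule filterlim_subseq) (auto simp: strict_mono_def power_strict_mono)
  then have "(\<lambda>j. mean_char (j ^ 4) t) \<longlonglongrightarrow> ?l"
    by (rule filterlim_compose[OF mean_char_tendsto[OF assms]])
  then have "(\<lambda>j. complex_of_real (mean_char (j ^ 4) t)) \<longlonglongrightarrow> complex_of_real ?l"
    by (rule tendsto_of_real)
  from tendsto_add[OF elim(1) this] have "(\<lambda>j. emp_char (j ^ 4) t \<omega>) \<longlonglongrightarrow> complex_of_real ?l" by simp
  moreover have "(\<lambda>j. t\<^sup>2 * osc j \<omega>) \<longlonglongrightarrow> 0" using tendsto_mult_right_zero[OF elim(2)] by simp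
  ultimately show ?case
    by (rule tendsto_from_fourth_powers) (rule emp_char_block_osc_le)
qed

end

section \<open>All arguments simultaneously\<close>

context gaussian_pair
begin

lemma emp_char_jointly_measurable:
  assumes [measurable_cong]: "sets S = sets borel"
  shows "(\<lambda>p. emp_char n (fst p / c) (snd p)) \<in> borel_measurable (S \<Otimes>\<^sub>M M)"
proof -
  interpret U: prob_space unif_circle by (rule prob_space_unif_circle)
  have [measurable]: "(\<lambda>z. trig_poly a b n (snd (fst z)) (snd z)) \<in> borel_measurable ((S \<Otimes>\<^sub>M M) \<Otimes>\<^sub>M unif_circle)"
    using measurable_compose[OF _ trig_poly_measurable[of unif_circle n],
        of "\<lambda>z. (snd (fst z), snd z)" "(S \<Otimes>\<^sub>M M) \<Otimes>\<^sub>M unif_circle"] by simp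
  have "(\<lambda>(p, x). iexp (fst p / c * trig_poly a b n (snd p) x)) \<in> borel_measurable ((S \<Otimes>\<^sub>M M) \<Otimes>\<^sub>M unif_circle)"
    unfolding case_prod_beta' by measurable
  then show ?thesis unfolding emp_char_def by (rule U.borel_measurable_lebesgue_integral)
qed

text \<open>
  The null set may be chosen for all rationals and, by Fubini, for almost every argument at each of the
  countably many scales \<open>1 / Suc m\<close>.
\<close>

lemma emp_char_tendsto_all:
  assumes ac: "is_ac_density \<mu> \<psi>" and "prob_space Q" and X[measurable]: "X \<in> borel_measurable Q"
    and X_unif: "distr Q borel X = unif_circle"
    and \<nu>': "real_distribution \<nu>'" "\<And>t. char \<nu>' t = complex_of_real (LINT x|unif_circle. exp (- (t\<^sup>2 * (2 * pi * \<psi> x)) / 2))"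
  shows "AE \<omega> in M. \<forall>t. (\<lambda>n. char (distr Q borel (\<lambda>q. trig_poly a b n \<omega> (X q))) t) \<longlonglongrightarrow> char \<nu>' t"
proof -
  interpret Q: prob_space Q by fact
  note [measurable] = trig_poly_measurable_snd
  have emp_char: "char (distr Q borel (\<lambda>q. trig_poly a b n \<omega> (X q))) t = emp_char n t \<omega>" for n t \<omega>
    unfolding emp_char_def X_unif[symmetric] char_def by (simp add: integral_distr)
  have pt: "AE \<omega> in M. (\<lambda>n. emp_char n t \<omega>) \<longlonglongrightarrow> char \<nu>' t" for t
    using emp_char_tendsto[OF ac, of t] by (simp only: \<nu>'(2))
  have rat: "AE \<omega> in M. \<forall>q\<in>\<rat>. (\<lambda>n. emp_char n q \<omega>) \<longlonglongrightarrow> char \<nu>' q"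
    using pt by (intro AE_ball_countable') (auto simp: countable_rat)
  have ae: "AE \<omega> in M. \<forall>m. AE s in std_normal_distribution. (\<lambda>n. emp_char n (s / real (Suc m)) \<omega>) \<longlonglongrightarrow> char \<nu>' (s / real (Suc m))"
    unfolding AE_all_countable
  proof
    fix m
    show "AE \<omega> in M. AE s in std_normal_distribution. (\<lambda>n. emp_char n (s / real (Suc m)) \<omega>) \<longlonglongrightarrow> char \<nu>' (s / real (Suc m))"
    proof (rule AE_AE_tendsto_swap[OF _ prob_space_axioms])
      show "prob_space std_normal_distribution"
        using real_dist_normal_dist by (simp add: real_distribution_def)
      show "(\<lambda>p. emp_char n (fst p / real (Suc m)) (snd p)) \<in> borel_measurable (std_normal_distribution \<Otimes>\<^sub>M M)" for n
        by (rule emp_char_jointly_measurable) simp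
      show "(\<lambda>s. char \<nu>' (s / real (Suc m))) \<in> borel_measurable std_normal_distribution"
        using real_distribution.char_measurable[OF \<nu>'(1)] by simp
    qed (rule pt)
  qed
  from rat ae show ?thesis
  proof eventually_elim
    case (elim \<omega>)
    show ?case
    proof
      fix t
      show "(\<lambda>n. char (distr Q borel (\<lambda>q. trig_poly a b n \<omega> (X q))) t) \<longlonglongrightarrow> char \<nu>' t"
      proof (rule char_tendsto_from_rationals)
        show "real_distribution (distr Q borel (\<lambda>q. trig_poly a b n \<omega> (X q)))" for n
          by (rule Q.real_distribution_distr) measurable
      qed (use elim \<nu>'(1) in \<open>auto simp: emp_char\<close>)
    qed
  qed
qed

end

theorem theorem1p5:
  fixes \<mu> :: "real measure" and \<psi> :: "real \<Rightarrow> real"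
    and M :: "'w measure" and a b :: "nat \<Rightarrow> 'w \<Rightarrow> real"
    and Q :: "'v measure" and X N :: "'v \<Rightarrow> real"
  assumes "symmetric_spectral_measure \<mu>"
    and "is_ac_density \<mu> \<psi>"
    and "prob_space M"
    and "stationary_gaussian_seq M (spectral_cov \<mu>) a"
    and "stationary_gaussian_seq M (spectral_cov \<mu>) b"
    and "indep_sequences M a b"
    and "prob_space Q"
    and "distributed Q lborel X (\<lambda>x. indicator {0..2 * pi} x / measure lborel {0..2 * pi})"
    and "distributed Q lborel N std_normal_density"
    and "prob_space.indep_var Q borel X borel N"
  shows "AE \<omega> in M.
      (\<forall>t. (\<lambda>n. CLINT q|Q. iexp (t * trig_poly a b n \<omega> (X q)))
              \<longlonglongrightarrow> complex_of_real (1 / (2 * pi) *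
                     (LINT x:{0..2 * pi}|lborel. exp (- (t\<^sup>2 / 2 * (2 * pi * \<psi> x))))) \<and>
           complex_of_real (1 / (2 * pi) *
                     (LINT x:{0..2 * pi}|lborel. exp (- (t\<^sup>2 / 2 * (2 * pi * \<psi> x)))))
              = (CLINT q|Q. iexp (t * (sqrt (2 * pi * \<psi> (X q)) * N q)))) \<and>
      weak_conv_m (\<lambda>n. distr Q borel (\<lambda>q. trig_poly a b n \<omega> (X q)))
        (distr Q borel (\<lambda>q. sqrt (2 * pi * \<psi> (X q)) * N q))"
proof -
  interpret Q: prob_space Q by fact
  interpret gaussian_pair M \<mu> a b
    using assms(1,3-6) by (auto simp: gaussian_pair_def gaussian_pair_axioms_def symmetric_spectral_measure_def)
  have \<psi>[measurable]: "\<psi> \<in> borel_measurable borel" and \<psi>0: "\<And>x. 0 \<le> \<psi> x"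
    using assms(2) by (auto simp: is_ac_density_def)
  have [measurable]: "X \<in> borel_measurable Q" "N \<in> borel_measurable Q"
    using Q.indep_var_rv1[OF assms(10)] Q.indep_var_rv2[OF assms(10)] by auto
  have X_unif: "distr Q borel X = unif_circle"
    using distributed_distr_eq_density[OF assms(8)] by (simp cong: distr_cong)
  define \<nu>' where "\<nu>' = distr Q borel (\<lambda>q. sqrt (2 * pi * \<psi> (X q)) * N q)"
  have \<nu>': "real_distribution \<nu>'" unfolding \<nu>'_def by (rule Q.real_distribution_distr) measurable
  define L where "L t = (LINT x|unif_circle. exp (- (t\<^sup>2 * (2 * pi * \<psi> x)) / 2))" for t
  have mix: "(CLINT q|Q. iexp (t * (sqrt (2 * pi * \<psi> (X q)) * N q))) = complex_of_real (L t)" for t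
  proof -
    have "(CLINT q|Q. iexp (t * (sqrt (2 * pi * \<psi> (X q)) * N q)))
      = complex_of_real (LINT x|unif_circle. exp (- (t * sqrt (2 * pi * \<psi> x))\<^sup>2 / 2))"
      by (rule char_gaussian_scale_mixture[OF assms(7) X_unif assms(9,10)]) measurable
    then show ?thesis using \<psi>0 by (simp add: L_def power_mult_distrib)
  qed
  have char_\<nu>': "char \<nu>' t = complex_of_real (L t)" for t
    unfolding \<nu>'_def char_def mix[symmetric] by (simp add: integral_distr)
  have L_eq: "L t = 1 / (2 * pi) * (LINT x:{0..2 * pi}|lborel. exp (- (t\<^sup>2 / 2 * (2 * pi * \<psi> x))))" for t
    unfolding L_def by (subst integral_unif_circle) simp_all
  note [measurable] = trig_poly_measurable_snd
  have char_f: "char (distr Q borel (\<lambda>q. trig_poly a b n \<omega> (X q))) t = (CLINT q|Q. iexp (t * trig_poly a b n \<omega> (X q)))" for n t \<omega>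
    unfolding char_def by (simp add: integral_distr)
  have "AE \<omega> in M. \<forall>t. (\<lambda>n. char (distr Q borel (\<lambda>q. trig_poly a b n \<omega> (X q))) t) \<longlonglongrightarrow> char \<nu>' t"
    using assms(2,7) _ X_unif \<nu>' char_\<nu>'[unfolded L_def] by (rule emp_char_tendsto_all) measurable
  then show ?thesis
  proof eventually_elim
    case (elim \<omega>)
    have "weak_conv_m (\<lambda>n. distr Q borel (\<lambda>q. trig_poly a b n \<omega> (X q))) \<nu>'"
      using elim by (intro levy_continuity \<nu>' Q.real_distribution_distr) auto
    moreover have "(\<lambda>n. CLINT q|Q. iexp (t * trig_poly a b n \<omega> (X q))) \<longlonglongrightarrow> complex_of_real (L t)" for t
      using elim by (simp only: char_f char_\<nu>')
    ultimately show ?case by (simp only: mix L_eq[symmetric] \<nu>'_def) blast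
  qed
qed

end
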